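(* Let $c\in\mathbb{C}$ and let $\mathcal{W}^c_3$ be the Zamolodchikov $\mathcal{W}_3$-algebra with central charge $c$, with its involution $\theta$ ($\theta(L)=L$, $\theta(W)=-W$) generating $\mathbb{Z}_2$. (1) If $c \neq \frac{559 \pm 7\sqrt{76657}}{95}$, then the orbifold $(\mathcal{W}^c_3)^{\mathbb{Z}_2}$ is of type $\mathcal{W}(2,6,8,10,12)$. (2) If $c = \frac{559 \pm 7\sqrt{76657}}{95}$, then $(\mathcal{W}^c_3)^{\mathbb{Z}_2}$ is of type $\mathcal{W}(2,6,8,10,12,14)$.
   Context: For vertex algebra elements $a,b$, write $a(z)b(w)\sim\sum_{n\ge0}(a\circ_n b)(w)(z-w)^{-n-1}$ for the operator product expansion, and $:ab:$ for the normally ordered (Wick) product; iterated products are nested to the right, $:a_1a_2\cdots a_k:=\,:a_1(:a_2\cdots a_k:):$. For $c\neq-\frac{22}{5}$, $\mathcal{W}^c_3$ is the vertex algebra strongly generated by a Virasoro field $L$ and a weight $3$ primary field $W$ with OPEs $L(z)L(w)\sim \frac c2(z-w)^{-4}+2L(w)(z-w)^{-2}+\partial L(w)(z-w)^{-1}$, $L(z)W(w)\sim 3W(w)(z-w)^{-2}+\partial W(w)(z-w)^{-1}$, $W(z)W(w)\sim \frac c3(z-w)^{-6}+2L(w)(z-w)^{-4}+\partial L(w)(z-w)^{-3}+\big(\frac{32}{22+5c}:LL:+\frac{3(c-2)}{2(22+5c)}\partial^2L\big)(w)(z-w)^{-2}+\big(\frac{32}{22+5c}:(\partial L)L:+\frac{c-2}{3(22+5c)}\partial^3L\big)(w)(z-w)^{-1}$.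 For $c=-\frac{22}{5}$, $\mathcal{W}^{c}_3$ is defined by rescaling $W$ by $\sqrt{22+5c}$ and taking the limit $c\to-\frac{22}{5}$; the rescaled generator (still called $W$) satisfies the same OPEs with $L$ and $W(z)W(w)\sim(32:LL:-\frac{48}{5}\partial^2L)(w)(z-w)^{-2}+(32:(\partial L)L:-\frac{32}{15}\partial^3L)(w)(z-w)^{-1}$. For every $c$, $\mathcal{W}^c_3$ is freely generated by $L,W$, with PBW basis $:(\partial^{a_1}L)\cdots(\partial^{a_r}L)(\partial^{b_1}W)\cdots(\partial^{b_s}W):$, $a_1\ge\cdots\ge a_r\ge0$, $b_1\ge\cdots\ge b_s\ge0$. The map $\theta$ with $\theta(L)=L$, $\theta(W)=-W$ is an automorphism of order $2$, and $(\mathcal{W}^c_3)^{\mathbb{Z}_2}$ denotes its fixed-point subalgebra. A subset $S$ strongly generates a vertex algebra $\mathcal{A}$ if $\mathcal{A}$ is spanned by normally ordered monomials $:\partial^{k_1}a_{1}\cdots\partial^{k_m}a_{m}:$ with $a_i\in S$, $k_i\ge0$. $\mathcal{A}$ is of type $\mathcal{W}(d_1,\dots,d_r)$ if it has a minimal strong generating set consisting of one field in each conformal weight $d_1,\dots,d_r$. *)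

theory Defs
  imports Complex_Main
begin

text \<open>A vertex algebra over the complex numbers, given by a carrier type 'v with
  scalar multiplication sc, vacuum vector vac and the n-th products
  pr n a b (written a_(n) b, n an integer).  Axioms: vector space,
  bilinearity, truncation, vacuum axioms and the Borcherds identity.\<close>

definition fsum :: "(nat \<Rightarrow> 'v::comm_monoid_add) \<Rightarrow> 'v" where
  "fsum f = (\<Sum>j\<in>{j. f j \<noteq> 0}. f j)"

definition isign :: "int \<Rightarrow> complex" where
  "isign n = (if even n then 1 else -1)"

definition vertex_algebra ::
  "(complex \<Rightarrow> 'v::ab_group_add \<Rightarrow> 'v) \<Rightarrow> 'v \<Rightarrow> (int \<Rightarrow> 'v \<Rightarrow> 'v \<Rightarrow> 'v) \<Rightarrow> bool" where
  "vertex_algebra sc vac pr \<longleftrightarrow>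
     vector_space sc \<and>
     (\<forall>n a b c. pr n (a + b) c = pr n a c + pr n b c) \<and>
     (\<forall>n a b c. pr n a (b + c) = pr n a b + pr n a c) \<and>
     (\<forall>n r a b. pr n (sc r a) b = sc r (pr n a b)) \<and>
     (\<forall>n r a b. pr n a (sc r b) = sc r (pr n a b)) \<and>
     (\<forall>a b. \<exists>N. \<forall>n\<ge>N. pr n a b = 0) \<and>
     (\<forall>n a. pr n vac a = (if n = -1 then a else 0)) \<and>
     (\<forall>n a. n \<ge> 0 \<longrightarrow> pr n a vac = 0) \<and>
     (\<forall>a. pr (-1) a vac = a) \<and>
     (\<forall>m n k a b c.
        fsum (\<lambda>j. sc (of_int m gchoose j) (pr (m + k - int j) (pr (n + int j) a b) c))
        = fsum (\<lambda>j. sc ((-1) ^ j * (of_int n gchoose j))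
              (pr (m + n - int j) a (pr (k + int j) b c)
               - sc (isign n) (pr (n + k - int j) b (pr (m + int j) a c)))))"

definition tr :: "'v \<Rightarrow> (int \<Rightarrow> 'v \<Rightarrow> 'v \<Rightarrow> 'v) \<Rightarrow> 'v \<Rightarrow> 'v" where
  "tr vac pr a = pr (-2) a vac"

definition der :: "'v \<Rightarrow> (int \<Rightarrow> 'v \<Rightarrow> 'v \<Rightarrow> 'v) \<Rightarrow> nat \<Rightarrow> 'v \<Rightarrow> 'v" where
  "der vac pr k a = (tr vac pr ^^ k) a"

fun nmon :: "'v \<Rightarrow> (int \<Rightarrow> 'v \<Rightarrow> 'v \<Rightarrow> 'v) \<Rightarrow> 'v list \<Rightarrow> 'v" where
  "nmon vac pr [] = vac"
| "nmon vac pr (x # xs) = pr (-1) x (nmon vac pr xs)"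

definition strongly_generates ::
  "(complex \<Rightarrow> 'v::ab_group_add \<Rightarrow> 'v) \<Rightarrow> 'v \<Rightarrow> (int \<Rightarrow> 'v \<Rightarrow> 'v \<Rightarrow> 'v) \<Rightarrow> 'v set \<Rightarrow> 'v set \<Rightarrow> bool" where
  "strongly_generates sc vac pr S A \<longleftrightarrow>
     A = module.span sc
           {nmon vac pr (map (\<lambda>(k, a). der vac pr k a) ps) | ps. \<forall>p\<in>set ps. snd p \<in> S}"

text \<open>A is of type W(d_1,...,d_r) (conformal weights measured by L_(1) = L_0):
  it has a minimal strong generating set consisting of one field of each weight d_i.\<close>
definition of_type ::
  "(complex \<Rightarrow> 'v::ab_group_add \<Rightarrow> 'v) \<Rightarrow> 'v \<Rightarrow> (int \<Rightarrow> 'v \<Rightarrow> 'v \<Rightarrow> 'v) \<Rightarrow> 'v \<Rightarrow> 'v set \<Rightarrow> nat list \<Rightarrow> bool" where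
  "of_type sc vac pr L A ds \<longleftrightarrow>
     (\<exists>g :: nat \<Rightarrow> 'v.
        inj_on g {..<length ds} \<and>
        (\<forall>i<length ds. g i \<in> A \<and> pr 1 L (g i) = sc (of_nat (ds ! i)) (g i)) \<and>
        strongly_generates sc vac pr (g ` {..<length ds}) A \<and>
        (\<forall>S'. S' \<subset> g ` {..<length ds} \<longrightarrow> \<not> strongly_generates sc vac pr S' A))"

definition W3_opes ::
  "(complex \<Rightarrow> 'v::ab_group_add \<Rightarrow> 'v) \<Rightarrow> 'v \<Rightarrow> (int \<Rightarrow> 'v \<Rightarrow> 'v \<Rightarrow> 'v) \<Rightarrow> complex \<Rightarrow> 'v \<Rightarrow> 'v \<Rightarrow> bool" where
  "W3_opes sc vac pr c L W \<longleftrightarrow>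
     (\<forall>n::int. n \<ge> 0 \<longrightarrow> pr n L L =
        (if n = 3 then sc (c / 2) vac else if n = 1 then sc 2 L
         else if n = 0 then der vac pr 1 L else 0)) \<and>
     (\<forall>n::int. n \<ge> 0 \<longrightarrow> pr n L W =
        (if n = 1 then sc 3 W else if n = 0 then der vac pr 1 W else 0)) \<and>
     (c \<noteq> - 22 / 5 \<longrightarrow>
       (\<forall>n::int. n \<ge> 0 \<longrightarrow> pr n W W =
        (if n = 5 then sc (c / 3) vac
         else if n = 3 then sc 2 L
         else if n = 2 then der vac pr 1 L
         else if n = 1 then sc (32 / (22 + 5 * c)) (pr (-1) L L)
                          + sc (3 * (c - 2) / (2 * (22 + 5 * c))) (der vac pr 2 L)
         else if n = 0 then sc (32 / (22 + 5 * c)) (pr (-1) (der vac pr 1 L) L)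
                          + sc ((c - 2) / (3 * (22 + 5 * c))) (der vac pr 3 L)
         else 0))) \<and>
     (c = - 22 / 5 \<longrightarrow>
       (\<forall>n::int. n \<ge> 0 \<longrightarrow> pr n W W =
        (if n = 1 then sc 32 (pr (-1) L L) - sc (48 / 5) (der vac pr 2 L)
         else if n = 0 then sc 32 (pr (-1) (der vac pr 1 L) L) - sc (32 / 15) (der vac pr 3 L)
         else 0)))"

definition pbw_index :: "(nat list \<times> nat list) set" where
  "pbw_index = {(as, bs). sorted_wrt (\<ge>) as \<and> sorted_wrt (\<ge>) bs}"

definition pbw_mon :: "'v \<Rightarrow> (int \<Rightarrow> 'v \<Rightarrow> 'v \<Rightarrow> 'v) \<Rightarrow> 'v \<Rightarrow> 'v \<Rightarrow> nat list \<times> nat list \<Rightarrow> 'v" where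
  "pbw_mon vac pr L W ab =
     nmon vac pr (map (\<lambda>a. der vac pr a L) (fst ab) @ map (\<lambda>b. der vac pr b W) (snd ab))"

definition is_W3 ::
  "(complex \<Rightarrow> 'v::ab_group_add \<Rightarrow> 'v) \<Rightarrow> 'v \<Rightarrow> (int \<Rightarrow> 'v \<Rightarrow> 'v \<Rightarrow> 'v) \<Rightarrow> complex \<Rightarrow> 'v \<Rightarrow> 'v \<Rightarrow> bool" where
  "is_W3 sc vac pr c L W \<longleftrightarrow>
     vertex_algebra sc vac pr \<and> W3_opes sc vac pr c L W \<and>
     inj_on (pbw_mon vac pr L W) pbw_index \<and>
     \<not> module.dependent sc (pbw_mon vac pr L W ` pbw_index) \<and>
     module.span sc (pbw_mon vac pr L W ` pbw_index) = UNIV"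

definition va_automorphism ::
  "(complex \<Rightarrow> 'v::ab_group_add \<Rightarrow> 'v) \<Rightarrow> 'v \<Rightarrow> (int \<Rightarrow> 'v \<Rightarrow> 'v \<Rightarrow> 'v) \<Rightarrow> ('v \<Rightarrow> 'v) \<Rightarrow> bool" where
  "va_automorphism sc vac pr \<theta> \<longleftrightarrow>
     bij \<theta> \<and> (\<forall>a b. \<theta> (a + b) = \<theta> a + \<theta> b) \<and> (\<forall>r a. \<theta> (sc r a) = sc r (\<theta> a)) \<and>
     \<theta> vac = vac \<and> (\<forall>n a b. \<theta> (pr n a b) = pr n (\<theta> a) (\<theta> b))"

end

theory Submission
  imports Defs
begin

text \<open>The even subalgebra is spanned by words in the modes of \<open>L\<close> and an even number of modes of \<open>W\<close>.
  By quasi-associativity it is generated by \<open>L\<close> and the quadratic fields \<open>U n = w (- 1 - n) W\<close>, and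
  skew-symmetry removes odd \<open>n\<close>. To decide which \<open>U n\<close> are decomposable, consider the linear functionals
  that kill all decomposable fields. Commuting one mode of \<open>W\<close> through the Wick products of \<open>U 0\<close>
  and \<open>U 2\<close> with a quadratic field gives two relations: each multiplies the value at \<open>U (m + 6)\<close> by a
  polynomial in \<open>m\<close> and the structure constants. For even \<open>m \<ge> 4\<close> the two polynomials have no
  common zero, so \<open>U n\<close> is decomposable for all even \<open>n \<ge> 10\<close>. For \<open>m = 2\<close> (weight 14) only the first
  relation is available, and it degenerates exactly at the two exceptional central charges.
  Conversely, the remaining generators are needed: on the PBW basis one defines functionals that kill
  the left multiples of \<open>L\<close> and the total derivatives, take the value 1 on \<open>U n\<close>, and are corrected on quartic words so
  as to kill every product of generators of weight \<open>n + 6\<close>.\<close>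

section \<open>Calculus of modes in a vertex algebra\<close>

text \<open>Functionals replace a normal form. If \<open>f\<close> kills \<open>l n x\<close> for
  \<open>n < 0\<close> and even \<open>x\<close>, and also the derivatives of quadratic words, then
  every quadratic word takes a binomial multiple of a single value per weight. Identities between
  fields thus become scalar identities with polynomial coefficients. The obstacle is that commuting
  a mode of \<open>W\<close> through a product leaves words with four factors \<open>W\<close>,
  where \<open>f\<close> is unknown. The two relations avoid this: each combines orderings of the
  same letters with coefficients of sum zero (\<open>2 - 1 - 1\<close> and \<open>1 - 1\<close>), so
  only quadratic terms survive. The second relation carries the factor \<open>m - 2\<close>, hence
  says nothing in weight 14. At \<open>m = 2\<close> the bracket of the first one is
  \<open>- 25 / 32 * be * (475 * c * c - 5590 * c - 181248)\<close> once \<open>al\<close> and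
  \<open>ga\<close> are eliminated; the exceptional charges are the roots of this quadratic.
  Conversely, no product of two quadratic fields has weight below 12. There is one quartic
  \<open>W\<close>-word in weight 12 and there are two in weight 14, which is the number of
  corrections that the dual functionals need. At the exceptional charges the first relation ties the
  remaining products of weight 14 to these two.\<close>

lemma fsum_eq_sum: "(\<And>j. j \<ge> N \<Longrightarrow> f j = 0) \<Longrightarrow> fsum f = (\<Sum>j<N. f j)"
  unfolding fsum_def by (rule sum.mono_neutral_left) (auto simp: not_less[symmetric])

lemma gbinomial_unroll: "k \<noteq> 0 \<Longrightarrow> (a::complex) gchoose k = (a - of_nat (k - 1)) / of_nat k * (a gchoose (k - 1))"
proof (cases k)
  case (Suc j)
  then show ?thesis using gbinomial_absorb_comp[of a j] Suc_times_gbinomial[of j "a - 1"]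
      gbinomial_absorption[of j a] by (simp add: field_simps del: of_nat_Suc)
qed simp

lemma gchoose_num:
  fixes a :: complex
  shows "a gchoose 2 = a * (a - 1) / 2"
    and "a gchoose 3 = a * (a - 1) * (a - 2) / 6"
    and "a gchoose 4 = a * (a - 1) * (a - 2) * (a - 3) / 24"
    and "a gchoose 5 = a * (a - 1) * (a - 2) * (a - 3) * (a - 4) / 120"
    and "a gchoose 6 = a * (a - 1) * (a - 2) * (a - 3) * (a - 4) * (a - 5) / 720"
    and "a gchoose 7 = a * (a - 1) * (a - 2) * (a - 3) * (a - 4) * (a - 5) * (a - 6) / 5040"
    and "a gchoose 8 = a * (a - 1) * (a - 2) * (a - 3) * (a - 4) * (a - 5) * (a - 6) * (a - 7) / 40320"
    and "a gchoose 9 = a * (a - 1) * (a - 2) * (a - 3) * (a - 4) * (a - 5) * (a - 6) * (a - 7) * (a - 8) / 362880"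
  by (simp_all add: gbinomial_unroll)

lemma sum_lessThan_numeral:
  fixes g :: "nat \<Rightarrow> 'b::comm_monoid_add"
  shows "(\<Sum>j<4. g j) = g 0 + g 1 + g 2 + g 3" "(\<Sum>j<5. g j) = g 0 + g 1 + g 2 + g 3 + g 4"
    and "(\<Sum>j<6. g j) = g 0 + g 1 + g 2 + g 3 + g 4 + g 5"
    and "(\<Sum>j<8. g j) = g 0 + g 1 + g 2 + g 3 + g 4 + g 5 + g 6 + g 7"
    and "(\<Sum>j<9. g j) = g 0 + g 1 + g 2 + g 3 + g 4 + g 5 + g 6 + g 7 + g 8"
    and "(\<Sum>j<10. g j) = g 0 + g 1 + g 2 + g 3 + g 4 + g 5 + g 6 + g 7 + g 8 + g 9"
    and "(\<Sum>j<16. g j) = g 0 + g 1 + g 2 + g 3 + g 4 + g 5 + g 6 + g 7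
      + g 8 + g 9 + g 10 + g 11 + g 12 + g 13 + g 14 + g 15"
  by (simp_all add: eval_nat_numeral)

definition lin :: "(complex \<Rightarrow> 'v::ab_group_add \<Rightarrow> 'v) \<Rightarrow> ('v \<Rightarrow> complex) \<Rightarrow> bool" where
  "lin sc f \<longleftrightarrow> (\<forall>x y. f (x + y) = f x + f y) \<and> (\<forall>r x. f (sc r x) = r * f x)"

locale va =
  fixes sc :: "complex \<Rightarrow> 'v::ab_group_add \<Rightarrow> 'v" and vac :: 'v
    and pr :: "int \<Rightarrow> 'v \<Rightarrow> 'v \<Rightarrow> 'v"
  assumes vertex_algebra: "vertex_algebra sc vac pr"

sublocale va \<subseteq> vector_space sc
  using vertex_algebra by (simp add: vertex_algebra_def)

context va
begin

abbreviation T :: "'v \<Rightarrow> 'v" where "T \<equiv> tr vac pr"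

lemma pr_add_left: "pr n (a + b) x = pr n a x + pr n b x"
  and pr_add_right: "pr n a (x + y) = pr n a x + pr n a y"
  and pr_scale_left: "pr n (sc r a) x = sc r (pr n a x)"
  and pr_scale_right: "pr n a (sc r x) = sc r (pr n a x)"
  and pr_truncation: "\<exists>N. \<forall>n\<ge>N. pr n a x = 0"
  and pr_vac_left: "pr n vac x = (if n = -1 then x else 0)"
  and pr_vac_right: "n \<ge> 0 \<Longrightarrow> pr n a vac = 0"
  and pr_creation: "pr (-1) a vac = a"
  using vertex_algebra by (simp_all add: vertex_algebra_def)

lemma borcherds:
  "fsum (\<lambda>j. sc (of_int m gchoose j) (pr (m + k - int j) (pr (n + int j) a b) x))
   = fsum (\<lambda>j. sc ((-1) ^ j * (of_int n gchoose j))
       (pr (m + n - int j) a (pr (k + int j) b x) - sc (isign n) (pr (n + k - int j) b (pr (m + int j) a x))))"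
  using vertex_algebra unfolding vertex_algebra_def by blast

lemma pr_zero_left [simp]: "pr n 0 x = 0"
  using pr_scale_left[of n 0 0 x] by simp

lemma pr_zero_right [simp]: "pr n a 0 = 0"
  using pr_scale_right[of n a 0 0] by simp

lemma pr_minus_left: "pr n (- a) x = - pr n a x"
  using pr_scale_left[of n "-1" a x] by simp

lemma pr_minus_right: "pr n a (- x) = - pr n a x"
  using pr_scale_right[of n a "-1" x] by simp

lemma pr_diff_left: "pr n (a - b) x = pr n a x - pr n b x"
  using pr_add_left[of n a "-b" x] by (simp add: pr_minus_left)

lemma pr_diff_right: "pr n a (x - y) = pr n a x - pr n a y"
  using pr_add_right[of n a x "-y"] by (simp add: pr_minus_right)

lemma pr_sum_right: "pr n a (\<Sum>i\<in>I. g i) = (\<Sum>i\<in>I. pr n a (g i))"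
  by (induction I rule: infinite_finite_induct) (auto simp: pr_add_right)

lemmas pr_bilinear = pr_add_left pr_add_right pr_scale_left pr_scale_right pr_minus_left
  pr_minus_right pr_diff_left pr_diff_right

lemma truncation_nat: obtains N :: nat where "\<And>j. j \<ge> N \<Longrightarrow> pr (k + int j) a x = 0"
proof -
  obtain M where M: "\<And>n. n \<ge> M \<Longrightarrow> pr n a x = 0" using pr_truncation by blast
  show thesis by (rule that[of "nat (M - k)"]) (auto intro!: M)
qed

text \<open>Borcherds identity at \<open>n = 0\<close>: there \<open>0 gchoose j\<close> leaves only
  \<open>j = 0\<close> on the right side, and truncation of \<open>a\<close> on \<open>b\<close>
  cuts off the left one.\<close>

lemma commutator:
  assumes "\<And>j. j \<ge> N \<Longrightarrow> pr (int j) a b = 0"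
  shows "pr m a (pr k b x) = pr k b (pr m a x)
    + (\<Sum>j<N. sc (of_int m gchoose j) (pr (m + k - int j) (pr (int j) a b) x))"
proof -
  have "fsum (\<lambda>j. sc (of_int m gchoose j) (pr (m + k - int j) (pr (0 + int j) a b) x))
      = (\<Sum>j<N. sc (of_int m gchoose j) (pr (m + k - int j) (pr (int j) a b) x))"
    by (subst fsum_eq_sum[of N]) (auto simp: assms)
  moreover have "fsum (\<lambda>j. sc ((-1) ^ j * (of_int 0 gchoose j))
       (pr (m + 0 - int j) a (pr (k + int j) b x) - sc (isign 0) (pr (0 + k - int j) b (pr (m + int j) a x))))
     = pr m a (pr k b x) - pr k b (pr m a x)"
    by (subst fsum_eq_sum[of 1]) (auto simp: gbinomial_0_left isign_def)
  ultimately show ?thesis using borcherds[of m k 0 a b x] by (simp add: algebra_simps)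
qed

text \<open>Borcherds identity at \<open>m = 0\<close>, where the left side collapses instead; it
  expands the modes of a composite field.\<close>

lemma iterate:
  assumes "\<And>j. j \<ge> N \<Longrightarrow> pr (k + int j) b x = 0" "\<And>j. j \<ge> N \<Longrightarrow> pr (int j) a x = 0"
  shows "pr k (pr n a b) x = (\<Sum>j<N. sc ((-1) ^ j * (of_int n gchoose j))
       (pr (n - int j) a (pr (k + int j) b x) - sc (isign n) (pr (n + k - int j) b (pr (int j) a x))))"
proof -
  have "fsum (\<lambda>j. sc (of_int 0 gchoose j) (pr (0 + k - int j) (pr (n + int j) a b) x)) = pr k (pr n a b) x"
    by (subst fsum_eq_sum[of 1]) (auto simp: gbinomial_0_left)
  moreover have "fsum (\<lambda>j. sc ((-1) ^ j * (of_int n gchoose j))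
       (pr (0 + n - int j) a (pr (k + int j) b x) - sc (isign n) (pr (n + k - int j) b (pr (0 + int j) a x))))
    = (\<Sum>j<N. sc ((-1) ^ j * (of_int n gchoose j))
       (pr (n - int j) a (pr (k + int j) b x) - sc (isign n) (pr (n + k - int j) b (pr (int j) a x))))"
    by (subst fsum_eq_sum[of N]) (auto simp: assms)
  ultimately show ?thesis using borcherds[of 0 k n a b x] by simp
qed

lemma iterate_ex:
  "\<exists>N. pr k (pr n a b) x = (\<Sum>j<N. sc ((-1) ^ j * (of_int n gchoose j))
       (pr (n - int j) a (pr (k + int j) b x) - sc (isign n) (pr (n + k - int j) b (pr (int j) a x))))
    \<and> (\<forall>j\<ge>N. pr (k + int j) b x = 0) \<and> (\<forall>j\<ge>N. pr (int j) a x = 0)"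
proof -
  obtain N1 where N1: "\<And>j. j \<ge> N1 \<Longrightarrow> pr (k + int j) b x = 0" using truncation_nat by blast
  obtain N2 where N2: "\<And>j. j \<ge> N2 \<Longrightarrow> pr (0 + int j) a x = 0" using truncation_nat by blast
  show ?thesis
    by (intro exI[of _ "max N1 N2"] conjI iterate) (use N1 N2 in auto)
qed

lemma commutator_ex:
  "\<exists>N. \<forall>m k x. pr m a (pr k b x) = pr k b (pr m a x)
    + (\<Sum>j<N. sc (of_int m gchoose j) (pr (m + k - int j) (pr (int j) a b) x))"
proof -
  obtain N where N: "\<And>j. j \<ge> N \<Longrightarrow> pr (0 + int j) a b = 0" using truncation_nat by blast
  show ?thesis
    by (intro exI[of _ N] allI commutator) (use N in auto)
qed

lemma gbinomial_neg2: "(-1) ^ j * ((-2 :: complex) gchoose j) = of_nat (Suc j)"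
  using gbinomial_minus[of "2::complex" j] gbinomial_of_nat_symmetric[of j "Suc j", where 'a=complex]
  by (simp add: power_mult_distrib[symmetric] mult.assoc[symmetric] add.commute)

text \<open>\<open>T a\<close> is a product with \<open>vac\<close>, whose only nonzero mode is
  \<open>-1\<close>. In the iterate formula one index survives: \<open>-1 - k\<close> for
  \<open>k < 0\<close>, \<open>k - 1\<close> for \<open>k > 0\<close>, and none for
  \<open>k = 0\<close>.\<close>

lemma pr_T_left: "pr k (T a) x = sc (- of_int k) (pr (k - 1) a x)"
proof -
  let ?t = "\<lambda>j. sc ((-1) ^ j * (of_int (-2) gchoose j))
       (pr (-2 - int j) a (pr (k + int j) vac x) - sc (isign (-2)) (pr (-2 + k - int j) vac (pr (int j) a x)))"
  obtain N where N: "pr k (pr (-2) a vac) x = (\<Sum>j<N. ?t j)"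
    "\<forall>j\<ge>N. pr (k + int j) vac x = 0" "\<forall>j\<ge>N. pr (int j) a x = 0"
    using iterate_ex[of k "-2" a vac x] by blast
  have t: "?t j = sc (of_nat (Suc j)) ((if k + int j = -1 then pr (-2 - int j) a x else 0)
      - (if k - 1 = int j then pr (int j) a x else 0))" for j
    using gbinomial_neg2[of j] by (auto simp: pr_vac_left isign_def)
  \<comment> \<open>The range is enlarged so that it certainly contains the surviving index.\<close>
  have E: "(\<Sum>j<N. ?t j) = (\<Sum>j<N + nat \<bar>k\<bar>. ?t j)"
    by (rule sum.mono_neutral_left) (auto simp: N)
  consider "k < 0" | "k = 0" | "k > 0" by linarith
  then show ?thesis
  proof cases
    case 1
    then have "(\<Sum>j<N + nat \<bar>k\<bar>. ?t j) = (\<Sum>j<N + nat \<bar>k\<bar>. if j = nat (-1 - k) then sc (- of_int k) (pr (k - 1) a x) else 0)"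
      unfolding t by (intro sum.cong refl) (use 1 in \<open>auto simp: algebra_simps\<close>)
    moreover have "nat (- 1 - k) < N + nat (- k)" using 1 by linarith
    ultimately show ?thesis using 1 N E by (simp add: tr_def)
  next
    case 2
    with N(1) show ?thesis unfolding t by (simp add: tr_def)
  next
    case 3
    then have "(\<Sum>j<N + nat \<bar>k\<bar>. ?t j) = (\<Sum>j<N + nat \<bar>k\<bar>. if j = nat (k - 1) then sc (- of_int k) (pr (k - 1) a x) else 0)"
      unfolding t by (intro sum.cong refl) (use 3 in \<open>auto simp: algebra_simps\<close>)
    moreover have "nat (k - 1) < N + nat k" using 3 by linarith
    ultimately show ?thesis using 3 N E by (simp add: tr_def)
  qed
qed

lemma T_pr: "T (pr n a b) = pr n (T a) b + pr n a (T b)"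
proof -
  let ?t = "\<lambda>j. sc ((-1) ^ j * (of_int n gchoose j))
       (pr (n - int j) a (pr (-2 + int j) b vac) - sc (isign n) (pr (n + -2 - int j) b (pr (int j) a vac)))"
  have "T (pr n a b) = (\<Sum>j<2. ?t j)"
    unfolding tr_def by (rule iterate) (auto simp: pr_vac_right)
  also have "\<dots> = pr n a (T b) - sc (of_int n) (pr (n - 1) a b)"
    by (simp add: numeral_2_eq_2 pr_vac_right pr_creation tr_def)
  finally show ?thesis by (simp add: pr_T_left)
qed

lemma T_linear: "T (x + y) = T x + T y" "T (sc r x) = sc r (T x)" "T 0 = 0"
  by (simp_all add: tr_def pr_bilinear)

lemma T_vac [simp]: "T vac = 0"
  by (simp add: tr_def pr_vac_left)

text \<open>Borcherds identity at \<open>m = -1\<close>, \<open>k = 0\<close> on the vacuum. The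
  creation axioms leave only the term in which \<open>b\<close> acts on
  \<open>pr (-1) a vac\<close>, which is \<open>a\<close>.\<close>

lemma skew:
  assumes "\<And>j. j \<ge> N \<Longrightarrow> pr (n + int j) a b = 0"
  shows "pr n b a = sc (- isign n) (\<Sum>j<N. sc ((-1) ^ j) (pr (-1 - int j) (pr (n + int j) a b) vac))"
proof -
  have b1: "(of_int (-1) gchoose j :: complex) = (-1) ^ j" for j
    using gbinomial_minus[of "1::complex" j] gbinomial_of_nat_symmetric[of j j, where 'a=complex] by simp
  have "fsum (\<lambda>j. sc (of_int (-1) gchoose j) (pr (-1 + 0 - int j) (pr (n + int j) a b) vac))
      = (\<Sum>j<N. sc ((-1) ^ j) (pr (-1 - int j) (pr (n + int j) a b) vac))"
    by (subst fsum_eq_sum[of N]) (auto simp: assms b1 simp del: of_int_minus)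
  moreover have "fsum (\<lambda>j. sc ((-1) ^ j * (of_int n gchoose j))
       (pr (-1 + n - int j) a (pr (0 + int j) b vac) - sc (isign n) (pr (n + 0 - int j) b (pr (-1 + int j) a vac))))
     = - sc (isign n) (pr n b a)"
    by (subst fsum_eq_sum[of 1]) (auto simp: pr_vac_right pr_creation)
  ultimately have "(\<Sum>j<N. sc ((-1) ^ j) (pr (-1 - int j) (pr (n + int j) a b) vac)) = - sc (isign n) (pr n b a)"
    using borcherds[of "-1" 0 n a b vac] by simp
  then show ?thesis by (simp add: isign_def)
qed

lemma pr_T_pow_left:
  "pr n ((T ^^ k) a) x = sc ((-1) ^ k * fact k * (of_int n gchoose k)) (pr (n - int k) a x)"
proof (induction k arbitrary: n)
  case (Suc k)
  have *: "of_nat (Suc k) * (of_int n gchoose Suc k) = of_int n * (of_int (n - 1) gchoose k :: complex)"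
    using gbinomial_absorption[of k "of_int n :: complex"] by simp
  have "pr n ((T ^^ Suc k) a) x = sc ((-1) ^ Suc k * fact k * (of_int n * (of_int (n - 1) gchoose k))) (pr (n - int (Suc k)) a x)"
    by (simp add: pr_T_left Suc algebra_simps)
  also have "\<dots> = sc ((-1) ^ Suc k * fact (Suc k) * (of_int n gchoose Suc k)) (pr (n - int (Suc k)) a x)"
    by (simp only: *[symmetric] fact_Suc mult_ac of_nat_mult)
  finally show ?case .
qed simp

lemma pr_T_pow: "pr (-1) ((T ^^ k) a) x = sc (fact k) (pr (-1 - int k) a x)"
  using pr_T_pow_left[of "-1" k a x]
    gbinomial_minus[of "1::complex" k] gbinomial_of_nat_symmetric[of k k, where 'a=complex]
  by (simp add: power_mult_distrib[symmetric] mult.left_commute mult.commute[of "fact k"])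

lemma pr_neg_vac: "sc (fact k) (pr (-1 - int k) a vac) = (T ^^ k) a"
  using pr_T_pow[of k a vac] by (simp add: pr_creation)

text \<open>The vector \<open>pr (-1 - int k) a vac\<close> is the divided derivative
  \<open>T^k a / k!\<close>, so its modes follow from those of \<open>(T ^^ k) a\<close> by
  cancelling \<open>fact k\<close>.\<close>

lemma pr_mode_vac:
  "pr q (pr (-1 - int k) a vac) x = sc ((-1) ^ k * (of_int q gchoose k)) (pr (q - int k) a x)"
proof -
  have "sc (fact k) (pr q (pr (-1 - int k) a vac) x) = sc (fact k) (sc ((-1) ^ k * (of_int q gchoose k)) (pr (q - int k) a x))"
    by (simp only: pr_scale_left[symmetric, of _ _ "pr (-1 - int k) a vac"] pr_neg_vac pr_T_pow_left scale_scale mult_ac)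
  then show ?thesis by (metis scale_cancel_left fact_nonzero)
qed

end

lemma fact_num: "fact 2 = (2::complex)" "fact 3 = (6::complex)"
  by (simp_all add: numeral_2_eq_2 numeral_3_eq_3)

section \<open>The algebra and the functionals on its even part\<close>

text \<open>The constants \<open>al\<close>, \<open>ga\<close>, \<open>be\<close> unify the two normalisations of \<open>W\<close>: they are
  \<open>c / 3\<close>, \<open>1\<close>, \<open>32 / (22 + 5 * c)\<close> in the generic case and \<open>0\<close>, \<open>0\<close>, \<open>32\<close> for \<open>c = - 22 / 5\<close>.\<close>

locale w3 = va sc vac pr
  for sc :: "complex \<Rightarrow> 'v::ab_group_add \<Rightarrow> 'v" and vac :: 'v and pr :: "int \<Rightarrow> 'v \<Rightarrow> 'v \<Rightarrow> 'v" +
  fixes L W :: 'v and c al ga be :: complex and \<theta> :: "'v \<Rightarrow> 'v"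
  assumes LL: "n \<ge> 0 \<Longrightarrow> pr n L L =
        (if n = 3 then sc (c / 2) vac else if n = 1 then sc 2 L else if n = 0 then T L else 0)"
    and LW: "n \<ge> 0 \<Longrightarrow> pr n L W = (if n = 1 then sc 3 W else if n = 0 then T W else 0)"
    and WW: "n \<ge> 0 \<Longrightarrow> pr n W W =
        (if n = 5 then sc al vac else if n = 3 then sc (2 * ga) L else if n = 2 then sc ga (T L)
         else if n = 1 then sc be (pr (-1) L L) + sc (3 / 10 * (ga - be)) (T (T L))
         else if n = 0 then sc be (pr (-1) (T L) L) + sc ((ga - be) / 15) (T (T (T L)))
         else 0)"
    and theta: "va_automorphism sc vac pr \<theta>" and theta_L: "\<theta> L = L" and theta_W: "\<theta> W = - W"
    and alga: "al = ga * c / 3" and gabe: "32 * ga = be * (22 + 5 * c)" and be: "be \<noteq> 0"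
    and pbw_inj: "inj_on (pbw_mon vac pr L W) pbw_index"
    and pbw_indep: "independent (pbw_mon vac pr L W ` pbw_index)"
    and pbw_span: "span (pbw_mon vac pr L W ` pbw_index) = UNIV"
begin

abbreviation l :: "int \<Rightarrow> 'v \<Rightarrow> 'v" where "l n \<equiv> pr n L"
abbreviation w :: "int \<Rightarrow> 'v \<Rightarrow> 'v" where "w n \<equiv> pr n W"

lemma l_vac: "n \<ge> 0 \<Longrightarrow> l n vac = 0" and w_vac: "n \<ge> 0 \<Longrightarrow> w n vac = 0"
  by (simp_all add: pr_vac_right)

lemma l_vac_num [simp]: "l (numeral n) vac = 0" "l 0 vac = 0" "l 1 vac = 0"
  and w_vac_num [simp]: "w (numeral n) vac = 0" "w 0 vac = 0" "w 1 vac = 0"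
  by (simp_all add: pr_vac_right)

lemma L_l: "L = l (-1) vac" and W_w: "W = w (-1) vac"
  by (simp_all add: pr_creation)

lemma TL_l: "T L = l (-2) vac"
  by (simp add: tr_def)

lemma TTL_l: "T (T L) = sc 2 (l (-3) vac)" and TTTL_l: "T (T (T L)) = sc 6 (l (-4) vac)"
  using pr_neg_vac[of 2 L] pr_neg_vac[of 3 L] by (simp_all add: numeral_2_eq_2 numeral_3_eq_3)

text \<open>The Virasoro relations with shifted index: \<open>l n\<close> is the usual
  \<open>L_{n-1}\<close>, so \<open>l 0\<close> is translation and \<open>l 1\<close> measures the
  conformal weight.\<close>

lemma l_l: "l m (l n x) = l n (l m x) + sc (of_int (m - n)) (l (m + n - 1) x)
    + sc (if m + n = 2 then of_int (m * (m - 1) * (m - 2)) * c / 12 else 0) x"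
proof -
  have "l m (l n x) = l n (l m x) + (\<Sum>j<4. sc (of_int m gchoose j) (pr (m + n - int j) (l (int j) L) x))"
    by (rule commutator) (auto simp: LL)
  also have "(\<Sum>j<4. sc (of_int m gchoose j) (pr (m + n - int j) (l (int j) L) x))
      = pr (m + n) (T L) x + sc (of_int m) (pr (m + n - 1) (sc 2 L) x) + sc (of_int m gchoose 3) (pr (m + n - 3) (sc (c/2) vac) x)"
    by (simp add: eval_nat_numeral LL)
  also have "\<dots> = sc (of_int (m - n)) (l (m + n - 1) x)
    + sc (if m + n = 2 then of_int (m * (m - 1) * (m - 2)) * c / 12 else 0) x"
    by (auto simp: pr_T_left pr_scale_left pr_vac_left gchoose_num simp flip: scale_left_distrib)
  finally show ?thesis by (simp add: add.assoc)
qed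

lemma l_w: "l m (w n x) = w n (l m x) + sc (of_int (2 * m - n)) (w (m + n - 1) x)"
proof -
  have "l m (w n x) = w n (l m x) + (\<Sum>j<2. sc (of_int m gchoose j) (pr (m + n - int j) (l (int j) W) x))"
    by (rule commutator) (auto simp: LW)
  also have "(\<Sum>j<2. sc (of_int m gchoose j) (pr (m + n - int j) (l (int j) W) x))
      = pr (m + n) (T W) x + sc (of_int m) (pr (m + n - 1) (sc 3 W) x)"
    by (simp add: eval_nat_numeral LW)
  also have "\<dots> = sc (of_int (2 * m - n)) (w (m + n - 1) x)"
    by (simp add: pr_T_left pr_scale_left flip: scale_left_distrib)
  finally show ?thesis .
qed

lemma w_l: "w n (l m x) = l m (w n x) + sc (of_int (n - 2 * m)) (w (n + m - 1) x)"
  using l_w[of m n x] by (simp add: add.assoc add.commute[of n m] flip: scale_left_distrib)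

lemma T_l: "T (l n x) = sc (- of_int n) (l (n - 1) x) + l n (T x)"
  and T_w: "T (w n x) = sc (- of_int n) (w (n - 1) x) + w n (T x)"
proof -
  show "T (l n x) = sc (- of_int n) (l (n - 1) x) + l n (T x)" by (simp add: T_pr pr_T_left)
  show "T (w n x) = sc (- of_int n) (w (n - 1) x) + w n (T x)" by (simp add: T_pr pr_T_left)
qed

lemma WW_num: "w (int j) W = (if j = 5 then sc al vac else if j = 3 then sc (2 * ga) (l (-1) vac)
   else if j = 2 then sc ga (l (-2) vac)
   else if j = 1 then sc be (l (-1) (l (-1) vac)) + sc (3 / 5 * (ga - be)) (l (-3) vac)
   else if j = 0 then sc be (l (-2) (l (-1) vac)) + sc (2 / 5 * (ga - be)) (l (-4) vac)
   else 0)"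
  by (auto simp: WW TTL_l pr_T_left T_l T_linear simp flip: L_l TL_l)

lemma WW_zero: "j \<ge> 6 \<Longrightarrow> w (int j) W = 0"
  by (simp add: WW_num)

lemma w_w: "w m (w n x) = w n (w m x)
    + (\<Sum>j<6. sc (of_int m gchoose j) (pr (m + n - int j) (w (int j) W) x))"
  by (rule commutator) (auto simp: WW_zero)

lemma mode_l_vac:
  "pr q (l (-1) vac) x = l q x"
  "pr q (l (-2) vac) x = sc (- of_int q) (l (q - 1) x)"
  "pr q (l (-3) vac) x = sc (of_int q * (of_int q - 1) / 2) (l (q - 2) x)"
  "pr q (l (-4) vac) x = sc (- of_int q * (of_int q - 1) * (of_int q - 2) / 6) (l (q - 3) x)"
  using pr_mode_vac[of q 0 L x] pr_mode_vac[of q 1 L x] pr_mode_vac[of q 2 L x] pr_mode_vac[of q 3 L x]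
  by (simp_all add: gchoose_num)

lemma mode_LL:
  assumes "\<And>j. j \<ge> N \<Longrightarrow> l (r + int j) x = 0" "\<And>j. j \<ge> N \<Longrightarrow> l (int j) x = 0"
  shows "pr r (l (-1) (l (-1) vac)) x = (\<Sum>j<N. l (-1 - int j) (l (r + int j) x) + l (r - 1 - int j) (l (int j) x))"
    and "pr r (l (-2) (l (-1) vac)) x
      = (\<Sum>j<N. sc (of_nat (Suc j)) (l (-2 - int j) (l (r + int j) x) - l (r - 2 - int j) (l (int j) x)))"
proof -
  have b1: "((-1 :: complex) gchoose j) * (-1) ^ j = 1" for j
    using gbinomial_minus[of "1::complex" j] gbinomial_of_nat_symmetric[of j j, where 'a=complex]
    by (simp add: power_mult_distrib[symmetric])
  show "pr r (l (-1) (l (-1) vac)) x = (\<Sum>j<N. l (-1 - int j) (l (r + int j) x) + l (r - 1 - int j) (l (int j) x))"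
    using iterate[of N r L x L "-1"] assms by (simp add: b1 isign_def L_l[symmetric] algebra_simps)
  show "pr r (l (-2) (l (-1) vac)) x
      = (\<Sum>j<N. sc (of_nat (Suc j)) (l (-2 - int j) (l (r + int j) x) - l (r - 2 - int j) (l (int j) x)))"
    using iterate[of N r L x L "-2"] assms by (simp add: gbinomial_neg2 isign_def L_l[symmetric] algebra_simps)
qed

lemma theta_add: "\<theta> (x + y) = \<theta> x + \<theta> y" and theta_sc: "\<theta> (sc r x) = sc r (\<theta> x)"
  and theta_vac: "\<theta> vac = vac" and theta_pr: "\<theta> (pr n a b) = pr n (\<theta> a) (\<theta> b)"
  using theta by (simp_all add: va_automorphism_def)

definition ev :: "'v \<Rightarrow> bool" where "ev x \<longleftrightarrow> \<theta> x = x"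
definition od :: "'v \<Rightarrow> bool" where "od x \<longleftrightarrow> \<theta> x = - x"

lemma theta_0: "\<theta> 0 = 0"
  using theta_sc[of 0 0] by simp

lemma ev_simps [simp]: "ev vac" "ev 0" "od 0" "ev L" "od W"
  and ev_l [simp]: "ev x \<Longrightarrow> ev (l n x)" and od_l [simp]: "od x \<Longrightarrow> od (l n x)"
  and od_w [simp]: "ev x \<Longrightarrow> od (w n x)" and ev_w [simp]: "od x \<Longrightarrow> ev (w n x)"
  and ev_pr: "ev a \<Longrightarrow> ev b \<Longrightarrow> ev (pr n a b)"
  and ev_pr_od [simp]: "od a \<Longrightarrow> od b \<Longrightarrow> ev (pr n a b)"
  and ev_add: "ev x \<Longrightarrow> ev y \<Longrightarrow> ev (x + y)" and ev_sc: "ev x \<Longrightarrow> ev (sc r x)"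
  and ev_T: "ev x \<Longrightarrow> ev (T x)"
  by (auto simp: ev_def od_def theta_vac theta_L theta_W theta_pr theta_add theta_sc theta_0 pr_bilinear tr_def)

end

text \<open>Vanishing is asked for even \<open>x\<close> only, since in the generation argument it
  is known only there. The condition on derivatives is kept apart: for the functionals built from
  PBW values it is derived from the present assumptions by \<open>f_T_criterion\<close>.\<close>

locale w3_l_functional = w3 sc vac pr L W c al ga be \<theta>
  for sc :: "complex \<Rightarrow> 'v::ab_group_add \<Rightarrow> 'v" and vac :: 'v and pr :: "int \<Rightarrow> 'v \<Rightarrow> 'v \<Rightarrow> 'v"
    and L W :: 'v and c al ga be :: complex and \<theta> :: "'v \<Rightarrow> 'v" +
  fixes f :: "'v \<Rightarrow> complex"
  assumes lin_f: "lin sc f"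
    and f_l: "n < 0 \<Longrightarrow> ev x \<Longrightarrow> f (l n x) = 0"
begin

lemma f_add: "f (x + y) = f x + f y" and f_sc: "f (sc r x) = r * f x"
  using lin_f by (auto simp: lin_def)

lemma f_0: "f 0 = 0" using f_sc[of 0 0] by simp
lemma f_minus: "f (- x) = - f x" using f_sc[of "-1" x] by simp
lemma f_diff: "f (x - y) = f x - f y" using f_add[of x "- y"] by (simp add: f_minus)
lemma f_sum: "f (sum g I) = (\<Sum>i\<in>I. f (g i))"
  by (induction I rule: infinite_finite_induct) (auto simp: f_0 f_add)

lemmas f_linear = f_add f_sc f_0 f_minus f_diff

end

locale w3_functional = w3_l_functional sc vac pr L W c al ga be \<theta> f
  for sc :: "complex \<Rightarrow> 'v::ab_group_add \<Rightarrow> 'v" and vac :: 'v and pr :: "int \<Rightarrow> 'v \<Rightarrow> 'v \<Rightarrow> 'v"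
    and L W :: 'v and c al ga be :: complex and \<theta> :: "'v \<Rightarrow> 'v" and f :: "'v \<Rightarrow> complex" +
  assumes f_T: "f (T (w r (w p vac))) = 0"
begin

text \<open>Integration by parts: \<open>f\<close> kills total derivatives, so derivatives move from
  the second factor to the first, and one value per weight remains.\<close>

lemma f_w_w: "f (w r (w (-1 - int b) vac)) = (of_int r gchoose b) * f (w (r - int b) (w (-1) vac))"
proof (induction b arbitrary: r)
  case (Suc b)
  have "0 = f (T (w r (w (-1 - int b) vac)))" by (simp add: f_T)
  also have "\<dots> = - of_int r * f (w (r - 1) (w (-1 - int b) vac)) + of_nat (Suc b) * f (w r (w (-1 - int (Suc b)) vac))"
    by (simp add: T_w f_linear pr_bilinear algebra_simps)
  finally have "of_nat (Suc b) * f (w r (w (-1 - int (Suc b)) vac)) = of_int r * f (w (r - 1) (w (-1 - int b) vac))"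
    by simp
  also have "\<dots> = of_int r * (of_int (r - 1) gchoose b) * f (w (r - int (Suc b)) (w (-1) vac))"
    unfolding Suc by (simp add: diff_diff_eq)
  also have "of_int r * (of_int (r - 1) gchoose b) = of_nat (Suc b) * (of_int r gchoose Suc b :: complex)"
    using gbinomial_absorption[of b "of_int r :: complex"] by simp
  finally show ?case by (simp del: of_nat_Suc)
qed simp

lemma f_mode_w:
  "f (pr q (w (-1 - int a) vac) x) = (-1) ^ a * (of_int q gchoose a) * f (w (q - int a) x)"
  using pr_mode_vac[of q a W x] by (simp add: f_linear)

text \<open>In the iterate formula the first family of terms starts with a negative mode of
  \<open>L\<close> on an even vector and is killed. In the second, \<open>l i\<close> maps
  \<open>w (-1 - int b) vac\<close> to a multiple of \<open>w (i - 2 - b) vac\<close>, which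
  vanishes from \<open>i = b + 2\<close> on.\<close>

lemma f_mode_l:
  assumes n: "n < 0" and y: "od y"
  shows "f (pr q (l n y) (w (-1 - int b) vac)) = - isign n * (\<Sum>i<b + 2. (-1) ^ i * (of_int n gchoose i)
     * of_int (2 * int i + 1 + int b) * f (pr (n + q - int i) y (w (int i - 2 - int b) vac)))"
proof -
  let ?x = "w (-1 - int b) vac"
  have lx: "l (int i) ?x = sc (of_int (2 * int i + 1 + int b)) (w (int i - 2 - int b) vac)" for i
    by (simp add: l_w l_vac algebra_simps)
  obtain N where N: "pr q (pr n L y) ?x = (\<Sum>j<N. sc ((-1) ^ j * (of_int n gchoose j))
       (pr (n - int j) L (pr (q + int j) y ?x) - sc (isign n) (pr (n + q - int j) y (pr (int j) L ?x))))"
    "\<forall>j\<ge>N. pr (q + int j) y ?x = 0" "\<forall>j\<ge>N. pr (int j) L ?x = 0"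
    using iterate_ex[of q n L y ?x] by blast
  have "f (pr q (pr n L y) ?x) = (\<Sum>j<N. - isign n * ((-1) ^ j * (of_int n gchoose j) * f (pr (n + q - int j) y (l (int j) ?x))))"
    unfolding N(1) using n y by (simp add: f_sum f_linear f_l algebra_simps)
  also have "\<dots> = (\<Sum>j<N + b + 2. - isign n * ((-1) ^ j * (of_int n gchoose j) * f (pr (n + q - int j) y (l (int j) ?x))))"
    by (rule sum.mono_neutral_left) (auto simp: N f_0)
  also have "\<dots> = (\<Sum>j<b + 2. - isign n * ((-1) ^ j * (of_int n gchoose j) * f (pr (n + q - int j) y (l (int j) ?x))))"
    by (rule sum.mono_neutral_right) (auto simp: lx w_vac f_0)
  also have "\<dots> = - isign n * (\<Sum>i<b + 2. (-1) ^ i * (of_int n gchoose i)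
     * of_int (2 * int i + 1 + int b) * f (pr (n + q - int i) y (w (int i - 2 - int b) vac)))"
    unfolding sum_distrib_left by (intro sum.cong refl) (simp add: lx pr_bilinear f_linear algebra_simps)
  finally show ?thesis .
qed

end

section \<open>The two relations\<close>

context w3
begin

text \<open>The sign conditions on this and the next two rules make the commutators terminate as
  rewrite rules: nonnegative modes of \<open>L\<close> move right until they reach the vacuum,
  negative ones move left, where \<open>f\<close> kills them.\<close>

lemma l_pos_w: "0 \<le> m \<Longrightarrow> l m (w n x) = w n (l m x) + sc (of_int (2 * m - n)) (w (m + n - 1) x)"
  by (rule l_w)

lemma w_neg_l: "m < 0 \<Longrightarrow> w n (l m x) = l m (w n x) + sc (of_int (n - 2 * m)) (w (n + m - 1) x)"
  by (rule w_l)

lemma l_pos_l: "0 \<le> m \<Longrightarrow> n < 0 \<Longrightarrow> l m (l n x) = l n (l m x) + sc (of_int (m - n)) (l (m + n - 1) x)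
    + sc (if m + n = 2 then of_int (m * (m - 1) * (m - 2)) * c / 12 else 0) x"
  by (rule l_l)

lemma mode_l_at_vac:
  "pr (-1) (l n v) vac = l n v" "pr (-2) (l n v) vac = T (l n v)" "pr (-3) (l n v) vac = sc (1/2) (T (T (l n v)))"
  "pr (-4) (l n v) vac = sc (1/6) (T (T (T (l n v))))"
  "pr (-5) (l n v) vac = sc (1/24) (T (T (T (T (l n v)))))"
  using pr_neg_vac[of 2 "l n v", symmetric] pr_neg_vac[of 3 "l n v", symmetric]
    pr_neg_vac[of 4 "l n v", symmetric]
  by (simp_all add: pr_creation tr_def[symmetric] eval_nat_numeral)

lemma WW_modes:
  "w 0 (w (-1) vac) = sc be (l (-2) (l (-1) vac)) + sc (2 / 5 * (ga - be)) (l (-4) vac)"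
  "w 1 (w (-1) vac) = sc be (l (-1) (l (-1) vac)) + sc (3 / 5 * (ga - be)) (l (-3) vac)"
  "w 2 (w (-1) vac) = sc ga (l (-2) vac)" "w 3 (w (-1) vac) = sc (2 * ga) (l (-1) vac)"
  "w 4 (w (-1) vac) = 0" "w 5 (w (-1) vac) = sc al vac"
  "w 6 (w (-1) vac) = 0" "w 7 (w (-1) vac) = 0"
  using WW_num[of 0] WW_num[of 1] WW_num[of 2] WW_num[of 3] WW_num[of 4] WW_num[of 5] WW_num[of 6] WW_num[of 7] by (simp_all flip: W_w)

lemma w_w_unfold: "w m (w n x) = w n (w m x)
   + (pr (m + n) (w 0 (w (-1) vac)) x + sc (of_int m) (pr (m + n - 1) (w 1 (w (-1) vac)) x)
   + sc (of_int m gchoose 2) (pr (m + n - 2) (w 2 (w (-1) vac)) x)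
   + sc (of_int m gchoose 3) (pr (m + n - 3) (w 3 (w (-1) vac)) x)
   + sc (of_int m gchoose 5) (pr (m + n - 5) (w 5 (w (-1) vac)) x))"
  using w_w[of m n x] by (simp add: eval_nat_numeral WW_modes(5)[unfolded W_w[symmetric]] flip: W_w)

lemmas w_w_modes = w_w_unfold[unfolded WW_modes]

text \<open>\<open>l i\<close> kills \<open>w (-1 - int b) vac\<close> once
  \<open>i >= b + 2\<close>. With \<open>r >= -8\<close> and \<open>b < 6\<close> all indices from
  16 on are therefore harmless.\<close>

lemma mode_LL_w:
  assumes "r \<ge> -8" "b < 6"
  shows "pr r (l (-1) (l (-1) vac)) (w (-1 - int b) vac)
      = (\<Sum>j<16. l (-1 - int j) (l (r + int j) (w (-1 - int b) vac)) + l (r - 1 - int j) (l (int j) (w (-1 - int b) vac)))"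
    and "pr r (l (-2) (l (-1) vac)) (w (-1 - int b) vac)
      = (\<Sum>j<16. sc (of_nat (Suc j)) (l (-2 - int j) (l (r + int j) (w (-1 - int b) vac)) - l (r - 2 - int j) (l (int j) (w (-1 - int b) vac))))"
  using assms by (intro mode_LL; simp add: l_w l_vac w_vac)+

lemmas norm = pr_vac_left sum_lessThan_numeral(7) l_pos_w w_neg_l l_pos_l l_vac w_vac mode_l_at_vac WW_modes mode_l_vac T_l T_w T_linear pr_bilinear

lemmas mode_LL_W = mode_LL_w[of _ 0, simplified]

context
  fixes g :: "'v \<Rightarrow> complex"
  assumes lin_g: "lin sc g"
begin

lemma g_linear: "g (x + y) = g x + g y" "g (x - y) = g x - g y" "g (sc r x) = r * g x" "g 0 = 0"
proof -
  have a: "g (x + y) = g x + g y" and m: "g (sc r x) = r * g x" for x y r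
    using lin_g by (auto simp: lin_def)
  show "g (x + y) = g x + g y" "g (sc r x) = r * g x" by (rule a m)+
  show "g (x - y) = g x - g y" using a[of "x - y" y] by simp
  show "g 0 = 0" using m[of 0 0] by simp
qed

text \<open>The OPE of \<open>W\<close> with \<open>U 0\<close>, seen through an arbitrary linear
  \<open>g\<close>: the vector identity becomes a scalar one, accessible to field arithmetic, and
  later \<open>g\<close> is specialised to a mode followed by \<open>f\<close>.\<close>

lemma w_U0:
  "g (w 0 (w (-1) (w (-1) vac))) = 2 * be * g (l (-2) (l (-1) (w (-1) vac))) + 3 * be * g (l (-1) (w (-4) vac)) + be * g (l (-2) (w (-3) vac)) + be * g (l (-3) (w (-2) vac)) + (4 / 5 * ga + 11 / 5 * be) * g (l (-4) (w (-1) vac)) + (14 / 5 * ga - 44 / 5 * be) * g (w (-6) vac)"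
  "g (w 1 (w (-1) (w (-1) vac))) = 2 * be * g (l (-1) (l (-1) (w (-1) vac))) + 2 * be * g (l (-1) (w (-3) vac)) + 2 * be * g (l (-2) (w (-2) vac)) + (6 / 5 * ga + 24 / 5 * be) * g (l (-3) (w (-1) vac)) + (3 * ga - 4 * be) * g (w (-5) vac)"
  "g (w 2 (w (-1) (w (-1) vac))) = 3 * be * g (l (-1) (w (-2) vac)) + (2 * ga + 9 * be) * g (l (-2) (w (-1) vac)) + 3 * ga * g (w (-4) vac)"
  "g (w 3 (w (-1) (w (-1) vac))) = (4 * ga + 12 * be) * g (l (-1) (w (-1) vac)) + (2 * ga + 4 * be) * g (w (-3) vac)"
  "g (w 4 (w (-1) (w (-1) vac))) = (4 * ga + 16 * be) * g (w (-2) vac)"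
  "g (w 5 (w (-1) (w (-1) vac))) = (2 * al + 111 / 5 * ga + 144 / 5 * be) * g (w (-1) vac)"
  by (simp_all add: w_w_modes[of _ "-1" "w (-1) vac"] norm mode_LL_W g_linear gchoose_num field_simps)

lemma w_U2:
  "g (w 0 (w (-3) (w (-1) vac))) = be * g (l (-2) (l (-1) (w (-3) vac))) + be * g (l (-2) (l (-3) (w (-1) vac))) + 2 * be * g (l (-3) (l (-2) (w (-1) vac))) + 3 * be * g (l (-4) (l (-1) (w (-1) vac))) + be * g (l (-1) (w (-6) vac)) + (- be) * g (l (-2) (w (-5) vac)) + (2 / 5 * ga - 2 / 5 * be) * g (l (-4) (w (-3) vac)) + 3 * be * g (l (-5) (w (-2) vac)) + (4 * ga + 5 * be) * g (l (-6) (w (-1) vac)) + (2 * ga - 6 * be) * g (w (-8) vac)"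
  "g (w 1 (w (-3) (w (-1) vac))) = be * g (l (-1) (l (-1) (w (-3) vac))) + be * g (l (-1) (l (-3) (w (-1) vac))) + 2 * be * g (l (-2) (l (-2) (w (-1) vac))) + 3 * be * g (l (-3) (l (-1) (w (-1) vac))) + (- 2 * be) * g (l (-1) (w (-5) vac)) + (3 / 5 * ga - 3 / 5 * be) * g (l (-3) (w (-3) vac)) + 4 * be * g (l (-4) (w (-2) vac)) + (26 / 5 * ga + 34 / 5 * be) * g (l (-5) (w (-1) vac)) + (9 / 5 * ga + 6 / 5 * be) * g (w (-7) vac)"
  "g (w 2 (w (-3) (w (-1) vac))) = 2 * be * g (l (-1) (l (-2) (w (-1) vac))) + 3 * be * g (l (-2) (l (-1) (w (-1) vac))) + ga * g (l (-2) (w (-3) vac)) + 5 * be * g (l (-3) (w (-2) vac)) + (7 * ga + 11 * be) * g (l (-4) (w (-1) vac)) + ga * g (w (-6) vac)"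
  "g (w 3 (w (-3) (w (-1) vac))) = 3 * be * g (l (-1) (l (-1) (w (-1) vac))) + 2 * ga * g (l (-1) (w (-3) vac)) + 6 * be * g (l (-2) (w (-2) vac)) + (49 / 5 * ga + 81 / 5 * be) * g (l (-3) (w (-1) vac)) + (- 2 * ga) * g (w (-5) vac)"
  "g (w 4 (w (-3) (w (-1) vac))) = 7 * be * g (l (-1) (w (-2) vac)) + (14 * ga + 21 * be) * g (l (-2) (w (-1) vac))"
  "g (w 5 (w (-3) (w (-1) vac))) = (20 * ga + 24 * be) * g (l (-1) (w (-1) vac)) + (al + 8 * be) * g (w (-3) vac)"
  "g (w 6 (w (-3) (w (-1) vac))) = (141 / 5 * ga + 144 / 5 * be) * g (w (-2) vac)"
  "g (w 7 (w (-3) (w (-1) vac))) = (21 * al + 117 * ga + 48 * be) * g (w (-1) vac)"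
  by (simp_all add: w_w_modes[of _ "-3" "w (-1) vac"] norm mode_LL_W g_linear gchoose_num field_simps)

end

lemma w_w_pos_vac: "m \<ge> 6 + int b \<Longrightarrow> w m (w (-1 - int b) vac) = 0"
  by (simp add: w_w_modes[of _ _ vac] pr_vac_right w_vac)

lemma w_pos_U0: "j \<ge> 6 \<Longrightarrow> w (int j) (w (-1) (w (-1) vac)) = 0"
  by (simp add: w_w_modes[of _ "-1" "w (-1) vac"] w_w_pos_vac[of 0, simplified] mode_LL[of 2] norm eval_nat_numeral)

lemma w_pos_U2: "j \<ge> 8 \<Longrightarrow> w (int j) (w (-3) (w (-1) vac)) = 0"
  by (simp add: w_w_modes[of _ "-3" "w (-1) vac"] w_w_pos_vac[of 0, simplified] mode_LL[of 2] norm eval_nat_numeral)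

text \<open>\<open>w n\<close> kills \<open>w (-1 - int b) vac\<close> for
  \<open>n >= 6 + b\<close>; in the worst case \<open>q = -2\<close>, \<open>b = 2\<close> this
  gives the bound 10.\<close>

lemma U0_mode:
  assumes "q \<ge> -2" "b \<le> 2"
  shows "pr q (w (-1) (w (-1) vac)) (w (-1 - int b) vac) =
    (\<Sum>j<10. w (-1 - int j) (w (q + int j) (w (-1 - int b) vac)) + w (-1 + q - int j) (w (int j) (w (-1 - int b) vac)))"
proof -
  have "((-1 :: complex) gchoose j) * (-1) ^ j = 1" for j
    using gbinomial_minus[of "1::complex" j] gbinomial_of_nat_symmetric[of j j, where 'a=complex]
    by (simp add: power_mult_distrib[symmetric])
  then show ?thesis using assms
    by (subst iterate[of 10]) (simp_all add: w_w_pos_vac isign_def W_w[symmetric] mult.commute[of "(-1) ^ _"])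
qed

lemma U2_mode:
  assumes "q \<ge> -2" "b \<le> 2"
  shows "pr q (w (-3) (w (-1) vac)) (w (-1 - int b) vac) =
    (\<Sum>j<10. sc ((-1) ^ j * (-3 gchoose j)) (w (-3 - int j) (w (q + int j) (w (-1 - int b) vac)) + w (-3 + q - int j) (w (int j) (w (-1 - int b) vac))))"
  using assms by (subst iterate[of 10]) (simp_all add: w_w_pos_vac isign_def W_w[symmetric])

end

section \<open>Evaluation of products under a killing functional\<close>

context w3_functional
begin

lemma f_w_w_num:
  "f (w r (w (-2) vac)) = of_int r * f (w (r - 1) (w (-1) vac))"
  "f (w r (w (-3) vac)) = (of_int r gchoose 2) * f (w (r - 2) (w (-1) vac))"
  "f (w r (w (-4) vac)) = (of_int r gchoose 3) * f (w (r - 3) (w (-1) vac))"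
  "f (w r (w (-5) vac)) = (of_int r gchoose 4) * f (w (r - 4) (w (-1) vac))"
  "f (w r (w (-6) vac)) = (of_int r gchoose 5) * f (w (r - 5) (w (-1) vac))"
  "f (w r (w (-7) vac)) = (of_int r gchoose 6) * f (w (r - 6) (w (-1) vac))"
  "f (w r (w (-8) vac)) = (of_int r gchoose 7) * f (w (r - 7) (w (-1) vac))"
  "f (w r (w (-9) vac)) = (of_int r gchoose 8) * f (w (r - 8) (w (-1) vac))"
  using f_w_w[of r 1] f_w_w[of r 2] f_w_w[of r 3] f_w_w[of r 4] f_w_w[of r 5] f_w_w[of r 6] f_w_w[of r 7] f_w_w[of r 8]
  by simp_all

lemma f_mode_w_num:
  "f (pr q (w (-1) vac) x) = f (w q x)"
  "f (pr q (w (-2) vac) x) = - of_int q * f (w (q - 1) x)"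
  "f (pr q (w (-3) vac) x) = (of_int q gchoose 2) * f (w (q - 2) x)"
  "f (pr q (w (-4) vac) x) = - (of_int q gchoose 3) * f (w (q - 3) x)"
  "f (pr q (w (-5) vac) x) = (of_int q gchoose 4) * f (w (q - 4) x)"
  "f (pr q (w (-6) vac) x) = - (of_int q gchoose 5) * f (w (q - 5) x)"
  "f (pr q (w (-7) vac) x) = (of_int q gchoose 6) * f (w (q - 6) x)"
  "f (pr q (w (-8) vac) x) = - (of_int q gchoose 7) * f (w (q - 7) x)"
  using f_mode_w[of q 0 x] f_mode_w[of q 1 x] f_mode_w[of q 2 x] f_mode_w[of q 3 x] f_mode_w[of q 4 x]
    f_mode_w[of q 5 x] f_mode_w[of q 6 x] f_mode_w[of q 7 x]
  by simp_all

lemmas f_mode_l_num = f_mode_l[where b=0, simplified] f_mode_l[where b=1, simplified]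
  f_mode_l[where b=2, simplified, unfolded sum_lessThan_numeral, simplified]
  f_mode_l[where b=3, simplified, unfolded sum_lessThan_numeral, simplified]
  f_mode_l[where b=4, simplified, unfolded sum_lessThan_numeral, simplified]

text \<open>The commutator formula read backwards: a Wick product of \<open>U 0\<close> with a
  quadratic word is traded for \<open>w k\<close> applied to a product with a shorter word, plus
  terms from the OPE of \<open>W\<close> with \<open>U 0\<close>.\<close>

lemma f_comm_U0:
  "f (pr q (w (-1) (w (-1) vac)) (w k x)) = f (w k (pr q (w (-1) (w (-1) vac)) x))
    - (\<Sum>j<6. (of_int k gchoose j) * f (pr (k + q - int j) (w (int j) (w (-1) (w (-1) vac))) x))"
  using commutator[of 6 W "w (-1) (w (-1) vac)" k q x]
  by (simp add: w_pos_U0 f_linear f_sum)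

lemma f_comm_U2:
  "f (pr q (w (-3) (w (-1) vac)) (w k x)) = f (w k (pr q (w (-3) (w (-1) vac)) x))
    - (\<Sum>j<8. (of_int k gchoose j) * f (pr (k + q - int j) (w (int j) (w (-3) (w (-1) vac))) x))"
  using commutator[of 8 W "w (-3) (w (-1) vac)" k q x]
  by (simp add: w_pos_U2 f_linear f_sum)

lemma lin_mode: "lin sc (\<lambda>v. f (pr q v x))"
  by (simp add: lin_def pr_bilinear f_linear)

lemmas f_eval = f_mode_l_num[folded numeral_2_eq_2] f_mode_w_num f_w_w_num isign_def gchoose_num f_l f_linear

text \<open>Each term of the OPE has one factor \<open>W\<close> and modes of \<open>L\<close>.
  Applied to a further factor \<open>W\<close> it becomes quadratic, so \<open>f\<close> reduces it
  to a polynomial in the mode number times one value. The next lemmas do the same for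
  \<open>T W\<close> and for half of \<open>T (T W)\<close>.\<close>

lemma f_U0_W:
  "f (pr q (w 0 (w (-1) (w (-1) vac))) (w (-1) vac)) = (ga * (- (7 * of_int q ^ 5) + 70 * of_int q ^ 4 - 245 * of_int q ^ 3 + 350 * of_int q ^ 2 - 408 * of_int q - 1920) / 300 + be * (11 * of_int q ^ 5 - 185 * of_int q ^ 4 + 835 * of_int q ^ 3 - 1375 * of_int q ^ 2 - 2166 * of_int q + 2160) / 150) * f (w (q - 5) (w (-1) vac))"
  "f (pr q (w 1 (w (-1) (w (-1) vac))) (w (-1) vac)) = (ga * (5 * of_int q ^ 4 - 30 * of_int q ^ 3 + 55 * of_int q ^ 2 + 18 * of_int q + 288) / 40 + be * (- (5 * of_int q ^ 4) + 60 * of_int q ^ 3 - 25 * of_int q ^ 2 + 234 * of_int q + 504) / 30) * f (w (q - 4) (w (-1) vac))"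
  "f (pr q (w 2 (w (-1) (w (-1) vac))) (w (-1) vac)) = (ga * (- (of_int q ^ 3) + 3 * of_int q ^ 2 - 6 * of_int q - 16) / 2 + be * (- (3 * of_int q ^ 2) - 9 * of_int q - 24)) * f (w (q - 3) (w (-1) vac))"
  "f (pr q (w 3 (w (-1) (w (-1) vac))) (w (-1) vac)) = (ga * (of_int q ^ 2 + 3 * of_int q + 8) + be * (2 * of_int q ^ 2 + 10 * of_int q + 24)) * f (w (q - 2) (w (-1) vac))"
  "f (pr q (w 4 (w (-1) (w (-1) vac))) (w (-1) vac)) = (ga * (- 4 * of_int q) + be * (- 16 * of_int q)) * f (w (q - 1) (w (-1) vac))"
  "f (pr q (w 5 (w (-1) (w (-1) vac))) (w (-1) vac)) = (al * (2) + ga * (111) / 5 + be * (144) / 5) * f (w (q) (w (-1) vac))"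
  by (simp_all add: w_U0[OF lin_mode] f_eval, algebra+)

lemma f_U0_TW:
  "f (pr q (w 0 (w (-1) (w (-1) vac))) (w (-2) vac)) = (ga * (- (7 * of_int q ^ 6) + 105 * of_int q ^ 5 - 595 * of_int q ^ 4 + 1575 * of_int q ^ 3 - 2158 * of_int q ^ 2 - 840 * of_int q) / 300 + be * (11 * of_int q ^ 6 - 240 * of_int q ^ 5 + 1685 * of_int q ^ 4 - 5100 * of_int q ^ 3 + 3884 * of_int q ^ 2 + 1920 * of_int q) / 150) * f (w (q - 6) (w (-1) vac))"
  "f (pr q (w 1 (w (-1) (w (-1) vac))) (w (-2) vac)) = (ga * (5 * of_int q ^ 5 - 50 * of_int q ^ 4 + 175 * of_int q ^ 3 - 202 * of_int q ^ 2 + 360 * of_int q) / 40 + be * (- (5 * of_int q ^ 5) + 80 * of_int q ^ 4 - 235 * of_int q ^ 3 + 484 * of_int q ^ 2 + 180 * of_int q) / 30) * f (w (q - 5) (w (-1) vac))"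
  "f (pr q (w 2 (w (-1) (w (-1) vac))) (w (-2) vac)) = (ga * (- (of_int q ^ 4) + 6 * of_int q ^ 3 - 15 * of_int q ^ 2 - 6 * of_int q) / 2 + be * (- (3 * of_int q ^ 3) - 3 * of_int q ^ 2 - 18 * of_int q)) * f (w (q - 4) (w (-1) vac))"
  "f (pr q (w 3 (w (-1) (w (-1) vac))) (w (-2) vac)) = (ga * (of_int q ^ 3 + of_int q ^ 2 + 6 * of_int q) + be * (2 * of_int q ^ 3 + 6 * of_int q ^ 2 + 16 * of_int q)) * f (w (q - 3) (w (-1) vac))"
  "f (pr q (w 4 (w (-1) (w (-1) vac))) (w (-2) vac)) = (ga * (- (4 * of_int q ^ 2) + 4 * of_int q) + be * (- (16 * of_int q ^ 2) + 16 * of_int q)) * f (w (q - 2) (w (-1) vac))"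
  "f (pr q (w 5 (w (-1) (w (-1) vac))) (w (-2) vac)) = (al * (2 * of_int q) + ga * (111 * of_int q) / 5 + be * (144 * of_int q) / 5) * f (w (q - 1) (w (-1) vac))"
  by (simp_all add: w_U0[OF lin_mode] f_eval, algebra+)

lemma f_U0_TTW:
  "f (pr q (w 0 (w (-1) (w (-1) vac))) (w (-3) vac)) = (ga * (- (7 * of_int q ^ 7) + 147 * of_int q ^ 6 - 1225 * of_int q ^ 5 + 5145 * of_int q ^ 4 - 11608 * of_int q ^ 3 + 11148 * of_int q ^ 2 - 3600 * of_int q) / 600 + be * (11 * of_int q ^ 7 - 306 * of_int q ^ 6 + 3050 * of_int q ^ 5 - 14460 * of_int q ^ 4 + 31859 * of_int q ^ 3 - 29154 * of_int q ^ 2 + 9000 * of_int q) / 300) * f (w (q - 7) (w (-1) vac))"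
  "f (pr q (w 1 (w (-1) (w (-1) vac))) (w (-3) vac)) = (ga * (5 * of_int q ^ 6 - 75 * of_int q ^ 5 + 425 * of_int q ^ 4 - 1077 * of_int q ^ 3 + 1514 * of_int q ^ 2 - 792 * of_int q) / 80 + be * (- (5 * of_int q ^ 6) + 105 * of_int q ^ 5 - 605 * of_int q ^ 4 + 1719 * of_int q ^ 3 - 1838 * of_int q ^ 2 + 624 * of_int q) / 60) * f (w (q - 6) (w (-1) vac))"
  "f (pr q (w 2 (w (-1) (w (-1) vac))) (w (-3) vac)) = (ga * (- (of_int q ^ 5) + 10 * of_int q ^ 4 - 39 * of_int q ^ 3 + 46 * of_int q ^ 2 - 16 * of_int q) / 4 + be * (- (3 * of_int q ^ 4) + 6 * of_int q ^ 3 - 21 * of_int q ^ 2 + 18 * of_int q) / 2) * f (w (q - 5) (w (-1) vac))"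
  "f (pr q (w 3 (w (-1) (w (-1) vac))) (w (-3) vac)) = (ga * (of_int q ^ 4 - 2 * of_int q ^ 3 + 7 * of_int q ^ 2 - 6 * of_int q) / 2 + be * (of_int q ^ 4 + 5 * of_int q ^ 2 - 6 * of_int q)) * f (w (q - 4) (w (-1) vac))"
  "f (pr q (w 4 (w (-1) (w (-1) vac))) (w (-3) vac)) = (ga * (- (2 * of_int q ^ 3) + 6 * of_int q ^ 2 - 4 * of_int q) + be * (- (8 * of_int q ^ 3) + 24 * of_int q ^ 2 - 16 * of_int q)) * f (w (q - 3) (w (-1) vac))"
  "f (pr q (w 5 (w (-1) (w (-1) vac))) (w (-3) vac)) = (al * (of_int q ^ 2 - of_int q) + ga * (111 * of_int q ^ 2 - 111 * of_int q) / 10 + be * (72 * of_int q ^ 2 - 72 * of_int q) / 5) * f (w (q - 2) (w (-1) vac))"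
  by (simp_all add: w_U0[OF lin_mode] f_eval, algebra+)

lemma f_U2_W:
  "f (pr q (w 0 (w (-3) (w (-1) vac))) (w (-1) vac)) = (ga * (- (of_int q ^ 7) + 21 * of_int q ^ 6 - 175 * of_int q ^ 5 + 735 * of_int q ^ 4 - 2128 * of_int q ^ 3 + 3276 * of_int q ^ 2 + 18432 * of_int q - 241920) / 2520 + be * (of_int q ^ 7 - 28 * of_int q ^ 6 + 336 * of_int q ^ 5 - 2450 * of_int q ^ 4 + 8687 * of_int q ^ 3 - 1386 * of_int q ^ 2 - 153000 * of_int q + 302400) / 840) * f (w (q - 7) (w (-1) vac))"
  "f (pr q (w 1 (w (-3) (w (-1) vac))) (w (-1) vac)) = (ga * (of_int q ^ 6 - 15 * of_int q ^ 5 + 85 * of_int q ^ 4 - 105 * of_int q ^ 3 - 86 * of_int q ^ 2 - 2120 * of_int q + 35200) / 400 + be * (of_int q ^ 6 - 65 * of_int q ^ 5 + 985 * of_int q ^ 4 - 4655 * of_int q ^ 3 + 8014 * of_int q ^ 2 + 55480 * of_int q - 100800) / 600) * f (w (q - 6) (w (-1) vac))"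
  "f (pr q (w 2 (w (-3) (w (-1) vac))) (w (-1) vac)) = (ga * (- (of_int q ^ 5) + 10 * of_int q ^ 4 - 95 * of_int q ^ 3 + 230 * of_int q ^ 2 + 96 * of_int q - 9600) / 120 + be * (- (10 * of_int q ^ 2) - 38 * of_int q + 36)) * f (w (q - 5) (w (-1) vac))"
  "f (pr q (w 3 (w (-3) (w (-1) vac))) (w (-1) vac)) = (ga * (- (5 * of_int q ^ 4) + 90 * of_int q ^ 3 - 235 * of_int q ^ 2 + 378 * of_int q + 4248) / 60 + be * (45 * of_int q ^ 2 + 141 * of_int q + 126) / 5) * f (w (q - 4) (w (-1) vac))"
  "f (pr q (w 4 (w (-3) (w (-1) vac))) (w (-1) vac)) = (ga * (- 14 * of_int q - 56) + be * (- (7 * of_int q ^ 2) - 21 * of_int q - 56)) * f (w (q - 3) (w (-1) vac))"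
  "f (pr q (w 5 (w (-3) (w (-1) vac))) (w (-1) vac)) = (al * (of_int q ^ 2 - of_int q) / 2 + ga * (20 * of_int q + 40) + be * (4 * of_int q ^ 2 + 20 * of_int q + 48)) * f (w (q - 2) (w (-1) vac))"
  "f (pr q (w 6 (w (-3) (w (-1) vac))) (w (-1) vac)) = (ga * (- 141 * of_int q) / 5 + be * (- 144 * of_int q) / 5) * f (w (q - 1) (w (-1) vac))"
  "f (pr q (w 7 (w (-3) (w (-1) vac))) (w (-1) vac)) = (al * (21) + ga * (117) + be * (48)) * f (w (q) (w (-1) vac))"
  by (simp_all add: w_U2[OF lin_mode] f_eval, simp add: field_simps eval_nat_numeral, algebra+)

lemma w_pos_w_vac: "0 \<le> m \<Longrightarrow> w m (w n vac) = 
   (pr (m + n) (sc be (l (- 2) (l (- 1) vac)) + sc (2 / 5 * (ga - be)) (l (- 4) vac)) vac +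
     sc (complex_of_int m) (pr (m + n - 1) (sc be (l (- 1) (l (- 1) vac)) + sc (3 / 5 * (ga - be)) (l (- 3) vac)) vac) +
     sc (complex_of_int m gchoose 2) (pr (m + n - 2) (sc ga (l (- 2) vac)) vac) +
     sc (complex_of_int m gchoose 3) (pr (m + n - 3) (sc (2 * ga) (l (- 1) vac)) vac) +
     sc (complex_of_int m gchoose 5) (pr (m + n - 5) (sc al vac) vac))"
  by (simp add: w_w_modes[of m n vac] w_vac)

text \<open>The inner nonnegative mode contracts two factors \<open>W\<close> into modes of
  \<open>L\<close>, so these quartic-looking words are quadratic for \<open>f\<close>. They are the
  corrections to quasi-associativity that \<open>f_w_U0_1\<close> collects.\<close>

lemma f_wTW:
  "f (w k (w (-2) (w 0 (w (-2) vac)))) = (ga * (4 * of_int k ^ 7 - 84 * of_int k ^ 6 + 700 * of_int k ^ 5 - 2940 * of_int k ^ 4 + 6496 * of_int k ^ 3 - 4536 * of_int k ^ 2 + 12960 * of_int k - 151200) / 1575 + be * (- (39 * of_int k ^ 7) + 1099 * of_int k ^ 6 - 11165 * of_int k ^ 5 + 51065 * of_int k ^ 4 - 93436 * of_int k ^ 3 + 102396 * of_int k ^ 2 - 789120 * of_int k + 1512000) / 4200) * f (w (k - 7) (w (-1) vac))"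
  "f (w k (w (-3) (w 1 (w (-2) vac)))) = (ga * (11 * of_int k ^ 7 - 231 * of_int k ^ 6 + 1925 * of_int k ^ 5 - 8085 * of_int k ^ 4 + 23408 * of_int k ^ 3 - 36036 * of_int k ^ 2 - 313632 * of_int k + 1330560) / 5040 + be * (- (of_int k ^ 7) + 28 * of_int k ^ 6 - 336 * of_int k ^ 5 + 2450 * of_int k ^ 4 - 8687 * of_int k ^ 3 - 6174 * of_int k ^ 2 + 110160 * of_int k - 151200) / 280) * f (w (k - 7) (w (-1) vac))"
  "f (w k (w (-4) (w 2 (w (-2) vac)))) = (ga * (2 * of_int k ^ 7 - 42 * of_int k ^ 6 + 350 * of_int k ^ 5 - 630 * of_int k ^ 4 - 4312 * of_int k ^ 3 - 16968 * of_int k ^ 2 + 273600 * of_int k - 604800) / 1575 + be * (17 * of_int k ^ 7 - 777 * of_int k ^ 6 + 12635 * of_int k ^ 5 - 89355 * of_int k ^ 4 + 244748 * of_int k ^ 3 + 97692 * of_int k ^ 2 - 1474560 * of_int k + 1512000) / 6300) * f (w (k - 7) (w (-1) vac))"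
  "f (w k (w (-5) (w 3 (w (-2) vac)))) = (ga * (- (of_int k ^ 7) + 21 * of_int k ^ 6 + 35 * of_int k ^ 5 - 2205 * of_int k ^ 4 + 8246 * of_int k ^ 3 + 29904 * of_int k ^ 2 - 212400 * of_int k + 302400) / 1008) * f (w (k - 7) (w (-1) vac))"
  "f (w k (w (-6) (w 4 (w (-2) vac)))) = (ga * (- (2 * of_int k ^ 7) + 63 * of_int k ^ 6 - 728 * of_int k ^ 5 + 3885 * of_int k ^ 4 - 8918 * of_int k ^ 3 + 1092 * of_int k ^ 2 + 27288 * of_int k - 30240) / 315) * f (w (k - 7) (w (-1) vac))"
  "f (w k (w (-7) (w 5 (w (-2) vac)))) = 0"
  "f (w k (w (-8) (w 6 (w (-2) vac)))) = (al * (of_int k ^ 7 - 21 * of_int k ^ 6 + 175 * of_int k ^ 5 - 735 * of_int k ^ 4 + 1624 * of_int k ^ 3 - 1764 * of_int k ^ 2 + 720 * of_int k) / 840) * f (w (k - 7) (w (-1) vac))"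
  "f (w k (w (-9) (w 7 (w (-2) vac)))) = 0"
  "f (w k (w (-10) (w 8 (w (-2) vac)))) = 0"
  by (simp_all add: w_pos_w_vac pr_vac_right norm f_eval, simp_all add: field_simps eval_nat_numeral)

lemma f_wW3:
  "f (w k (w (-3) (w 0 (w (-1) vac)))) = (ga * (of_int k ^ 7 - 21 * of_int k ^ 6 + 175 * of_int k ^ 5 - 735 * of_int k ^ 4 + 2128 * of_int k ^ 3 - 3276 * of_int k ^ 2 - 28512 * of_int k + 120960) / 2520 + be * (- (of_int k ^ 7) + 28 * of_int k ^ 6 - 336 * of_int k ^ 5 + 2450 * of_int k ^ 4 - 8687 * of_int k ^ 3 - 6174 * of_int k ^ 2 + 110160 * of_int k - 151200) / 840) * f (w (k - 7) (w (-1) vac))"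
  "f (w k (w (-4) (w 1 (w (-1) vac)))) = (ga * (of_int k ^ 7 - 21 * of_int k ^ 6 + 175 * of_int k ^ 5 - 315 * of_int k ^ 4 - 2156 * of_int k ^ 3 - 8484 * of_int k ^ 2 + 136800 * of_int k - 302400) / 4200 + be * (17 * of_int k ^ 7 - 777 * of_int k ^ 6 + 12635 * of_int k ^ 5 - 89355 * of_int k ^ 4 + 244748 * of_int k ^ 3 + 97692 * of_int k ^ 2 - 1474560 * of_int k + 1512000) / 12600) * f (w (k - 7) (w (-1) vac))"
  "f (w k (w (-5) (w 2 (w (-1) vac)))) = (ga * (- (of_int k ^ 7) + 21 * of_int k ^ 6 + 35 * of_int k ^ 5 - 2205 * of_int k ^ 4 + 8246 * of_int k ^ 3 + 29904 * of_int k ^ 2 - 212400 * of_int k + 302400) / 5040) * f (w (k - 7) (w (-1) vac))"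
  "f (w k (w (-6) (w 3 (w (-1) vac)))) = (ga * (- (2 * of_int k ^ 7) + 63 * of_int k ^ 6 - 728 * of_int k ^ 5 + 3885 * of_int k ^ 4 - 8918 * of_int k ^ 3 + 1092 * of_int k ^ 2 + 27288 * of_int k - 30240) / 1260) * f (w (k - 7) (w (-1) vac))"
  "f (w k (w (-7) (w 4 (w (-1) vac)))) = 0"
  "f (w k (w (-8) (w 5 (w (-1) vac)))) = (al * (of_int k ^ 7 - 21 * of_int k ^ 6 + 175 * of_int k ^ 5 - 735 * of_int k ^ 4 + 1624 * of_int k ^ 3 - 1764 * of_int k ^ 2 + 720 * of_int k) / 5040) * f (w (k - 7) (w (-1) vac))"
  "f (w k (w (-9) (w 6 (w (-1) vac)))) = 0"
  "f (w k (w (-10) (w 7 (w (-1) vac)))) = 0"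
  "f (w k (w (-11) (w 8 (w (-1) vac)))) = 0"
  by (simp_all add: w_pos_w_vac pr_vac_right norm f_eval, simp_all add: field_simps eval_nat_numeral)

lemma f_wTTW:
  "f (w k (w (-2) (w 0 (w (-3) vac)))) = (ga * (of_int k ^ 8 - 28 * of_int k ^ 7 + 322 * of_int k ^ 6 - 1960 * of_int k ^ 5 + 6769 * of_int k ^ 4 - 13132 * of_int k ^ 3 + 17100 * of_int k ^ 2 + 15120 * of_int k - 338688) / 1008 + be * (- (of_int k ^ 8) + 35 * of_int k ^ 7 - 469 * of_int k ^ 6 + 3129 * of_int k ^ 5 - 11354 * of_int k ^ 4 + 25060 * of_int k ^ 3 - 25136 * of_int k ^ 2 - 132384 * of_int k + 352800) / 280) * f (w (k - 8) (w (-1) vac))"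
  "f (w k (w (-3) (w 1 (w (-3) vac)))) = (ga * (13 * of_int k ^ 8 - 364 * of_int k ^ 7 + 4186 * of_int k ^ 6 - 25480 * of_int k ^ 5 + 87997 * of_int k ^ 4 - 133276 * of_int k ^ 3 + 57564 * of_int k ^ 2 - 3360240 * of_int k + 15724800) / 14400 + be * (- (9 * of_int k ^ 8) + 322 * of_int k ^ 7 - 4508 * of_int k ^ 6 + 30870 * of_int k ^ 5 - 92071 * of_int k ^ 4 + 66248 * of_int k ^ 3 - 787092 * of_int k ^ 2 + 6531840 * of_int k - 10584000) / 4200) * f (w (k - 8) (w (-1) vac))"
  "f (w k (w (-4) (w 2 (w (-3) vac)))) = (ga * (of_int k ^ 8 - 28 * of_int k ^ 7 + 322 * of_int k ^ 6 - 1960 * of_int k ^ 5 + 8449 * of_int k ^ 4 - 29932 * of_int k ^ 3 - 49092 * of_int k ^ 2 + 1080240 * of_int k - 2822400) / 1440 + be * (- (of_int k ^ 8) + 28 * of_int k ^ 7 - 742 * of_int k ^ 6 + 14980 * of_int k ^ 5 - 132349 * of_int k ^ 4 + 317632 * of_int k ^ 3 + 1635012 * of_int k ^ 2 - 9092160 * of_int k + 10584000) / 5040) * f (w (k - 8) (w (-1) vac))"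
  "f (w k (w (-5) (w 3 (w (-3) vac)))) = (ga * (7 * of_int k ^ 8 - 196 * of_int k ^ 7 + 2254 * of_int k ^ 6 - 1960 * of_int k ^ 5 - 140777 * of_int k ^ 4 + 460796 * of_int k ^ 3 + 5218836 * of_int k ^ 2 - 35174160 * of_int k + 59270400) / 28800 + be * (3 * of_int k ^ 8 - 154 * of_int k ^ 7 + 3066 * of_int k ^ 6 - 29960 * of_int k ^ 5 + 146167 * of_int k ^ 4 - 271446 * of_int k ^ 3 - 357556 * of_int k ^ 2 + 1971480 * of_int k - 1764000) / 2800) * f (w (k - 8) (w (-1) vac))"
  "f (w k (w (-6) (w 4 (w (-3) vac)))) = (ga * (- (of_int k ^ 8) + 28 * of_int k ^ 7 - 154 * of_int k ^ 6 - 1568 * of_int k ^ 5 + 17591 * of_int k ^ 4 - 19628 * of_int k ^ 3 - 339996 * of_int k ^ 2 + 1432368 * of_int k - 1693440) / 1440) * f (w (k - 8) (w (-1) vac))"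
  "f (w k (w (-7) (w 5 (w (-3) vac)))) = (ga * (- (5 * of_int k ^ 8) + 196 * of_int k ^ 7 - 3010 * of_int k ^ 6 + 23296 * of_int k ^ 5 - 94045 * of_int k ^ 4 + 165004 * of_int k ^ 3 + 56740 * of_int k ^ 2 - 591696 * of_int k + 564480) / 2016) * f (w (k - 8) (w (-1) vac))"
  "f (w k (w (-8) (w 6 (w (-3) vac)))) = 0"
  "f (w k (w (-9) (w 7 (w (-3) vac)))) = (al * (of_int k ^ 8 - 28 * of_int k ^ 7 + 322 * of_int k ^ 6 - 1960 * of_int k ^ 5 + 6769 * of_int k ^ 4 - 13132 * of_int k ^ 3 + 13068 * of_int k ^ 2 - 5040 * of_int k) / 1920) * f (w (k - 8) (w (-1) vac))"
  "f (w k (w (-10) (w 8 (w (-3) vac)))) = 0"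
  by (simp_all add: w_pos_w_vac pr_vac_right norm f_eval, simp_all add: field_simps eval_nat_numeral)

lemma f_wW4:
  "f (w k (w (-4) (w 0 (w (-1) vac)))) = (ga * (of_int k ^ 8 - 28 * of_int k ^ 7 + 322 * of_int k ^ 6 - 1960 * of_int k ^ 5 + 8449 * of_int k ^ 4 - 29932 * of_int k ^ 3 - 49092 * of_int k ^ 2 + 1080240 * of_int k - 2822400) / 25200 + be * (- (of_int k ^ 8) + 28 * of_int k ^ 7 - 742 * of_int k ^ 6 + 14980 * of_int k ^ 5 - 132349 * of_int k ^ 4 + 317632 * of_int k ^ 3 + 1635012 * of_int k ^ 2 - 9092160 * of_int k + 10584000) / 25200) * f (w (k - 8) (w (-1) vac))"
  "f (w k (w (-5) (w 1 (w (-1) vac)))) = (ga * (of_int k ^ 8 - 28 * of_int k ^ 7 + 322 * of_int k ^ 6 - 280 * of_int k ^ 5 - 20111 * of_int k ^ 4 + 65828 * of_int k ^ 3 + 745548 * of_int k ^ 2 - 5024880 * of_int k + 8467200) / 67200 + be * (3 * of_int k ^ 8 - 154 * of_int k ^ 7 + 3066 * of_int k ^ 6 - 29960 * of_int k ^ 5 + 146167 * of_int k ^ 4 - 271446 * of_int k ^ 3 - 357556 * of_int k ^ 2 + 1971480 * of_int k - 1764000) / 8400) * f (w (k - 8) (w (-1) vac))"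
  "f (w k (w (-6) (w 2 (w (-1) vac)))) = (ga * (- (of_int k ^ 8) + 28 * of_int k ^ 7 - 154 * of_int k ^ 6 - 1568 * of_int k ^ 5 + 17591 * of_int k ^ 4 - 19628 * of_int k ^ 3 - 339996 * of_int k ^ 2 + 1432368 * of_int k - 1693440) / 20160) * f (w (k - 8) (w (-1) vac))"
  "f (w k (w (-7) (w 3 (w (-1) vac)))) = (ga * (- (5 * of_int k ^ 8) + 196 * of_int k ^ 7 - 3010 * of_int k ^ 6 + 23296 * of_int k ^ 5 - 94045 * of_int k ^ 4 + 165004 * of_int k ^ 3 + 56740 * of_int k ^ 2 - 591696 * of_int k + 564480) / 20160) * f (w (k - 8) (w (-1) vac))"
  "f (w k (w (-8) (w 4 (w (-1) vac)))) = 0"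
  "f (w k (w (-9) (w 5 (w (-1) vac)))) = (al * (of_int k ^ 8 - 28 * of_int k ^ 7 + 322 * of_int k ^ 6 - 1960 * of_int k ^ 5 + 6769 * of_int k ^ 4 - 13132 * of_int k ^ 3 + 13068 * of_int k ^ 2 - 5040 * of_int k) / 40320) * f (w (k - 8) (w (-1) vac))"
  "f (w k (w (-10) (w 6 (w (-1) vac)))) = 0"
  "f (w k (w (-11) (w 7 (w (-1) vac)))) = 0"
  "f (w k (w (-12) (w 8 (w (-1) vac)))) = 0"
  by (simp_all add: w_pos_w_vac pr_vac_right norm f_eval, simp_all add: field_simps eval_nat_numeral)

lemma w_w_vac_zero: "w 8 (w (-1) vac) = 0" "w 9 (w (-1) vac) = 0" "w 8 (w (-2) vac) = 0" "w 9 (w (-2) vac) = 0"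
   "w 9 (w (-3) vac) = 0"
  by (simp_all add: w_w_pos_vac[of 0, simplified] w_w_pos_vac[of 1, simplified] w_w_pos_vac[of 2, simplified])

text \<open>The three words are orderings of the same letters and the coefficients
  \<open>2, -1, -1\<close> add up to zero. The quartic part cancels and only commutators of modes of
  \<open>W\<close> remain.\<close>

lemma f_creation_1: "2 * f (w k (w (-1) (w (-1) (w (-2) vac)))) - f (w k (w (-1) (w (-2) (w (-1) vac))))
    - f (w k (w (-2) (w (-1) (w (-1) vac)))) = (ga * (11 * of_int k ^ 7 - 231 * of_int k ^ 6 + 1925 * of_int k ^ 5 - 8085 * of_int k ^ 4 + 17864 * of_int k ^ 3 - 19404 * of_int k ^ 2 + 15480 * of_int k + 90720) / 2520 + be * (- (22 * of_int k ^ 7) + 609 * of_int k ^ 6 - 5971 * of_int k ^ 5 + 26985 * of_int k ^ 4 - 60823 * of_int k ^ 3 + 76986 * of_int k ^ 2 + 37836 * of_int k - 226800) / 1260) * f (w (k - 7) (w (-1) vac))"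
  by (simp add: w_w_modes[of "-2" "-1" vac] w_w_modes[of "-2" "-1" "w (-1) vac"] norm mode_LL_W f_eval,
    simp add: field_simps eval_nat_numeral)

lemma f_creation_2: "f (w k (w (-3) (w (-1) (w (-1) vac)))) - f (w k (w (-1) (w (-1) (w (-3) vac))))
    = (ga * (- (13 * of_int k ^ 8) + 364 * of_int k ^ 7 - 4186 * of_int k ^ 6 + 25480 * of_int k ^ 5 - 87997 * of_int k ^ 4 + 170716 * of_int k ^ 3 - 169884 * of_int k ^ 2 - 15120 * of_int k - 1128960) / 13440 + be * (19 * of_int k ^ 8 - 658 * of_int k ^ 7 + 8680 * of_int k ^ 6 - 57358 * of_int k ^ 5 + 207361 * of_int k ^ 4 - 411712 * of_int k ^ 3 + 343380 * of_int k ^ 2 - 634032 * of_int k + 2116800) / 5040) * f (w (k - 8) (w (-1) vac))"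
  by (simp add: w_w_modes[of "-3" "-1" vac] w_w_modes[of "-3" "-1" "w (-1) vac"] norm mode_LL_W f_eval,
    simp add: field_simps eval_nat_numeral)

text \<open>The leading words of the two Wick products are exactly those of
  \<open>f_creation_1\<close>; this dictates the factor 2 and the modes \<open>-1\<close> and
  \<open>-2\<close>.\<close>

lemma f_w_U0_1:
  "2 * f (w k (pr (-1) (w (-1) (w (-1) vac)) (w (-2) vac))) - f (w k (pr (-2) (w (-1) (w (-1) vac)) (w (-1) vac)))
   = (al * (11 * of_int k ^ 7 - 231 * of_int k ^ 6 + 1925 * of_int k ^ 5 - 8085 * of_int k ^ 4 + 17864 * of_int k ^ 3 - 19404 * of_int k ^ 2 + 7920 * of_int k) / 2520 + ga * (8 * of_int k ^ 7 + 1302 * of_int k ^ 6 - 20335 * of_int k ^ 5 + 109200 * of_int k ^ 4 - 246253 * of_int k ^ 3 + 218358 * of_int k ^ 2 - 81180 * of_int k - 226800) / 6300 + be * (- (92 * of_int k ^ 7) + 2352 * of_int k ^ 6 - 21035 * of_int k ^ 5 + 89250 * of_int k ^ 4 - 195503 * of_int k ^ 3 + 207333 * of_int k ^ 2 - 176805 * of_int k + 283500) / 1575) * f (w (k - 7) (w (-1) vac))"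
proof -
  have 1: "f (w k (pr (-1) (w (-1) (w (-1) vac)) (w (-2) vac))) = f (w k (w (-1) (w (-1) (w (-2) vac))))
      + (\<Sum>j<9. 2 * f (w k (w (- 2 - int j) (w (int j) (w (-2) vac)))))"
    by (simp add: U0_mode[of "-1" 1, simplified] sum_lessThan_numeral pr_bilinear f_linear f_wTW w_w_vac_zero)
  have 2: "f (w k (pr (-2) (w (-1) (w (-1) vac)) (w (-1) vac))) = f (w k (w (-1) (w (-2) (w (-1) vac)))) + f (w k (w (-2) (w (-1) (w (-1) vac))))
      + (\<Sum>j<9. 2 * f (w k (w (- 3 - int j) (w (int j) (w (-1) vac)))))"
    by (simp add: U0_mode[of "-2" 0, simplified] sum_lessThan_numeral pr_bilinear f_linear f_wW3 w_w_vac_zero)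
  have "2 * f (w k (pr (-1) (w (-1) (w (-1) vac)) (w (-2) vac))) - f (w k (pr (-2) (w (-1) (w (-1) vac)) (w (-1) vac)))
    = (2 * f (w k (w (-1) (w (-1) (w (-2) vac)))) - f (w k (w (-1) (w (-2) (w (-1) vac)))) - f (w k (w (-2) (w (-1) (w (-1) vac)))))
    + 2 * (\<Sum>j<9. 2 * f (w k (w (- 2 - int j) (w (int j) (w (-2) vac)))))
    - (\<Sum>j<9. 2 * f (w k (w (- 3 - int j) (w (int j) (w (-1) vac)))))"
    unfolding 1 2 by simp
  then show ?thesis
    unfolding f_creation_1
    by (simp add: sum_lessThan_numeral f_wTW f_wW3, simp add: ring_distribs add_divide_distrib diff_divide_distrib mult_ac)
qed

lemma f_w_U0_2:
  "f (w k (pr (-1) (w (-3) (w (-1) vac)) (w (-1) vac))) - f (w k (pr (-1) (w (-1) (w (-1) vac)) (w (-3) vac)))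
   = (al * (of_int k ^ 8 - 28 * of_int k ^ 7 + 322 * of_int k ^ 6 - 1960 * of_int k ^ 5 + 6769 * of_int k ^ 4 - 13132 * of_int k ^ 3 + 13068 * of_int k ^ 2 - 5040 * of_int k) / 5760 + ga * (- (88 * of_int k ^ 8) + 2639 * of_int k ^ 7 - 33971 * of_int k ^ 6 + 233660 * of_int k ^ 5 - 873257 * of_int k ^ 4 + 1556261 * of_int k ^ 3 - 507664 * of_int k ^ 2 - 1549380 * of_int k + 529200) / 12600 + be * (208 * of_int k ^ 8 - 7504 * of_int k ^ 7 + 106981 * of_int k ^ 6 - 789985 * of_int k ^ 5 + 3147487 * of_int k ^ 4 - 5856571 * of_int k ^ 3 + 1329204 * of_int k ^ 2 + 7286580 * of_int k - 2646000) / 12600) * f (w (k - 8) (w (-1) vac))"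
proof -
  have 1: "f (w k (pr (-1) (w (-3) (w (-1) vac)) (w (-1) vac))) = f (w k (w (-3) (w (-1) (w (-1) vac))))
      + (\<Sum>j<9. ((-1) ^ j * (-3 gchoose j) - (-1) ^ j * (-3 gchoose (Suc j))) * f (w k (w (- 4 - int j) (w (int j) (w (-1) vac)))))"
    by (simp add: U2_mode[of "-1" 0, simplified] sum_lessThan_numeral pr_bilinear f_linear w_w_vac_zero numeral_2_eq_2[symmetric] algebra_simps)
  have 2: "f (w k (pr (-1) (w (-1) (w (-1) vac)) (w (-3) vac))) = f (w k (w (-1) (w (-1) (w (-3) vac))))
      + (\<Sum>j<9. 2 * f (w k (w (- 2 - int j) (w (int j) (w (-3) vac)))))"
    by (simp add: U0_mode[of "-1" 2, simplified] sum_lessThan_numeral pr_bilinear f_linear f_wTTW w_w_vac_zero)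
  have "f (w k (pr (-1) (w (-3) (w (-1) vac)) (w (-1) vac))) - f (w k (pr (-1) (w (-1) (w (-1) vac)) (w (-3) vac)))
    = (f (w k (w (-3) (w (-1) (w (-1) vac)))) - f (w k (w (-1) (w (-1) (w (-3) vac)))))
    + (\<Sum>j<9. ((-1) ^ j * (-3 gchoose j) - (-1) ^ j * (-3 gchoose (Suc j))) * f (w k (w (- 4 - int j) (w (int j) (w (-1) vac)))))
    - (\<Sum>j<9. 2 * f (w k (w (- 2 - int j) (w (int j) (w (-3) vac)))))"
    unfolding 1 2 by simp
  then show ?thesis
    unfolding f_creation_2
    by (simp add: sum_lessThan_numeral f_wTTW f_wW4 gchoose_num numeral_2_eq_2[symmetric], simp add: ring_distribs add_divide_distrib diff_divide_distrib mult_ac)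
qed

lemma f_comm_sum_1:
  "2 * (\<Sum>j<6. (of_int k gchoose j) * f (pr (k + -1 - int j) (w (int j) (w (-1) (w (-1) vac))) (w (-2) vac)))
    - (\<Sum>j<6. (of_int k gchoose j) * f (pr (k + -2 - int j) (w (int j) (w (-1) (w (-1) vac))) (w (-1) vac)))
   = (al * (2 * of_int k ^ 6 - 33 * of_int k ^ 5 + 200 * of_int k ^ 4 - 555 * of_int k ^ 3 + 698 * of_int k ^ 2 - 312 * of_int k) / 60 + ga * (22 * of_int k ^ 6 + 157 * of_int k ^ 5 - 4240 * of_int k ^ 4 + 19655 * of_int k ^ 3 - 28002 * of_int k ^ 2 + 6228 * of_int k - 10800) / 300 + be * (- (28 * of_int k ^ 6) + 657 * of_int k ^ 5 - 4790 * of_int k ^ 4 + 13005 * of_int k ^ 3 - 9327 * of_int k ^ 2 - 9297 * of_int k + 13500) / 75) * f (w (k - 7) (w (-1) vac))"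
  by (simp add: sum_lessThan_numeral f_U0_W f_U0_TW gchoose_num, simp add: ring_distribs add_divide_distrib diff_divide_distrib mult_ac eval_nat_numeral)

lemma f_comm_sum_2:
  "(\<Sum>j<8. (of_int k gchoose j) * f (pr (k + -1 - int j) (w (int j) (w (-3) (w (-1) vac))) (w (-1) vac)))
    - (\<Sum>j<6. (of_int k gchoose j) * f (pr (k + -1 - int j) (w (int j) (w (-1) (w (-1) vac))) (w (-3) vac)))
   = (al * (of_int k ^ 6 - 16 * of_int k ^ 5 + 95 * of_int k ^ 4 - 260 * of_int k ^ 3 + 324 * of_int k ^ 2 - 144 * of_int k) / 120 + ga * (- (211 * of_int k ^ 7) + 4599 * of_int k ^ 6 - 39844 * of_int k ^ 5 + 171605 * of_int k ^ 4 - 355089 * of_int k ^ 3 + 182056 * of_int k ^ 2 + 476204 * of_int k - 653520) / 4200 + be * (416 * of_int k ^ 7 - 13209 * of_int k ^ 6 + 153349 * of_int k ^ 5 - 842555 * of_int k ^ 4 + 2217159 * of_int k ^ 3 - 1940596 * of_int k ^ 2 - 2160084 * of_int k + 3442320) / 4200) * f (w (k - 8) (w (-1) vac))"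
  by (simp add: sum_lessThan_numeral f_U2_W f_U0_TTW gchoose_num, simp add: ring_distribs add_divide_distrib diff_divide_distrib mult_ac eval_nat_numeral)

lemma double_diff_diff: "2 * (a - x) - (b - y) = (2 * a - b) - (2 * x - y)" for a b x y :: complex
  by simp

text \<open>Both sides of the commutator are evaluated at \<open>k = - m\<close>. Regrouping by
  \<open>double_diff_diff\<close> first brings the unknown quartic values together, where they
  cancel.\<close>

lemma relation_1:
  "2 * f (pr (-1) (w (-1) (w (-1) vac)) (w (- m) (w (-2) vac))) - f (pr (-2) (w (-1) (w (-1) vac)) (w (- m) (w (-1) vac)))
   = of_int m * (of_int m + 12) * (of_int m + 2) * (of_int m + 4) / 12600 *
    (- 5 * (11 * of_int m + 73) * (of_int m + 1) * (of_int m + 3) * al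
     + 16 * (of_int m + 6) * (46 + 129 * of_int m - of_int m * of_int m) * ga
     + 32 * (of_int m + 6) * (of_int m + 8) * (23 * of_int m - 1) * be)
    * f (w (- m - 7) (w (-1) vac))"
  unfolding f_comm_U0 double_diff_diff f_w_U0_1 f_comm_sum_1
  by (simp add: ring_distribs add_divide_distrib diff_divide_distrib mult_ac eval_nat_numeral)

lemma diff_diff_diff: "(a - x) - (b - y) = (a - b) - (x - y)" for a b x y :: complex
  by simp

text \<open>The same scheme for \<open>U 2\<close> against \<open>U 0\<close>, at
  \<open>k = 1 - m\<close>. The factor \<open>of_int m - 2\<close> makes this relation empty for
  \<open>m = 2\<close>, that is, in weight 14.\<close>

lemma relation_2:
  "f (pr (-1) (w (-3) (w (-1) vac)) (w (1 - m) (w (-1) vac))) - f (pr (-1) (w (-1) (w (-1) vac)) (w (1 - m) (w (-3) vac)))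
   = of_int m * (of_int m + 12) * (of_int m + 2) * (of_int m - 2) / 201600 *
    (35 * (of_int m + 5) * (of_int m + 3) * (of_int m + 1) * (of_int m - 1) * al
     - 128 * (of_int m + 6) * (of_int m + 4) * (of_int m + 3) * (11 * of_int m + 46) * ga
     + 256 * (of_int m + 8) * (of_int m + 6) * (of_int m + 4) * (13 * of_int m + 53) * be)
    * f (w (- 7 - m) (w (-1) vac))"
  unfolding f_comm_U0 f_comm_U2 diff_diff_diff f_w_U0_2 f_comm_sum_2
  by (simp add: ring_distribs add_divide_distrib diff_divide_distrib mult_ac eval_nat_numeral)

end

section \<open>Words, weights and the filtration by the number of factors\<close>

context w3
begin

definition lw :: "nat list \<Rightarrow> 'v \<Rightarrow> 'v" where "lw as x = foldr (\<lambda>a. l (-1 - int a)) as x"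
definition ww :: "nat list \<Rightarrow> 'v" where "ww bs = foldr (\<lambda>b. w (-1 - int b)) bs vac"

lemma lw_simps [simp]: "lw [] x = x" "lw (a # as) x = l (-1 - int a) (lw as x)"
  and ww_simps [simp]: "ww [] = vac" "ww (b # bs) = w (-1 - int b) (ww bs)"
  by (simp_all add: lw_def ww_def)

lemma neg_int: "n < 0 \<Longrightarrow> \<exists>a. n = -1 - int a"
  by (rule exI[of _ "nat (-1 - n)"]) simp

lemma pbw_mon_eq: "\<exists>r. r \<noteq> 0 \<and> pbw_mon vac pr L W (as, bs) = sc r (lw as (ww bs))"
proof -
  have d: "pr (-1) (der vac pr k a) x = sc (fact k) (pr (-1 - int k) a x)" for k a x
    by (simp add: der_def pr_T_pow)
  have b: "\<exists>r. r \<noteq> 0 \<and> nmon vac pr (map (\<lambda>b. der vac pr b W) bs) = sc r (ww bs)"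
  proof (induction bs)
    case Nil
    show ?case by (rule exI[of _ 1]) simp
  next
    case (Cons b bs)
    then obtain r where "r \<noteq> 0" "nmon vac pr (map (\<lambda>b. der vac pr b W) bs) = sc r (ww bs)" by blast
    then show ?case by (intro exI[of _ "fact b * r"]) (simp add: d pr_bilinear)
  qed
  have "\<exists>r. r \<noteq> 0 \<and> nmon vac pr (map (\<lambda>a. der vac pr a L) as @ map (\<lambda>b. der vac pr b W) bs) = sc r (lw as (ww bs))"
  proof (induction "as")
    case Nil
    then show ?case using b by simp
  next
    case (Cons a as)
    then obtain r where "r \<noteq> 0" "nmon vac pr (map (\<lambda>a. der vac pr a L) as @ map (\<lambda>b. der vac pr b W) bs) = sc r (lw as (ww bs))" by blast
    then show ?case by (intro exI[of _ "fact a * r"]) (simp add: d pr_bilinear)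
  qed
  then show ?thesis by (simp add: pbw_mon_def)
qed

abbreviation dec :: "nat list \<Rightarrow> bool" where "dec \<equiv> sorted_wrt (\<ge>)"

lemma mon_span: "x \<in> span {lw as (ww bs) | as bs. dec as \<and> dec bs}" (is "_ \<in> span ?B")
proof -
  have "pbw_mon vac pr L W ` pbw_index \<subseteq> span ?B"
  proof clarify
    fix as bs assume "(as, bs) \<in> pbw_index"
    then have "lw as (ww bs) \<in> ?B" by (auto simp: pbw_index_def)
    then have "lw as (ww bs) \<in> span ?B" by (rule span_base)
    moreover obtain r where "pbw_mon vac pr L W (as, bs) = sc r (lw as (ww bs))" using pbw_mon_eq by blast
    ultimately show "pbw_mon vac pr L W (as, bs) \<in> span ?B" by (simp add: span_scale)
  qed
  then show ?thesis using pbw_span span_minimal[OF _ subspace_span] by blast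
qed

text \<open>This is where freeness of the algebra enters: values on PBW words may be prescribed at
  will. The scalars \<open>r\<close> convert between derivatives and modes.\<close>

lemma linear_extension:
  "\<exists>f. lin sc f \<and> (\<forall>as bs. dec as \<and> dec bs \<longrightarrow> f (lw as (ww bs)) = G as bs)"
proof -
  interpret vp: vector_space_pair sc "(*) :: complex \<Rightarrow> complex \<Rightarrow> complex"
    by unfold_locales (auto simp: algebra_simps)
  define r where "r = (\<lambda>as bs. SOME r. r \<noteq> 0 \<and> pbw_mon vac pr L W (as, bs) = sc r (lw as (ww bs)))"
  have r: "r as bs \<noteq> 0 \<and> pbw_mon vac pr L W (as, bs) = sc (r as bs) (lw as (ww bs))" for "as" bs
    unfolding r_def by (rule someI_ex[OF pbw_mon_eq])
  obtain f where f: "Vector_Spaces.linear sc (*) f"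
    "\<forall>x\<in>pbw_mon vac pr L W ` pbw_index. f x = (case inv_into pbw_index (pbw_mon vac pr L W) x of (as, bs) \<Rightarrow> r as bs * G as bs)"
    using vp.linear_independent_extend[OF pbw_indep, of "\<lambda>x. case inv_into pbw_index (pbw_mon vac pr L W) x of (as, bs) \<Rightarrow> r as bs * G as bs"] by blast
  interpret f: Vector_Spaces.linear sc "(*)" f by fact
  have "f (lw as (ww bs)) = G as bs" if "dec as" "dec bs" for "as" bs
  proof -
    have i: "(as, bs) \<in> pbw_index" using that by (simp add: pbw_index_def)
    have "r as bs * f (lw as (ww bs)) = f (pbw_mon vac pr L W (as, bs))" using r[of "as" bs] by (simp add: f.scale)
    also have "\<dots> = r as bs * G as bs" using f(2) i inv_into_f_f[OF pbw_inj i] by auto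
    finally show ?thesis using r[of "as" bs] by simp
  qed
  moreover have "lin sc f" by (simp add: lin_def f.add f.scale)
  ultimately show ?thesis by blast
qed

lemma separating_functional:
  assumes "subspace S" "x \<notin> S"
  shows "\<exists>f. lin sc f \<and> (\<forall>y\<in>S. f y = 0) \<and> f x = 1"
proof -
  interpret vp: vector_space_pair sc "(*) :: complex \<Rightarrow> complex \<Rightarrow> complex"
    by unfold_locales (auto simp: algebra_simps)
  obtain B where B: "B \<subseteq> S" "independent B" "S \<subseteq> span B" by (rule maximal_independent_subset)
  have SB: "span B = S" using B assms(1) by (metis span_minimal subset_antisym)
  with assms(2) B have "independent (insert x B)" by (simp add: independent_insert)
  then obtain f where f: "Vector_Spaces.linear sc (*) f" "\<forall>y\<in>insert x B. f y = (if y = x then 1 else 0)"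
    using vp.linear_independent_extend[of "insert x B" "\<lambda>y. if y = x then 1 else 0"] by blast
  interpret f: Vector_Spaces.linear sc "(*)" f by fact
  have "x \<notin> B" using assms(2) B by blast
  have "f y = 0" if "y \<in> span B" for y
    using that by (induction rule: span_induct_alt) (use f(2) \<open>x \<notin> B\<close> in \<open>auto simp: f.add f.scale\<close>)
  then show ?thesis using f(2) SB by (intro exI[of _ f]) (auto simp: lin_def f.add f.scale)
qed

lemma lin_span_zero:
  assumes "lin sc f" "x \<in> span S" "\<And>y. y \<in> S \<Longrightarrow> f y = 0"
  shows "f x = 0"
  using assms(2)
proof (induction rule: span_induct_alt)
  case base
  have "f (sc 0 0) = 0 * f 0" using assms(1) unfolding lin_def by blast
  then show ?case by simp
next
  case (step c x y)
  then show ?case using assms(1,3) by (simp add: lin_def)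
qed

lemma linear_span:
  assumes "x \<in> span S" "\<And>y. y \<in> S \<Longrightarrow> h y \<in> V" "subspace V"
    "\<And>x y. h (x + y) = h x + h y" "\<And>r x. h (sc r x) = sc r (h x)"
  shows "h x \<in> V"
  using assms(1)
proof (induction rule: span_induct_alt)
  case base
  have "h (sc 0 0) = sc 0 (h 0)" by (rule assms(5))
  then show ?case using assms(3) by (simp add: subspace_0)
next
  case (step c x y)
  then show ?case using assms by (simp add: subspace_add subspace_scale)
qed

lemma pr_span: "x \<in> span S \<Longrightarrow> (\<And>y. y \<in> S \<Longrightarrow> pr n a y \<in> V) \<Longrightarrow> subspace V \<Longrightarrow> pr n a x \<in> V"
  by (rule linear_span[of x S "pr n a" V]) (auto simp: pr_bilinear)

lemma pr_span_left: "a \<in> span S \<Longrightarrow> (\<And>b. b \<in> S \<Longrightarrow> pr n b x \<in> V) \<Longrightarrow> subspace V \<Longrightarrow> pr n a x \<in> V"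
  by (rule linear_span[of a S "\<lambda>a. pr n a x" V]) (auto simp: pr_bilinear)

text \<open>\<open>T\<close> is defined through the vacuum, not through \<open>L\<close>. Both
  operators kill \<open>vac\<close> and have the same commutators with all \<open>l n\<close> and
  \<open>w n\<close>, so they agree on the spanning words.\<close>

lemma T_eq_l0: "T x = l 0 x"
proof -
  have w: "T (ww bs) = l 0 (ww bs)" for bs
    by (induction bs) (simp_all add: T_w l_w)
  have m: "T (lw as (ww bs)) = l 0 (lw as (ww bs))" for "as" bs
    by (induction "as") (simp_all add: w T_l l_l[of 0])
  have "subspace {0 :: 'v}" by (auto simp: subspace_def)
  have "T x - l 0 x \<in> {0}"
  proof (rule linear_span[OF mon_span[of x], where h = "\<lambda>x. T x - l 0 x"])
    show "T y - l 0 y \<in> {0}" if "y \<in> {lw as (ww bs) |as bs. dec as \<and> dec bs}" for y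
      using that m by auto
  qed (use \<open>subspace {0}\<close> in \<open>simp_all add: T_linear pr_bilinear scale_right_diff_distrib\<close>)
  then show ?thesis by simp
qed

section \<open>Conformal weight and parity\<close>

definition V :: "int \<Rightarrow> 'v set" where "V d = {x. l 1 x = sc (of_int d) x}"

lemma V_subspace: "subspace (V d)"
  by (auto simp: V_def subspace_def pr_bilinear algebra_simps)

lemma V_pr:
  assumes x: "x \<in> V p" and y: "y \<in> V q" and d: "d = p + q - n - 1"
  shows "pr n x y \<in> V d"
proof -
  obtain N where N: "\<And>j. j \<ge> N \<Longrightarrow> l (0 + int j) x = 0" using truncation_nat by blast
  have "l 1 (pr n x y) = pr n x (l 1 y) + (\<Sum>j<N + 2. sc (of_int 1 gchoose j) (pr (1 + n - int j) (l (int j) x) y))"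
    by (rule commutator) (use N in auto)
  also have "(\<Sum>j<N + 2. sc (of_int 1 gchoose j) (pr (1 + n - int j) (l (int j) x) y))
      = (\<Sum>j<2. sc (of_int 1 gchoose j) (pr (1 + n - int j) (l (int j) x) y))"
  proof (rule sum.mono_neutral_right)
    have "(1 gchoose j :: complex) = 0" if "j \<ge> 2" for j
      using binomial_gbinomial[of 1 j, where 'a=complex] that by (simp add: binomial_eq_0)
    then show "\<forall>i\<in>{..<N + 2} - {..<2}. sc (of_int 1 gchoose i) (pr (1 + n - int i) (l (int i) x) y) = 0"
      by auto
  qed auto
  also have "\<dots> = pr (1 + n) (T x) y + pr n (l 1 x) y"
    by (simp add: numeral_2_eq_2 T_eq_l0)
  finally have "l 1 (pr n x y) = sc (of_int q - (of_int n + 1) + of_int p) (pr n x y)"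
    using x y by (simp only: V_def mem_Collect_eq pr_scale_left pr_scale_right pr_T_left scale_left_distrib
        scale_left_diff_distrib) (simp add: pr_bilinear scale_left_distrib scale_left_diff_distrib)
  moreover have "of_int q - (of_int n + 1) + of_int p = (of_int d :: complex)"
    by (simp add: d)
  ultimately show ?thesis by (simp add: V_def)
qed

lemma V_L: "L \<in> V 2" and V_W: "W \<in> V 3" and V_vac: "vac \<in> V 0"
  by (simp_all add: V_def LL LW l_vac)

lemma V_l: "x \<in> V q \<Longrightarrow> d = q + 1 - n \<Longrightarrow> l n x \<in> V d" and V_w: "x \<in> V q \<Longrightarrow> d = q + 2 - n \<Longrightarrow> w n x \<in> V d"
  by (rule V_pr[OF V_L] V_pr[OF V_W]; simp)+

lemma V_T: "x \<in> V q \<Longrightarrow> T x \<in> V (q + 1)"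
  unfolding tr_def by (rule V_pr[OF _ V_vac]) auto

definition wt :: "nat list \<Rightarrow> nat list \<Rightarrow> nat" where
  "wt as bs = (\<Sum>a\<leftarrow>as. a + 2) + (\<Sum>b\<leftarrow>bs. b + 3)"

lemma V_mon: "lw as (ww bs) \<in> V (int (wt as bs))"
proof (induction "as")
  case Nil
  show ?case
  proof (induction bs)
    case (Cons b bs)
    then show ?case by (auto simp: wt_def intro!: V_w)
  qed (simp add: V_vac wt_def)
next
  case (Cons a as)
  then show ?case by (auto simp: wt_def intro!: V_l)
qed

lemma theta_mon: "\<theta> (lw as (ww bs)) = sc ((-1) ^ length bs) (lw as (ww bs))"
proof (induction "as")
  case Nil
  show ?case by (induction bs) (simp_all add: theta_pr theta_W theta_vac pr_bilinear)
next
  case (Cons a as)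
  then show ?case by (simp add: theta_pr theta_L pr_bilinear)
qed

lemma ev_mon: "even (length bs) \<Longrightarrow> ev (lw as (ww bs))"
  by (simp add: ev_def theta_mon)

definition E :: "int \<Rightarrow> 'v set" where "E d = {x \<in> V d. ev x}"

lemma ev_span: "x \<in> span S \<Longrightarrow> (\<And>y. y \<in> S \<Longrightarrow> ev y) \<Longrightarrow> ev x"
  by (induction rule: span_induct_alt) (auto intro: ev_add ev_sc)

lemma coordinates:
  obtains K r where "finite K" "x = (\<Sum>p\<in>K. sc (r p) (lw (fst p) (ww (snd p))))"
    "\<And>p. p \<in> K \<Longrightarrow> dec (fst p) \<and> dec (snd p)"
proof -
  let ?P = "\<lambda>x. \<exists>K r. finite K \<and> x = (\<Sum>p\<in>K. sc (r p) (lw (fst p) (ww (snd p)))) \<and> (\<forall>p\<in>K. dec (fst p) \<and> dec (snd p))"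
  have "?P x"
    using mon_span[of x]
  proof (induction rule: span_induct_alt)
    case base
    show ?case by (rule exI[of _ "{}"]) simp
  next
    case (step c x y)
    then obtain "as" bs K r where x: "x = lw as (ww bs)" "dec as" "dec bs"
      and y: "finite K" "y = (\<Sum>p\<in>K. sc (r p) (lw (fst p) (ww (snd p))))" "\<forall>p\<in>K. dec (fst p) \<and> dec (snd p)"
      by blast
    define r' where "r' = (\<lambda>p. if p \<in> K then r p else 0)"
    have y2: "y = (\<Sum>p\<in>insert (as, bs) K. sc (r' p) (lw (fst p) (ww (snd p))))"
      unfolding y(2) r'_def by (rule sum.mono_neutral_cong_left) (use y in auto)
    have "sc c x = (\<Sum>p\<in>insert (as, bs) K. sc (if p = (as, bs) then c else 0) (lw (fst p) (ww (snd p))))"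
      using y(1) by (subst sum.remove[of _ "(as, bs)"]) (auto simp: x intro!: sum.neutral)
    then have "sc c x + y = (\<Sum>p\<in>insert (as, bs) K. sc ((if p = (as, bs) then c else 0) + r' p) (lw (fst p) (ww (snd p))))"
      unfolding y2 by (simp add: sum.distrib[symmetric] scale_left_distrib)
    then show ?case using x y
      by (intro exI[of _ "insert (as, bs) K"] exI[of _ "\<lambda>p. (if p = (as, bs) then c else 0) + r' p"]) auto
  qed
  then show thesis using that by blast
qed

text \<open>The PBW coordinates of \<open>x\<close> are compared with those of \<open>l 1 x\<close>
  and of \<open>\<theta> x\<close>. Dual functionals read off one coordinate at a time, and those of
  the wrong weight or parity must vanish.\<close>

lemma E_span:
  assumes "x \<in> E d"
  shows "x \<in> span {lw as (ww bs) | as bs. dec as \<and> dec bs \<and> even (length bs) \<and> int (wt as bs) = d}"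
proof -
  obtain K r where K: "finite K" "x = (\<Sum>p\<in>K. sc (r p) (lw (fst p) (ww (snd p))))"
    "\<And>p. p \<in> K \<Longrightarrow> dec (fst p) \<and> dec (snd p)"
    using coordinates[of x] by blast
  have r: "r p = 0" if p: "p \<in> K" "odd (length (snd p)) \<or> int (wt (fst p) (snd p)) \<noteq> d" for p
  proof -
    obtain f where f: "lin sc f" "\<And>as bs. dec as \<and> dec bs \<Longrightarrow> f (lw as (ww bs)) = (if (as, bs) = p then 1 else 0 :: complex)"
      using linear_extension[of "\<lambda>as bs. if (as, bs) = p then 1 else 0"] by blast
    have f0: "f 0 = 0" using f(1) unfolding lin_def by (metis mult_zero_left scale_zero_left)
    have fs: "f (\<Sum>q\<in>K. sc (s q) (lw (fst q) (ww (snd q)))) = s p" for s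
    proof -
      have "f (\<Sum>q\<in>K'. sc (s q) (lw (fst q) (ww (snd q)))) = (\<Sum>q\<in>K'. s q * f (lw (fst q) (ww (snd q))))" if "finite K'" for K'
        using that by (induction K') (use f(1) in \<open>auto simp: f0 lin_def\<close>)
      from this[OF K(1)] show ?thesis using K p by (simp add: f(2) if_distrib cong: if_cong)
    qed
    have "l 1 x = (\<Sum>q\<in>K. sc (r q * of_nat (wt (fst q) (snd q))) (lw (fst q) (ww (snd q))))"
      using V_mon unfolding K(2) V_def by (simp add: pr_sum_right pr_bilinear)
    moreover have "l 1 x = (\<Sum>q\<in>K. sc (r q * of_int d) (lw (fst q) (ww (snd q))))"
    proof -
      have "l 1 x = sc (of_int d) x" using assms by (simp add: E_def V_def)
      also have "\<dots> = sc (of_int d) (\<Sum>p\<in>K. sc (r p) (lw (fst p) (ww (snd p))))" by (rule arg_cong[OF K(2)])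
      finally show ?thesis by (simp add: scale_sum_right mult.commute)
    qed
    ultimately have "f (\<Sum>q\<in>K. sc (r q * of_nat (wt (fst q) (snd q))) (lw (fst q) (ww (snd q))))
        = f (\<Sum>q\<in>K. sc (r q * of_int d) (lw (fst q) (ww (snd q))))" by simp
    then have 1: "r p * of_nat (wt (fst p) (snd p)) = r p * of_int d" unfolding fs .
    have ts: "\<theta> (\<Sum>q\<in>K'. g q) = (\<Sum>q\<in>K'. \<theta> (g q))" for g and K' :: "(nat list \<times> nat list) set"
      by (induction K' rule: infinite_finite_induct) (auto simp: theta_0 theta_add)
    have "\<theta> x = (\<Sum>q\<in>K. sc (r q * (-1) ^ length (snd q)) (lw (fst q) (ww (snd q))))"
      unfolding K(2) ts by (simp add: theta_sc theta_mon)
    moreover have "\<theta> x = (\<Sum>q\<in>K. sc (r q) (lw (fst q) (ww (snd q))))"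
      using assms K(2) by (simp add: E_def ev_def)
    ultimately have "f (\<Sum>q\<in>K. sc (r q * (-1) ^ length (snd q)) (lw (fst q) (ww (snd q))))
        = f (\<Sum>q\<in>K. sc (r q) (lw (fst q) (ww (snd q))))" by simp
    then have 2: "r p * (-1) ^ length (snd p) = r p" unfolding fs .
    have "of_nat (wt (fst p) (snd p)) = (of_int d :: complex) \<longleftrightarrow> int (wt (fst p) (snd p)) = d"
      by (metis of_int_eq_iff of_int_of_nat_eq)
    then show ?thesis using 1 2 p(2) by auto
  qed
  have "(\<Sum>p\<in>K. sc (r p) (lw (fst p) (ww (snd p)))) \<in> span {lw as (ww bs) | as bs. dec as \<and> dec bs \<and> even (length bs) \<and> int (wt as bs) = d}"
  proof (rule span_sum)
    fix p assume p: "p \<in> K"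
    show "sc (r p) (lw (fst p) (ww (snd p))) \<in> span {lw as (ww bs) | as bs. dec as \<and> dec bs \<and> even (length bs) \<and> int (wt as bs) = d}"
    proof (cases "r p = 0")
      case False
      then show ?thesis using r[OF p] K(3)[OF p] by (intro span_scale span_base) blast
    qed (simp add: span_zero)
  qed
  then show ?thesis using K(2) by simp
qed

lemma ev_mon_span:
  assumes "ev x"
  shows "x \<in> span {lw as (ww bs) | as bs. dec as \<and> dec bs \<and> even (length bs)}" (is "_ \<in> span ?B")
proof -
  have "sc (1/2) (x + \<theta> x) \<in> span ?B"
  proof (rule linear_span[OF mon_span[of x], where h = "\<lambda>x. sc (1/2) (x + \<theta> x)"])
    fix y assume "y \<in> {lw as (ww bs) |as bs. dec as \<and> dec bs}"
    then obtain "as" bs where y: "y = lw as (ww bs)" "dec as" "dec bs" by blast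
    show "sc (1/2) (y + \<theta> y) \<in> span ?B"
    proof (cases "even (length bs)")
      case True
      then have "y \<in> ?B" using y by blast
      then have "y \<in> span ?B" by (rule span_base)
      moreover have "\<theta> y = y" using True y by (simp add: theta_mon)
      ultimately show ?thesis by (simp add: span_scale span_add)
    qed (simp add: y theta_mon span_zero)
  qed (auto simp: theta_add theta_sc algebra_simps)
  moreover have "sc (1/2) (x + x) = x"
    using scale_left_distrib[of "1/2" "1/2" x] by (simp add: scale_right_distrib)
  ultimately show ?thesis using assms by (simp add: ev_def)
qed

lemma ev_subspace: "subspace {x. ev x}"
  by (auto simp: subspace_def intro: ev_add ev_sc)

lemma E_subspace: "subspace (E d)"
  using V_subspace[of d] by (auto simp: E_def subspace_def intro: ev_add ev_sc)

lemma E_pr: "x \<in> E p \<Longrightarrow> y \<in> E q \<Longrightarrow> d = p + q - n - 1 \<Longrightarrow> pr n x y \<in> E d"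
  by (auto simp: E_def intro: V_pr ev_pr)

lemma E_w_w: "x \<in> E q \<Longrightarrow> d = q + 4 - r - p \<Longrightarrow> w r (w p x) \<in> E d"
  by (auto simp: E_def intro!: V_w)

lemma E_T: "x \<in> E q \<Longrightarrow> T x \<in> E (q + 1)"
  by (auto simp: E_def intro: V_T ev_T)

lemma E_vac: "vac \<in> E 0" and E_L: "L \<in> E 2"
  by (simp_all add: E_def V_vac V_L)

lemma E_mon: "even (length bs) \<Longrightarrow> lw as (ww bs) \<in> E (int (wt as bs))"
  by (simp add: E_def V_mon ev_mon)

text \<open>Only the factors \<open>W\<close> are counted. The parity condition records that
  commuting two modes of \<open>W\<close> replaces them by modes of \<open>L\<close>, so the count
  drops by two. Words need not be ordered.\<close>

definition F :: "nat \<Rightarrow> 'v set" where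
  "F k = span {lw as (ww bs) | as bs. length bs \<le> k \<and> even (length bs + k)}"

lemma F_subspace: "subspace (F k)"
  by (simp add: F_def)

lemma F_mon: "length bs \<le> k \<Longrightarrow> even (length bs + k) \<Longrightarrow> lw as (ww bs) \<in> F k"
  unfolding F_def by (rule span_base) blast

lemma F_mono: "j \<le> k \<Longrightarrow> even (j + k) \<Longrightarrow> F j \<subseteq> F k"
  unfolding F_def
proof (rule span_mono, rule subsetI)
  fix y assume jk: "j \<le> k" "even (j + k)" and "y \<in> {lw as (ww bs) |as bs. length bs \<le> j \<and> even (length bs + j)}"
  then obtain "as" bs where "y = lw as (ww bs)" "length bs \<le> j" "even (length bs + j)" by blast
  then show "y \<in> {lw as (ww bs) |as bs. length bs \<le> k \<and> even (length bs + k)}"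
    using jk by (intro CollectI exI[of _ "as"] exI[of _ bs]) auto
qed

lemma F_l_neg: "x \<in> F k \<Longrightarrow> l (-1 - int a) x \<in> F k"
  unfolding F_def
proof (rule pr_span, assumption)
  fix y assume "y \<in> {lw as (ww bs) |as bs. length bs \<le> k \<and> even (length bs + k)}"
  then obtain "as" bs where "y = lw as (ww bs)" "length bs \<le> k" "even (length bs + k)" by blast
  then show "l (-1 - int a) y \<in> span {lw as (ww bs) |as bs. length bs \<le> k \<and> even (length bs + k)}"
    by (intro span_base CollectI exI[of _ "a # as"] exI[of _ bs]) auto
qed (rule subspace_span)

text \<open>Every product \<open>w (int j) W\<close> is built from \<open>L\<close> and
  \<open>vac\<close>, so its modes act through modes of \<open>L\<close>.\<close>

lemma mode_LL_closed:
  assumes S: "subspace S" and l: "\<And>n z. z \<in> S \<Longrightarrow> l n z \<in> S" and y: "y \<in> S"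
  shows "pr r (w (int j) W) y \<in> S"
proof -
  note cl = subspace_add[OF S] subspace_scale[OF S] subspace_diff[OF S] subspace_sum[OF S] subspace_0[OF S] subspace_neg[OF S]
  obtain N1 where N1: "\<And>j. j \<ge> N1 \<Longrightarrow> l (r + int j) y = 0" using truncation_nat by blast
  obtain N2 where N2: "\<And>j. j \<ge> N2 \<Longrightarrow> l (0 + int j) y = 0" using truncation_nat by blast
  have "pr r (l (-1) (l (-1) vac)) y \<in> S"
    by (subst mode_LL(1)[of "max N1 N2"]) (use N1 N2 in \<open>auto intro!: cl l y\<close>)
  moreover have "pr r (l (-2) (l (-1) vac)) y \<in> S"
    by (subst mode_LL(2)[of "max N1 N2"]) (use N1 N2 in \<open>auto intro!: cl l y\<close>)
  ultimately show ?thesis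
    by (auto simp: WW_num pr_bilinear mode_l_vac pr_vac_left intro!: cl l y)
qed

lemma w_w_closed:
  assumes S: "subspace S" and l: "\<And>n z. z \<in> S \<Longrightarrow> l n z \<in> S" and y: "y \<in> S"
  shows "w m (w n y) - w n (w m y) \<in> S"
  using w_w[of m n y] mode_LL_closed[OF S l y]
  by (auto intro!: subspace_sum[OF S] subspace_scale[OF S])

text \<open>The statements need a joint induction: contracting a word with a nonnegative mode uses
  closure under \<open>w\<close> at smaller counts, and closure under \<open>w\<close> uses that
  contraction. For \<open>k = 0\<close> there is nothing left to contract, so the target is
  \<open>{0}\<close>, not \<open>F (0 - 1)\<close>.\<close>

lemma F_closed:
  "(\<forall>n x. x \<in> F k \<longrightarrow> l n x \<in> F k \<and> w n x \<in> F (Suc k))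
    \<and> (\<forall>n bs. n \<ge> 0 \<longrightarrow> length bs = k \<longrightarrow> w n (ww bs) \<in> (if k = 0 then {0} else F (k - 1)))"
proof (induction k rule: less_induct)
  case (less k)
  have l_less: "l n x \<in> F k'" and w_less: "w n x \<in> F (Suc k')" if "k' < k" "x \<in> F k'" for k' n x
    using less that by blast+
  have C3: "w n (ww bs) \<in> (if k = 0 then {0} else F (k - 1))" if n: "n \<ge> 0" and bs: "length bs = k" for n bs
  proof (cases bs)
    case Nil
    then show ?thesis using n bs by (simp add: w_vac)
  next
    case (Cons b bs')
    then have k: "k = Suc (length bs')" using bs by simp
    have y: "ww bs' \<in> F (length bs')" using F_mon[of bs' "length bs'" "[]"] by simp
    have "w (-1 - int b) (w n (ww bs')) \<in> F (length bs')"
    proof (cases "length bs'")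
      case 0
      then show ?thesis using n by (simp add: w_vac subspace_0[OF F_subspace])
    next
      case (Suc j)
      then have "w n (ww bs') \<in> F j" using less[of "length bs'"] n k by auto
      then show ?thesis using w_less[of j] Suc k by simp
    qed
    moreover have "w n (w (-1 - int b) (ww bs')) - w (-1 - int b) (w n (ww bs')) \<in> F (length bs')"
      by (rule w_w_closed[OF F_subspace _ y]) (use l_less k in auto)
    ultimately have "w n (w (-1 - int b) (ww bs')) \<in> F (length bs')"
      using subspace_add[OF F_subspace] by fastforce
    then show ?thesis using Cons k by simp
  qed
  have C1: "l n (lw as (ww bs)) \<in> F k" if bs: "length bs \<le> k" "even (length bs + k)" for n "as" bs
  proof (induction "as" arbitrary: n)
    case Nil
    show ?case
    proof (cases bs)
      case Nil
      show ?thesis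
      proof (cases "n \<ge> 0")
        case False
        then obtain a where "n = -1 - int a" using neg_int[of n] by auto
        then show ?thesis using F_mon[of bs k "[a]"] bs Nil by simp
      qed (use Nil in \<open>simp add: l_vac subspace_0[OF F_subspace]\<close>)
    next
      case (Cons b bs')
      have y: "ww bs' \<in> F (k - 1)" using F_mon[of bs' "k - 1" "[]"] bs Cons by auto
      have k: "k - 1 < k" "Suc (k - 1) = k" using bs Cons by auto
      show ?thesis
        using w_less[OF k(1) l_less[OF k(1) y], of "-1 - int b" n] w_less[OF k(1) y] k
        by (simp add: Cons l_w subspace_add[OF F_subspace] subspace_scale[OF F_subspace])
    qed
  next
    case (Cons a as)
    have "l (-1 - int a) (l n (lw as (ww bs))) \<in> F k" by (rule F_l_neg) (rule Cons)
    moreover have "lw as (ww bs) \<in> F k" using bs by (rule F_mon)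
    ultimately show ?case unfolding lw_simps l_l[of n "-1 - int a"]
      by (intro subspace_add[OF F_subspace] subspace_scale[OF F_subspace] Cons)
  qed
  have C2: "w n (lw as (ww bs)) \<in> F (Suc k)" if bs: "length bs \<le> k" "even (length bs + k)" for n "as" bs
  proof (induction "as" arbitrary: n)
    case Nil
    show ?case
    proof (cases "n \<ge> 0")
      case True
      show ?thesis
      proof (cases "k = 0")
        case True
        then show ?thesis using C3[OF \<open>n \<ge> 0\<close>] bs subspace_0[OF F_subspace] by auto
      next
        case k: False
        show ?thesis
        proof (cases "length bs = k")
          case True
          then have "w n (ww bs) \<in> F (k - 1)" using C3[OF \<open>n \<ge> 0\<close> True] k by simp
          then show ?thesis using F_mono[of "k - 1" "Suc k"] k by (cases k) auto
        next
          case False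
          then have "length bs < k" using bs by simp
          moreover have "ww bs \<in> F (length bs)" using F_mon[of bs "length bs" "[]"] by simp
          ultimately have "w n (ww bs) \<in> F (Suc (length bs))" by (rule w_less)
          then show ?thesis using F_mono[of "Suc (length bs)" "Suc k"] bs by auto
        qed
      qed
    next
      case False
      then obtain b where "n = -1 - int b" using neg_int[of n] by auto
      then show ?thesis using F_mon[of "b # bs" "Suc k" "[]"] bs by simp
    qed
  next
    case (Cons a as)
    have "l (-1 - int a) (w n (lw as (ww bs))) \<in> F (Suc k)" by (rule F_l_neg) (rule Cons)
    then show ?case unfolding lw_simps w_l[of n "-1 - int a"]
      by (intro subspace_add[OF F_subspace] subspace_scale[OF F_subspace] Cons)
  qed
  have "l n x \<in> F k" "w n x \<in> F (Suc k)" if "x \<in> F k" for n x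
  proof -
    note x = that[unfolded F_def]
    show "l n x \<in> F k" by (rule pr_span[OF x _ F_subspace]) (use C1 in auto)
    show "w n x \<in> F (Suc k)" by (rule pr_span[OF x _ F_subspace]) (use C2 in auto)
  qed
  with C3 show ?case by blast
qed

lemma F_l: "x \<in> F k \<Longrightarrow> l n x \<in> F k" and F_w: "x \<in> F k \<Longrightarrow> w n x \<in> F (Suc k)"
  and F_w_pos: "n \<ge> 0 \<Longrightarrow> bs \<noteq> [] \<Longrightarrow> w n (ww bs) \<in> F (length bs - 1)"
  using F_closed[of k] F_closed[of "length bs"] by auto

lemma ww_F: "ww bs \<in> F (length bs)"
  using F_mon[of bs "length bs" "[]"] by simp

text \<open>Quasi-associativity: the Wick product of two quadratic fields agrees with the iterated
  creation operators up to terms with fewer factors \<open>W\<close>.\<close>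

lemma Wick_ww:
  assumes bs: "bs \<noteq> []"
  shows "pr (-1) (w (-1 - int a) (w (-1 - int b) vac)) (ww bs) - ww (a # b # bs) \<in> F (length bs)"
proof -
  let ?y = "ww bs" and ?z = "w (-1 - int b) vac"
  obtain k where k: "length bs = Suc k" using bs by (cases bs) auto
  have zmode: "pr q ?z x = sc ((-1) ^ b * (of_int q gchoose b)) (w (q - int b) x)" for q x
    by (rule pr_mode_vac)
  let ?t = "\<lambda>j. sc ((-1) ^ j * (of_int (-1 - int a) gchoose j))
       (w (-1 - int a - int j) (pr (-1 + int j) ?z ?y) - sc (isign (-1 - int a)) (pr (-1 - int a + -1 - int j) ?z (w (int j) ?y)))"
  obtain N where N: "pr (-1) (w (-1 - int a) ?z) ?y = (\<Sum>j<N. ?t j)"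
    "\<forall>j\<ge>N. pr (-1 + int j) ?z ?y = 0" "\<forall>j\<ge>N. w (int j) ?y = 0"
    using iterate_ex[of "-1" "-1 - int a" W ?z ?y] by blast
  have wF: "w q x \<in> F (length bs)" if "x \<in> F k" for q x
    using F_w[OF that] k by simp
  have pos: "w (int j) ?y \<in> F k" for j
    using F_w_pos[of "int j" bs] bs k by simp
  have second: "sc (isign (-1 - int a)) (pr (-1 - int a + -1 - int j) ?z (w (int j) ?y)) \<in> F (length bs)" for j
    unfolding zmode by (intro subspace_scale[OF F_subspace] wF pos)
  \<comment> \<open>For \<open>0 <= j - 1 < b\<close> the mode of the differentiated
    \<open>W\<close> has binomial coefficient zero; for \<open>j - 1 >= b\<close> it is a
    nonnegative mode of \<open>W\<close>, which contracts.\<close>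
  have first: "w (-1 - int a - int j) (pr (-1 + int j) ?z ?y) \<in> F (length bs)" if "j > 0" for j
  proof (cases "j - 1 < b")
    case True
    have "(of_int (-1 + int j) gchoose b :: complex) = of_nat (j - 1 choose b)"
      using that binomial_gbinomial[of "j - 1" b, where 'a=complex] by (simp add: of_nat_diff algebra_simps)
    then show ?thesis using True unfolding zmode by (simp add: binomial_eq_0 subspace_0[OF F_subspace])
  next
    case False
    then have "w (-1 + int j - int b) ?y \<in> F k"
      using F_w_pos[of "-1 + int j - int b" bs] that bs k by simp
    then show ?thesis unfolding zmode by (simp add: pr_bilinear subspace_scale[OF F_subspace] wF)
  qed
  have t: "?t j \<in> F (length bs)" if "j > 0" for j
    by (intro subspace_scale[OF F_subspace] subspace_diff[OF F_subspace] first second that)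
  have "?t 0 - ww (a # b # bs) = - sc (isign (-1 - int a)) (pr (-1 - int a + -1 - int 0) ?z (w (int 0) ?y))"
  proof -
    have "pr (-1) ?z ?y = w (-1 - int b) ?y"
      unfolding zmode using gbinomial_minus[of "1::complex" b] gbinomial_of_nat_symmetric[of b b, where 'a=complex]
      by (simp add: power_mult_distrib[symmetric])
    then show ?thesis by simp
  qed
  then have t0: "?t 0 - ww (a # b # bs) \<in> F (length bs)"
    using subspace_neg[OF F_subspace second[of 0]] by simp
  have "(\<Sum>j<N. ?t j) = (\<Sum>j<Suc N. ?t j)"
    using N by simp
  also have "\<dots> = ?t 0 + (\<Sum>j<N. ?t (Suc j))"
    by (rule sum.lessThan_Suc_shift)
  finally have "pr (-1) (w (-1 - int a) ?z) ?y - ww (a # b # bs) = (?t 0 - ww (a # b # bs)) + (\<Sum>j<N. ?t (Suc j))"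
    unfolding N(1) by simp
  also have "\<dots> \<in> F (length bs)"
    by (intro subspace_add[OF F_subspace] subspace_sum[OF F_subspace] t0 t) simp
  finally show ?thesis .
qed

end

section \<open>Killing functionals on quadratic and longer words\<close>

context w3_l_functional
begin

lemma f_mode_vac_l: "n < 0 \<Longrightarrow> ev z \<Longrightarrow> f (pr r (l n z) vac) = 0"
proof -
  assume n: "n < 0" and z: "ev z"
  obtain N where N: "pr r (pr n L z) vac = (\<Sum>j<N. sc ((-1) ^ j * (of_int n gchoose j))
       (pr (n - int j) L (pr (r + int j) z vac) - sc (isign n) (pr (n + r - int j) z (pr (int j) L vac))))"
    using iterate_ex[of r n L z vac] by blast
  show ?thesis unfolding N using n z by (simp add: f_sum f_linear f_l l_vac ev_pr)
qed

text \<open>On the vacuum the commutator of two modes of \<open>W\<close> consists of modes of words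
  in \<open>L\<close> and a multiple of \<open>vac\<close>, all killed.\<close>

lemma f_w_w_commute:
  assumes "f vac = 0"
  shows "f (w r (w p vac)) = f (w p (w r vac))"
proof -
  have "f (pr q (w (int j) W) vac) = 0" for q j
    using assms by (auto simp: WW_num pr_bilinear f_linear f_mode_vac_l pr_vac_left)
  then show ?thesis using w_w[of r p vac] by (simp add: f_linear f_sum)
qed

end

context w3_functional
begin

text \<open>Swapping the two factors and integrating by parts multiplies the value by
  \<open>-1 gchoose n\<close>, which is \<open>-1\<close> for odd \<open>n\<close>.\<close>

lemma f_odd_zero:
  assumes "f vac = 0" "odd n"
  shows "f (w (-1 - int n) (w (-1) vac)) = 0"
proof -
  have "f (w (-1 - int n) (w (-1) vac)) = (-1 gchoose n) * f (w (-1 - int n) (w (-1) vac))"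
    using f_w_w_commute[OF assms(1), of "-1 - int n" "-1"] f_w_w[of "-1" n] by simp
  moreover have "(-1 gchoose n :: complex) = -1"
    using gbinomial_minus[of "1::complex" n] gbinomial_of_nat_symmetric[of n n, where 'a=complex] assms(2) by simp
  ultimately show ?thesis by simp
qed

text \<open>A functional killing decomposables and all quadratic fields is zero: a word in
  \<open>W\<close> of length at least four is a Wick product modulo shorter words.\<close>

lemma f_mon_zero:
  assumes vac: "f vac = 0" and two: "\<And>a b. f (w (-1 - int a) (w (-1 - int b) vac)) = 0"
    and prod: "\<And>a b bs. bs \<noteq> [] \<Longrightarrow> even (length bs) \<Longrightarrow> f (pr (-1) (w (-1 - int a) (w (-1 - int b) vac)) (ww bs)) = 0"
    and bs: "even (length bs)"
  shows "f (lw as (ww bs)) = 0"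
  using bs
proof (induction "length bs" arbitrary: "as" bs rule: less_induct)
  case less
  show ?case
  proof (cases "as")
    case (Cons a as')
    then show ?thesis using less.prems by (simp add: f_l ev_mon)
  next
    case Nil
    consider "bs = []" | a b where "bs = [a, b]" | a b bs' where "bs = a # b # bs'" "bs' \<noteq> []" "even (length bs')"
      using less.prems by (cases bs rule: remdups_adj.cases) auto
    then show ?thesis
    proof cases
      case (3 a b bs')
      have "f (pr (-1) (w (-1 - int a) (w (-1 - int b) vac)) (ww bs') - ww (a # b # bs')) = 0"
      proof (rule lin_span_zero[OF lin_f Wick_ww[OF 3(2), unfolded F_def]])
        fix y assume "y \<in> {lw as (ww bs) |as bs. length bs \<le> length bs' \<and> even (length bs + length bs')}"
        then show "f y = 0" using less.hyps 3 by auto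
      qed
      then show ?thesis using 3 Nil prod by (simp add: f_linear)
    qed (use Nil vac two in auto)
  qed
qed

end

section \<open>Strong generation\<close>

context w3
begin

definition U :: "nat \<Rightarrow> 'v" where "U n = w (-1 - int n) (w (-1) vac)"

text \<open>Only even orders appear, because odd quadratic fields are decomposable or derivatives;
  generator \<open>i >= 1\<close> has weight \<open>2 * i + 4\<close>.\<close>

definition gen :: "nat \<Rightarrow> 'v" where "gen i = (if i = 0 then L else U (2 * (i - 1)))"
definition gwt :: "nat \<Rightarrow> nat" where "gwt i = (if i = 0 then 2 else 2 * i + 4)"

definition gmon :: "(nat \<times> nat) list \<Rightarrow> 'v" where
  "gmon qs = foldr (\<lambda>(k, i). pr (-1 - int k) (gen i)) qs vac"
definition qwt :: "(nat \<times> nat) list \<Rightarrow> nat" where "qwt qs = (\<Sum>(k, i)\<leftarrow>qs. gwt i + k)"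

lemma gmon_simps [simp]: "gmon [] = vac" "gmon ((k, i) # qs) = pr (-1 - int k) (gen i) (gmon qs)"
  and qwt_simps [simp]: "qwt [] = 0" "qwt ((k, i) # qs) = gwt i + k + qwt qs"
  by (simp_all add: gmon_def qwt_def)

definition Gs :: "nat set \<Rightarrow> int \<Rightarrow> 'v set" where
  "Gs I d = span {gmon qs | qs. snd ` set qs \<subseteq> I \<and> int (qwt qs) = d}"

lemma Gs_subspace: "subspace (Gs I d)"
  by (simp add: Gs_def)

lemma U_E: "U n \<in> E (int n + 6)"
  unfolding U_def by (rule E_w_w[OF E_vac]) simp

lemma gen_E: "gen i \<in> E (int (gwt i))"
  using U_E[of "2 * (i - 1)"] by (cases i) (auto simp: gen_def gwt_def E_L add.commute)

lemma gwt_pos: "gwt i \<ge> 2"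
  by (simp add: gwt_def)

lemma gmon_E: "gmon qs \<in> E (int (qwt qs))"
  by (induction qs) (auto intro!: E_vac E_pr[OF gen_E])

lemma Gs_E: "Gs I d \<subseteq> E d"
  unfolding Gs_def by (rule span_minimal[OF _ E_subspace]) (use gmon_E in auto)

lemma Gs_gmon: "snd ` set qs \<subseteq> I \<Longrightarrow> int (qwt qs) = d \<Longrightarrow> gmon qs \<in> Gs I d"
  unfolding Gs_def by (rule span_base) blast

lemma Gs_gen:
  assumes "x \<in> Gs I q" "i \<in> I" "d = q + int (gwt i) + int k"
  shows "pr (-1 - int k) (gen i) x \<in> Gs I d"
proof (rule pr_span[OF assms(1)[unfolded Gs_def] _ Gs_subspace])
  fix y assume "y \<in> {gmon qs |qs. snd ` set qs \<subseteq> I \<and> int (qwt qs) = q}"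
  then obtain qs where "y = gmon qs" "snd ` set qs \<subseteq> I" "int (qwt qs) = q" by blast
  then show "pr (-1 - int k) (gen i) y \<in> Gs I d"
    using Gs_gmon[of "(k, i) # qs" I d] assms(2,3) by simp
qed

lemma T_pr_neg: "T (pr (-1 - int k) a x) = sc (of_nat (Suc k)) (pr (-1 - int (Suc k)) a x) + pr (-1 - int k) a (T x)"
  by (simp add: T_pr pr_T_left algebra_simps)

lemma Gs_T: assumes "x \<in> Gs I q" shows "T x \<in> Gs I (q + 1)"
proof (rule linear_span[OF assms[unfolded Gs_def] _ Gs_subspace, where h = T])
  fix y assume "y \<in> {gmon qs |qs. snd ` set qs \<subseteq> I \<and> int (qwt qs) = q}"
  then obtain qs where y: "y = gmon qs" "snd ` set qs \<subseteq> I" "int (qwt qs) = q" by blast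
  have "T (gmon qs) \<in> Gs I (int (qwt qs) + 1)" using y(2)
  proof (induction qs)
    case (Cons p qs)
    obtain k i where p: "p = (k, i)" by (cases p)
    have i: "i \<in> I" and qs: "gmon qs \<in> Gs I (int (qwt qs))"
      using Cons.prems p by (auto intro!: Gs_gmon)
    have "pr (-1 - int (Suc k)) (gen i) (gmon qs) \<in> Gs I (int (qwt (p # qs)) + 1)"
      by (rule Gs_gen[OF qs i]) (simp add: p)
    moreover have "pr (-1 - int k) (gen i) (T (gmon qs)) \<in> Gs I (int (qwt (p # qs)) + 1)"
      by (rule Gs_gen[OF Cons.IH i]) (use Cons.prems p in auto)
    ultimately show ?case unfolding p gmon_simps T_pr_neg
      by (intro subspace_add[OF Gs_subspace] subspace_scale[OF Gs_subspace])
  qed (simp add: subspace_0[OF Gs_subspace])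
  then show "T y \<in> Gs I (q + 1)" using y by simp
qed (auto simp: T_linear)

text \<open>If all elements of smaller weight are generated, so are all products of negative order of
  elements of smaller weight: the iterate formula moves one generator at a time to the left.\<close>

lemma Gs_product:
  assumes IH: "\<And>q. q < d \<Longrightarrow> E q \<subseteq> Gs I q"
    and a: "a \<in> E p" "p < d" and b: "b \<in> E q" "q < d" and n: "n < 0" "d = p + q - n - 1"
  shows "pr n a b \<in> Gs I d"
proof -
  have main: "pr n (gmon qs) b \<in> Gs I d"
    if "snd ` set qs \<subseteq> I" "b \<in> E q" "q < d" "n < 0" "d = int (qwt qs) + q - n - 1" for qs n b q
    using that
  proof (induction qs arbitrary: n b q)
    case Nil
    then have "n \<noteq> -1" by auto
    then show ?case by (simp add: pr_vac_left subspace_0[OF Gs_subspace])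
  next
    case (Cons t qs)
    obtain k i where t: "t = (k, i)" by (cases t)
    have i: "i \<in> I" using Cons.prems t by auto
    have e: "gmon qs \<in> E (int (qwt qs))" by (rule gmon_E)
    obtain N where N: "pr n (pr (-1 - int k) (gen i) (gmon qs)) b = (\<Sum>j<N. sc ((-1) ^ j * (of_int (-1 - int k) gchoose j))
       (pr (-1 - int k - int j) (gen i) (pr (n + int j) (gmon qs) b) - sc (isign (-1 - int k)) (pr (-1 - int k + n - int j) (gmon qs) (pr (int j) (gen i) b))))"
      using iterate_ex[of n "-1 - int k" "gen i" "gmon qs" b] by blast
    have 1: "pr (-1 - int k - int j) (gen i) (pr (n + int j) (gmon qs) b) \<in> Gs I d" for j
    proof -
      let ?q = "int (qwt qs) + q - (n + int j) - 1"
      have "pr (n + int j) (gmon qs) b \<in> E ?q" by (rule E_pr[OF e Cons.prems(2)]) simp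
      moreover have "?q < d" using Cons.prems t gwt_pos[of i] by auto
      ultimately have "pr (n + int j) (gmon qs) b \<in> Gs I ?q" using IH by blast
      moreover have "d = ?q + int (gwt i) + int (k + j)" using Cons.prems t by simp
      ultimately show ?thesis using Gs_gen[OF _ i, of _ ?q d "k + j"] by (simp add: algebra_simps)
    qed
    \<comment> \<open>The word in generators is shorter. The weight of the right factor may have
      grown, but it stays below \<open>d\<close>, so the inductive hypothesis applies.\<close>
    have 2: "pr (-1 - int k + n - int j) (gmon qs) (pr (int j) (gen i) b) \<in> Gs I d" for j
      by (rule Cons.IH[OF _ E_pr[OF gen_E Cons.prems(2) refl]]) (use Cons.prems t in auto)
    show ?case unfolding t gmon_simps N
      by (intro subspace_sum[OF Gs_subspace] subspace_scale[OF Gs_subspace] subspace_diff[OF Gs_subspace] 1 2)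
  qed
  have "a \<in> Gs I p" using IH a by blast
  then show ?thesis unfolding Gs_def[of I p]
    by (rule pr_span_left[OF _ _ Gs_subspace]) (use main b n in blast)
qed

definition decomposable_killing :: "('v \<Rightarrow> complex) \<Rightarrow> bool" where
  "decomposable_killing f \<longleftrightarrow> (\<forall>a b p q n. a \<in> E p \<longrightarrow> b \<in> E q \<longrightarrow> p > 0 \<longrightarrow> q > 0 \<longrightarrow> n < 0 \<longrightarrow> f (pr n a b) = 0)"

lemma E_neg: "d < 0 \<Longrightarrow> E d \<subseteq> {0}"
proof
  fix x assume "d < 0" "x \<in> E d"
  moreover from \<open>d < 0\<close> have e: "{lw as (ww bs) | as bs. dec as \<and> dec bs \<and> even (length bs) \<and> int (wt as bs) = d} = {}" by auto
  ultimately show "x \<in> {0}" using E_span[of x d] unfolding e by simp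
qed

text \<open>A separating functional is controlled in one weight only. Passing to its component of
  weight \<open>d\<close> lets killing conditions over all weights be checked in that weight
  alone.\<close>

lemma graded_functional:
  assumes f0: "lin sc f0"
  shows "\<exists>f. lin sc f \<and> (\<forall>x\<in>E d. f x = f0 x) \<and> (\<forall>e x. e \<noteq> d \<longrightarrow> x \<in> E e \<longrightarrow> f x = 0)"
proof -
  obtain f where f: "lin sc f" "\<And>as bs. dec as \<Longrightarrow> dec bs \<Longrightarrow> f (lw as (ww bs)) = (if int (wt as bs) = d then f0 (lw as (ww bs)) else 0)"
    using linear_extension[of "\<lambda>as bs. if int (wt as bs) = d then f0 (lw as (ww bs)) else 0"] by blast
  have "f x = f0 x" if "x \<in> E d" for x
  proof -
    have "lin sc (\<lambda>x. f x - f0 x)" using f(1) f0 by (simp add: lin_def algebra_simps)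
    then have "f x - f0 x = 0" by (rule lin_span_zero[OF _ E_span[OF that]]) (auto simp: f(2))
    then show ?thesis by simp
  qed
  moreover have "f x = 0" if "e \<noteq> d" "x \<in> E e" for e x
    by (rule lin_span_zero[OF f(1) E_span[OF that(2)]]) (use that(1) f(2) in auto)
  ultimately show ?thesis using f(1) by blast
qed

text \<open>If a word of minimal weight were not generated, a functional separating it would kill
  all decomposables and derivatives, the chosen \<open>U n\<close>, and by \<open>kill\<close> the
  other even ones; then \<open>f_mon_zero\<close> annihilates the word. So \<open>kill\<close>
  isolates the only computation that depends on \<open>c\<close>.\<close>

lemma generation:
  assumes r: "r \<ge> 1"
    and kill: "\<And>f n. w3_functional sc vac pr L W c al ga be \<theta> f \<Longrightarrow> f vac = 0 \<Longrightarrow> decomposable_killing f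
      \<Longrightarrow> even n \<Longrightarrow> n \<ge> 2 * (r - 1) \<Longrightarrow> f (U n) = 0"
  shows "E (int d) \<subseteq> Gs {..<r} (int d)"
proof (induction d rule: less_induct)
  case (less d)
  let ?G = "Gs {..<r}"
  have IH: "E q \<subseteq> ?G q" if "q < int d" for q
  proof (cases "q < 0")
    case True
    then show ?thesis using E_neg[of q] subspace_0[OF Gs_subspace] by blast
  next
    case False
    then show ?thesis using less.IH[of "nat q"] that by simp
  qed
  have main: "lw as (ww bs) \<in> ?G (int d)" if x: "even (length bs)" "wt as bs = d" for "as" bs
  proof (rule ccontr)
    have e: "lw as (ww bs) \<in> E (int d)" using E_mon[OF x(1), of "as"] x(2) by simp
    assume nG: "lw as (ww bs) \<notin> ?G (int d)"
    obtain f0 where f0: "lin sc f0" "\<forall>y\<in>?G (int d). f0 y = 0" "f0 (lw as (ww bs)) = 1"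
      using separating_functional[OF Gs_subspace nG] by blast
    obtain f where f: "lin sc f" "\<And>x. x \<in> E (int d) \<Longrightarrow> f x = f0 x" "\<And>e x. e \<noteq> int d \<Longrightarrow> x \<in> E e \<Longrightarrow> f x = 0"
      using graded_functional[OF f0(1), of "int d"] by blast
    have f1: "f (lw as (ww bs)) = 1"
      using f(2)[OF e] f0(3) by simp
    have fG: "f x = 0" if "x \<in> ?G e" for x e
    proof (cases "e = int d")
      case True
      moreover have "x \<in> E e" using that Gs_E by blast
      ultimately show ?thesis using that f0(2) f(2) by simp
    next
      case False
      then show ?thesis using that f(3) Gs_E by blast
    qed
    have fprod: "f (pr n a b) = 0" if ab: "a \<in> E p" "b \<in> E q" "p > 0" "q > 0" "n < 0" for n a b p q
    proof (cases "p + q - n - 1 = int d")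
      case True
      have "pr n a b \<in> ?G (int d)"
        by (rule Gs_product[OF IH ab(1) _ ab(2)]) (use ab True in auto)
      then show ?thesis by (rule fG)
    next
      case False
      then show ?thesis using E_pr[OF ab(1,2) refl, of n] f(3) by blast
    qed
    have fvac: "f vac = 0"
      using Gs_gmon[of "[]" "{..<r}" 0] by (intro fG[of _ 0]) simp
    have lineG: "f (l n y) = 0" if n: "n < 0" and y: "ev y" for n y
    proof -
      have lf: "lin sc (\<lambda>y. f (l n y))" using f(1) by (simp add: lin_def pr_bilinear)
      have m: "f (l n (lw as (ww bs))) = 0" if "even (length bs)" for "as" bs
      \<comment> \<open>In weight zero the word is the vacuum, and \<open>l n vac\<close> is not a
        product of factors of positive weight; it is itself a word in the generator
        \<open>L\<close>.\<close>
      proof (cases "wt as bs = 0")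
        case True
        obtain k where k: "n = -1 - int k" using n neg_int by blast
        from True have "as = []" "bs = []" by (cases "as"; cases bs; simp add: wt_def)+
        then have "l n (lw as (ww bs)) = gmon [(k, 0)]" by (simp add: k gen_def)
        then show ?thesis using Gs_gmon[of "[(k, 0)]" "{..<r}"] r fG by simp
      next
        case False
        then show ?thesis using fprod[OF E_L E_mon[OF that]] n by simp
      qed
      show ?thesis by (rule lin_span_zero[OF lf ev_mon_span[OF y]]) (use m in auto)
    qed
    have fT: "f (T (w s (w p vac))) = 0" for s p
    proof -
      let ?e = "4 - s - p"
      have e: "w s (w p vac) \<in> E ?e" by (rule E_w_w[OF E_vac]) simp
      show ?thesis
      proof (cases "?e + 1 = int d")
        case True
        then have "w s (w p vac) \<in> ?G ?e" using IH[of ?e] e by auto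
        then show ?thesis using fG Gs_T by blast
      next
        case False
        then show ?thesis using E_T[OF e] f(3) by blast
      qed
    qed
    interpret w3_functional sc vac pr L W c al ga be \<theta> f
      by unfold_locales (use f(1) lineG fT in auto)
    have u: "f (U n) = 0" for n
    proof (cases "odd n")
      case True
      then show ?thesis using f_odd_zero[OF fvac] by (simp add: U_def)
    next
      case False
      show ?thesis
      proof (cases "n \<ge> 2 * (r - 1)")
        case True
        have "decomposable_killing f" unfolding decomposable_killing_def using fprod by blast
        then show ?thesis using kill[OF w3_functional_axioms fvac] True \<open>\<not> odd n\<close> by blast
      next
        case n: False
        define i where "i = n div 2 + 1"
        have "gmon [(0, i)] = U n" using \<open>\<not> odd n\<close> by (simp add: i_def gen_def pr_creation)
        moreover have "i < r" using n False by (auto simp: i_def elim!: evenE)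
        ultimately show ?thesis using Gs_gmon[of "[(0, i)]" "{..<r}"] fG by auto
      qed
    qed
    have "f (lw as (ww bs)) = 0"
    proof (rule f_mon_zero[OF fvac _ _ x(1)])
      show "f (w (-1 - int a) (w (-1 - int b) vac)) = 0" for a b
        using u[of "a + b"] by (simp add: f_w_w U_def algebra_simps)
    next
      fix a b and bs :: "nat list" assume bs: "bs \<noteq> []" "even (length bs)"
      have "w (-1 - int a) (w (-1 - int b) vac) \<in> E (int a + int b + 6)" by (rule E_w_w[OF E_vac]) simp
      moreover have "ww bs \<in> E (int (wt [] bs))" using E_mon[OF bs(2), of "[]"] by simp
      moreover have "wt [] bs > 0" using bs by (cases bs) (auto simp: wt_def)
      ultimately show "f (pr (-1) (w (-1 - int a) (w (-1 - int b) vac)) (ww bs)) = 0"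
        by (intro fprod[of _ "int a + int b + 6" _ "int (wt [] bs)"]) auto
    qed
    with f1 show False by simp
  qed
  have "{lw as (ww bs) | as bs. dec as \<and> dec bs \<and> even (length bs) \<and> int (wt as bs) = int d} \<subseteq> ?G (int d)"
  proof clarify
    fix "as" bs assume "even (length bs)" "int (wt as bs) = int d"
    then show "lw as (ww bs) \<in> ?G (int d)" by (intro main) simp_all
  qed
  then have sp: "span {lw as (ww bs) | as bs. dec as \<and> dec bs \<and> even (length bs) \<and> int (wt as bs) = int d} \<subseteq> ?G (int d)"
    by (rule span_minimal[OF _ Gs_subspace])
  show ?case
    by (rule subsetI) (rule subsetD[OF sp E_span])
qed

end

text \<open>The two relations have no common root: eliminating the structure constants leaves a
  polynomial in the weight whose coefficients are all positive.\<close>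

lemma no_common_root:
  fixes al ga be c m :: complex
  assumes alga: "al = ga * c / 3" and gabe: "32 * ga = be * (22 + 5 * c)" and be: "be \<noteq> 0"
    and m: "m = of_nat t + 4"
    and e1: "- 5 * (11 * m + 73) * (m + 1) * (m + 3) * al + 16 * (m + 6) * (46 + 129 * m - m * m) * ga
      + 32 * (m + 6) * (m + 8) * (23 * m - 1) * be = 0"
    and e2: "35 * (m + 5) * (m + 3) * (m + 1) * (m - 1) * al - 128 * (m + 6) * (m + 4) * (m + 3) * (11 * m + 46) * ga
      + 256 * (m + 8) * (m + 6) * (m + 4) * (13 * m + 53) * be = 0"
  shows False
proof -
  define T where "T = (of_nat t :: complex)"
  define a where "a = al / be"
  define g where "g = ga / be"
  have al: "al = a * be" and ga: "ga = g * be" using be by (simp_all add: a_def g_def)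
  have "32 * g = 22 + 5 * c" using gabe be by (simp add: ga)
  moreover have "a = g * c / 3" using alga be by (simp add: al ga)
  ultimately have ag: "15 * a = g * (32 * g - 22)" by (simp add: field_simps)
  define A1 where "A1 = - 5 * (11 * m + 73) * (m + 1) * (m + 3)"
  define B1 where "B1 = 16 * (m + 6) * (46 + 129 * m - m * m)"
  define C1 where "C1 = 32 * (m + 6) * (m + 8) * (23 * m - 1)"
  define A2 where "A2 = 35 * (m + 5) * (m + 3) * (m + 1) * (m - 1)"
  define B2 where "B2 = - 128 * (m + 6) * (m + 4) * (m + 3) * (11 * m + 46)"
  define C2 where "C2 = 256 * (m + 8) * (m + 6) * (m + 4) * (13 * m + 53)"
  \<comment> \<open>Cramer's rule: after division by \<open>be\<close> both relations are linear in
    \<open>a\<close> and \<open>g\<close>, so \<open>a * D = X\<close> and \<open>g * D = Y\<close>.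
    Substitution into \<open>ag\<close>, the constraint on the structure constants, leaves a
    polynomial in \<open>m\<close> alone.\<close>
  define D where "D = A1 * B2 - A2 * B1"
  define X where "X = B1 * C2 - B2 * C1"
  define Y where "Y = C1 * A2 - C2 * A1"
  have "(A1 * a + B1 * g + C1) * be = 0" using e1 by (simp add: A1_def B1_def C1_def al ga algebra_simps)
  then have 1: "A1 * a + B1 * g + C1 = 0" using be by simp
  have "(A2 * a + B2 * g + C2) * be = 0" using e2 by (simp add: A2_def B2_def C2_def al ga algebra_simps)
  then have 2: "A2 * a + B2 * g + C2 = 0" using be by simp
  have aX: "a * D = X" and gY: "g * D = Y" using 1 2 unfolding D_def X_def Y_def by algebra+
  have "15 * X * D = 15 * a * D * D" by (simp add: aX[symmetric])
  also have "\<dots> = Y * (32 * Y - 22 * D)" unfolding ag by (simp add: gY[symmetric] algebra_simps)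
  finally have zero: "15 * X * D - 32 * Y * Y + 22 * Y * D = 0" by (simp add: algebra_simps)
  have mT: "m = T + 4" by (simp add: m T_def)
  have D: "D = 129198888000 + 119235614400 * T + 46727562160 * T ^ 2 + 10096566960 * T ^ 3 + 1301250400 * T ^ 4 + 100193760 * T ^ 5 + 4273840 * T ^ 6 + 78000 * T ^ 7"
    unfolding D_def A1_def A2_def B1_def B2_def mT by (simp add: algebra_simps eval_nat_numeral)
  have X: "X = 4508614656000 + 3787043635200 * T + 1322656399360 * T ^ 2 + 250354237440 * T ^ 3 + 27835678720 * T ^ 4 + 1822433280 * T ^ 5 + 65167360 * T ^ 6 + 983040 * T ^ 7"
    unfolding X_def B1_def B2_def C1_def C2_def mT by (simp add: algebra_simps eval_nat_numeral)
  have Y: "Y = 539911008000 + 473287550400 * T + 175676014560 * T ^ 2 + 35836188960 * T ^ 3 + 4342516800 * T ^ 4 + 312754560 * T ^ 5 + 12399840 * T ^ 6 + 208800 * T ^ 7"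
    unfolding Y_def A1_def A2_def C1_def C2_def mT by (simp add: algebra_simps eval_nat_numeral)
  have "15 * X * D - 32 * Y * Y + 22 * Y * D = 944125150485404160000000 + 1810463449359487104000000 * T + 1554183119881433664000000 * T ^ 2 + 797579754275413912320000 * T ^ 3 + 274722313353375242880000 * T ^ 4 + 67424035431724930560000 * T ^ 5 + 12190803833633255040000 * T ^ 6 + 1652936295426071040000 * T ^ 7 + 169157337979311360000 * T ^ 8 + 13019109301416960000 * T ^ 9 + 742596212816640000 * T ^ 10 + 30467264029440000 * T ^ 11 + 850617720960000 * T ^ 12 + 14475041280000 * T ^ 13 + 113339520000 * T ^ 14"
    unfolding D X Y by (simp add: algebra_simps eval_nat_numeral)
  also have "\<dots> = of_nat (944125150485404160000000 + 1810463449359487104000000 * t + 1554183119881433664000000 * t ^ 2 + 797579754275413912320000 * t ^ 3 + 274722313353375242880000 * t ^ 4 + 67424035431724930560000 * t ^ 5 + 12190803833633255040000 * t ^ 6 + 1652936295426071040000 * t ^ 7 + 169157337979311360000 * t ^ 8 + 13019109301416960000 * t ^ 9 + 742596212816640000 * t ^ 10 + 30467264029440000 * t ^ 11 + 850617720960000 * t ^ 12 + 14475041280000 * t ^ 13 + 113339520000 * t ^ 14)"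
    by (simp add: T_def)
  finally have "of_nat (944125150485404160000000 + 1810463449359487104000000 * t + 1554183119881433664000000 * t ^ 2 + 797579754275413912320000 * t ^ 3 + 274722313353375242880000 * t ^ 4 + 67424035431724930560000 * t ^ 5 + 12190803833633255040000 * t ^ 6 + 1652936295426071040000 * t ^ 7 + 169157337979311360000 * t ^ 8 + 13019109301416960000 * t ^ 9 + 742596212816640000 * t ^ 10 + 30467264029440000 * t ^ 11 + 850617720960000 * t ^ 12 + 14475041280000 * t ^ 13 + 113339520000 * t ^ 14) = (0 :: complex)" using zero by simp
  then show False by (simp only: of_nat_eq_0_iff)
qed

text \<open>The quadratic is the one that \<open>critical_coefficient\<close> extracts from the
  first relation at \<open>m = 2\<close>; the roots come from completing the square, using
  \<open>95 * 95 = 19 * 475\<close>.\<close>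

lemma critical_charge:
  fixes c :: complex
  assumes "475 * c * c - 5590 * c - 181248 = 0"
  shows "c = of_real ((559 + 7 * sqrt 76657) / 95) \<or> c = of_real ((559 - 7 * sqrt 76657) / 95)"
proof -
  define s where "s = complex_of_real (sqrt 76657)"
  have "s * s = complex_of_real (sqrt 76657 * sqrt 76657)" by (simp only: s_def of_real_mult)
  then have s: "s * s = 76657" by simp
  have "(95 * c - (559 + 7 * s)) * (95 * c - (559 - 7 * s)) = 19 * (475 * c * c - 5590 * c - 181248)"
    using s by (simp add: algebra_simps)
  then have "95 * c = 559 + 7 * s \<or> 95 * c = 559 - 7 * s" using assms by simp
  then have "c = (559 + 7 * s) / 95 \<or> c = (559 - 7 * s) / 95"
    by (metis nonzero_mult_div_cancel_left zero_neq_numeral)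
  then show ?thesis by (simp add: s_def)
qed

lemma critical_charge_converse:
  fixes c :: complex
  assumes "c = of_real ((559 + 7 * sqrt 76657) / 95) \<or> c = of_real ((559 - 7 * sqrt 76657) / 95)"
  shows "475 * c * c - 5590 * c - 181248 = 0"
proof -
  define s where "s = complex_of_real (sqrt 76657)"
  have "s * s = complex_of_real (sqrt 76657 * sqrt 76657)" by (simp only: s_def of_real_mult)
  then have s: "s * s = 76657" by simp
  have "95 * c = 559 + 7 * s \<or> 95 * c = 559 - 7 * s"
    using assms by (auto simp: s_def simp del: eq_divide_eq_numeral1)
  then have "95 * c - (559 + 7 * s) = 0 \<or> 95 * c - (559 - 7 * s) = 0" by (elim disjE) simp_all
  then have "(95 * c - (559 + 7 * s)) * (95 * c - (559 - 7 * s)) = 0"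
    by (simp only: mult_eq_0_iff)
  moreover have "(95 * c - (559 + 7 * s)) * (95 * c - (559 - 7 * s)) = 19 * (475 * c * c - 5590 * c - 181248)"
    using s by (simp add: algebra_simps)
  ultimately show ?thesis by (metis mult_eq_0_iff zero_neq_numeral)
qed

section \<open>Decomposability of the quadratic fields of weight at least 14\<close>

context w3_functional
begin

lemma relation_1_even:
  "2 * f (pr (-1) (U 0) (w (- int m) (w (-2) vac))) - f (pr (-2) (U 0) (w (- int m) (w (-1) vac)))
   = of_nat m * (of_nat m + 12) * (of_nat m + 2) * (of_nat m + 4) / 12600 *
    (- 5 * (11 * of_nat m + 73) * (of_nat m + 1) * (of_nat m + 3) * al
     + 16 * (of_nat m + 6) * (46 + 129 * of_nat m - of_nat m * of_nat m) * ga
     + 32 * (of_nat m + 6) * (of_nat m + 8) * (23 * of_nat m - 1) * be) * f (U (m + 6))"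
proof -
  have "- 1 - int (m + 6) = - int m - 7" by simp
  then show ?thesis using relation_1[of "int m"] by (simp only: U_def of_int_of_nat_eq) simp
qed

lemma relation_2_even:
  "f (pr (-1) (U 2) (w (1 - int m) (w (-1) vac))) - f (pr (-1) (U 0) (w (1 - int m) (w (-3) vac)))
   = of_nat m * (of_nat m + 12) * (of_nat m + 2) * (of_nat m - 2) / 201600 *
    (35 * (of_nat m + 5) * (of_nat m + 3) * (of_nat m + 1) * (of_nat m - 1) * al
     - 128 * (of_nat m + 6) * (of_nat m + 4) * (of_nat m + 3) * (11 * of_nat m + 46) * ga
     + 256 * (of_nat m + 8) * (of_nat m + 6) * (of_nat m + 4) * (13 * of_nat m + 53) * be) * f (U (m + 6))"
proof -
  have "- 1 - int (m + 6) = - 7 - int m" by simp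
  then show ?thesis using relation_2[of "int m"] by (simp only: U_def of_int_of_nat_eq) simp
qed

text \<open>The bracket of \<open>relation_1\<close> at \<open>m = 2\<close>, with \<open>al\<close>
  and \<open>ga\<close> eliminated through \<open>alga\<close> and \<open>gabe\<close>; the factor
  32 clears the denominator of \<open>gabe\<close>.\<close>

lemma critical_coefficient:
  "(- 5 * (11 * 2 + 73) * (2 + 1) * (2 + 3) * al + 16 * (2 + 6) * (46 + 129 * 2 - 2 * 2) * ga
     + 32 * (2 + 6) * (2 + 8) * (23 * 2 - 1) * be) * 32 = - 25 * be * (475 * c * c - 5590 * c - 181248)"
proof -
  have "3 * al = ga * c" by (simp add: alga)
  then show ?thesis using gabe by algebra
qed

text \<open>The left sides of both relations are combinations of decomposables. A nonzero value at
  \<open>U n\<close> forces the bracket of the first to vanish, and from \<open>m = 4\<close> on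
  that of the second as well, which \<open>no_common_root\<close> excludes.\<close>

lemma decomposable_killing_U:
  assumes f: "decomposable_killing f" and n: "n \<ge> 8" "even n"
    and c: "n = 8 \<Longrightarrow> 475 * c * c - 5590 * c - 181248 \<noteq> 0"
  shows "f (U n) = 0"
proof (rule ccontr)
  assume u: "f (U n) \<noteq> 0"
  define m where "m = n - 6"
  have m: "n = m + 6" "m \<ge> 2" "even m" using n by (auto simp: m_def)
  have kill: "f (pr r (U k) (w (- int p) (w (- int q) vac))) = 0" if "r < 0" "p + q > 0" for r k p q
  proof -
    have "w (- int p) (w (- int q) vac) \<in> E (int p + int q + 4)" by (rule E_w_w[OF E_vac]) simp
    then show ?thesis using f U_E[of k] that unfolding decomposable_killing_def by fastforce
  qed
  have z1: "of_nat m * (of_nat m + 12) * (of_nat m + 2) * (of_nat m + 4) / (12600 :: complex) \<noteq> 0"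
  proof -
    have "of_nat m * (of_nat m + 12) * (of_nat m + 2) * (of_nat m + 4) = (of_nat (m * (m + 12) * (m + 2) * (m + 4)) :: complex)"
      by (simp only: of_nat_mult of_nat_add of_nat_numeral)
    then show ?thesis using m by (simp only: divide_eq_0_iff of_nat_eq_0_iff) simp
  qed
  have e1: "- 5 * (11 * of_nat m + 73) * (of_nat m + 1) * (of_nat m + 3) * al
     + 16 * (of_nat m + 6) * (46 + 129 * of_nat m - of_nat m * of_nat m) * ga
     + 32 * (of_nat m + 6) * (of_nat m + 8) * (23 * of_nat m - 1) * be = 0"
    using relation_1_even[of m] kill[of "-1" m 2 0] kill[of "-2" m 1 0] u z1 m by simp
  show False
  proof (cases "m = 2")
    case True
    have "- 25 * be * (475 * c * c - 5590 * c - 181248) = 0"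
      unfolding critical_coefficient[symmetric] using e1 True by simp
    then show False using c be True m by simp
  next
    case False
    then have m4: "m \<ge> 4" using m by (cases "m = 3") auto
    have z2: "of_nat m * (of_nat m + 12) * (of_nat m + 2) * (of_nat m - 2) / (201600 :: complex) \<noteq> 0"
    proof -
      have "of_nat m * (of_nat m + 12) * (of_nat m + 2) * (of_nat m - 2) = (of_nat (m * (m + 12) * (m + 2) * (m - 2)) :: complex)"
        using m4 by (simp only: of_nat_mult of_nat_add of_nat_numeral of_nat_diff)
      then show ?thesis using m4 by (simp only: divide_eq_0_iff of_nat_eq_0_iff) simp
    qed
    have e: "1 - int m = - int (m - 1)" using m4 by simp
    have e2: "35 * (of_nat m + 5) * (of_nat m + 3) * (of_nat m + 1) * (of_nat m - 1) * al
     - 128 * (of_nat m + 6) * (of_nat m + 4) * (of_nat m + 3) * (11 * of_nat m + 46) * ga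
     + 256 * (of_nat m + 8) * (of_nat m + 6) * (of_nat m + 4) * (13 * of_nat m + 53) * be = 0"
      using relation_2_even[of m, unfolded e] kill[of "-1" "m - 1" 1 2] kill[of "-1" "m - 1" 3 0] u z2 m by simp
    show False
      by (rule no_common_root[OF alga gabe be _ e1 e2, of "m - 4"]) (use m4 in \<open>simp add: of_nat_diff\<close>)
  qed
qed

end

section \<open>Minimality\<close>

context w3
begin

text \<open>Straightening of the creation operators of \<open>L\<close>, by induction on the length: the commutator of
  two of them is again one, so that reordering only produces shorter words.\<close>

lemma lw_sort: "as \<noteq> [] \<Longrightarrow> length as \<le> m \<Longrightarrow> lw as y \<in> span {lw as y | as. dec as \<and> as \<noteq> [] \<and> length as \<le> m}"
proof (induction m arbitrary: "as" rule: less_induct)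
  case (less m)
  let ?S = "\<lambda>m. span {lw as y | as. dec as \<and> as \<noteq> [] \<and> length as \<le> m}"
  have mono: "?S i \<subseteq> ?S j" if "i \<le> j" for i j
    by (rule span_mono) (use that in auto)
  have l_S: "l (-1 - int b) x \<in> ?S (Suc i)" if x: "x \<in> ?S i" and i: "Suc i < m" for x b i
  proof (rule pr_span[OF x _ subspace_span])
    fix z assume "z \<in> {lw as y |as. dec as \<and> as \<noteq> [] \<and> length as \<le> i}"
    then obtain v where v: "z = lw v y" "length v \<le> i" by blast
    then show "l (-1 - int b) z \<in> ?S (Suc i)" using less.IH[of "Suc i" "b # v"] i by simp
  qed
  have insert: "\<exists>s. dec s \<and> length s = Suc (length t) \<and> set s = insert a (set t)
      \<and> l (-1 - int a) (lw t y) - lw s y \<in> ?S (length t)" if "dec t" "length t < m" for a t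
    using that
  proof (induction t)
    case Nil
    show ?case by (rule exI[of _ "[a]"]) (simp add: span_zero)
  next
    case (Cons b t)
    show ?case
    proof (cases "b \<le> a")
      case True
      then show ?thesis using Cons.prems by (intro exI[of _ "a # b # t"]) (auto simp: span_zero)
    next
      case False
      obtain s where s: "dec s" "length s = Suc (length t)" "set s = insert a (set t)"
        "l (-1 - int a) (lw t y) - lw s y \<in> ?S (length t)"
        using Cons.IH Cons.prems by auto
      have i: "- 1 - int a + (- 1 - int b) - 1 = - 1 - int (a + b + 2)" by simp
      have c: "l (-1 - int a) (lw (b # t) y) - lw (b # s) y =
          l (-1 - int b) (l (-1 - int a) (lw t y) - lw s y) + sc (of_int (int b - int a)) (lw ((a + b + 2) # t) y)"
        using l_l[of "-1 - int a" "-1 - int b" "lw t y"] unfolding i by (simp add: pr_bilinear)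
      have 1: "lw ((a + b + 2) # t) y \<in> ?S (length (b # t))"
        by (rule less.IH) (use Cons.prems in simp_all)
      have 2: "l (-1 - int b) (l (-1 - int a) (lw t y) - lw s y) \<in> ?S (length (b # t))"
        using l_S[OF s(4)] Cons.prems by simp
      show ?thesis
      proof (intro exI[of _ "b # s"] conjI)
        show "l (-1 - int a) (lw (b # t) y) - lw (b # s) y \<in> ?S (length (b # t))"
          unfolding c by (intro span_add span_scale 1 2)
      qed (use s False Cons.prems in auto)
    qed
  qed
  obtain a as' where a: "as = a # as'" using less.prems by (cases "as") auto
  show ?case
  proof (cases "as' = []")
    case True
    then have "lw as y \<in> {lw as y | as. dec as \<and> as \<noteq> [] \<and> length as \<le> m}"
      using a less.prems by (intro CollectI exI[of _ "as"]) auto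
    then show ?thesis by (rule span_base)
  next
    case False
    have "lw as' y \<in> ?S (length as')" by (rule less.IH) (use a less.prems False in auto)
    then have "l (-1 - int a) (lw as' y) \<in> ?S m"
    proof (rule pr_span[OF _ _ subspace_span])
      fix z assume "z \<in> {lw as y |as. dec as \<and> as \<noteq> [] \<and> length as \<le> length as'}"
      then obtain t where t: "z = lw t y" "dec t" "length t \<le> length as'" by blast
      then have tm: "length t < m" using a less.prems by simp
      obtain s where s: "dec s" "length s = Suc (length t)" "l (-1 - int a) (lw t y) - lw s y \<in> ?S (length t)"
        using insert[OF t(2) tm] by blast
      have "lw s y \<in> {lw as y | as. dec as \<and> as \<noteq> [] \<and> length as \<le> m}"
        using s tm by (intro CollectI exI[of _ s]) auto
      then have "lw s y \<in> ?S m" by (rule span_base)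
      moreover have "l (-1 - int a) (lw t y) - lw s y \<in> ?S m"
        using s(3) mono[of "length t" m] tm by auto
      ultimately show "l (-1 - int a) z \<in> ?S m"
        using span_add t(1) by fastforce
    qed
    then show ?thesis using a by simp
  qed
qed

text \<open>The values are prescribed as zero on PBW words with at least one mode of
  \<open>L\<close>. Straightening keeps that property, so every negative mode of \<open>L\<close> is
  killed, even when it breaks the PBW order.\<close>

lemma extension_by_words:
  "\<exists>f. lin sc f \<and> (\<forall>n x. n < 0 \<longrightarrow> f (l n x) = 0) \<and> (\<forall>bs. dec bs \<longrightarrow> f (ww bs) = val bs)"
proof -
  obtain f where f: "lin sc f" "\<And>as bs. dec as \<Longrightarrow> dec bs \<Longrightarrow> f (lw as (ww bs)) = (if as = [] then val bs else 0)"
    using linear_extension[of "\<lambda>as bs. if as = [] then val bs else 0"] by blast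
  have "f (l n x) = 0" if n: "n < 0" for n x
  proof -
    obtain a where a: "n = -1 - int a" using n neg_int by blast
    have lf: "lin sc (\<lambda>x. f (l n x))" using f(1) by (simp add: lin_def pr_bilinear)
    show ?thesis
    proof (rule lin_span_zero[OF lf mon_span[of x]])
      fix y assume "y \<in> {lw as (ww bs) |as bs. dec as \<and> dec bs}"
      then obtain "as" bs where y: "y = lw as (ww bs)" "dec bs" by blast
      define m where "m = length (a # as)"
      have "lw (a # as) (ww bs) \<in> span {lw as (ww bs) | as. dec as \<and> as \<noteq> [] \<and> length as \<le> m}"
        by (rule lw_sort) (auto simp: m_def)
      then have "f (lw (a # as) (ww bs)) = 0"
        by (rule lin_span_zero[OF f(1)]) (use f(2) y in auto)
      then show "f (l n y) = 0" using y a by simp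
    qed
  qed
  moreover have "f (ww bs) = val bs" if "dec bs" for bs
    using f(2)[of "[]" bs] that by simp
  ultimately show ?thesis using f(1) by blast
qed

lemma ww_swap: "ww (xs @ a # b # ys) - ww (xs @ b # a # ys) \<in> F (length xs + length ys)"
proof (induction xs)
  case Nil
  show ?case using w_w_closed[OF F_subspace F_l ww_F[of ys]] by simp
next
  case (Cons x xs)
  then show ?case using F_w[OF Cons.IH] by (simp add: pr_bilinear)
qed

end

context w3_l_functional
begin

text \<open>If one of the two modes is nonnegative, commutativity under \<open>f\<close> moves it
  onto the vacuum. Only creation modes are left, and there the claim is the recursion
  \<open>rec\<close>.\<close>

lemma f_T_criterion:
  assumes vac: "f vac = 0"
    and rec: "\<And>a b. of_nat (Suc a) * f (ww [Suc a, b]) + of_nat (Suc b) * f (ww [a, Suc b]) = 0"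
  shows "f (T (w r (w p vac))) = 0"
proof -
  have z: "f (w r (w p vac)) = 0" if "r \<ge> 0 \<or> p \<ge> 0" for r p
    using that f_w_w_commute[OF vac, of r p] by (auto simp: w_vac f_linear)
  have T: "f (T (w r (w p vac))) = - of_int r * f (w (r - 1) (w p vac)) - of_int p * f (w r (w (p - 1) vac))"
    by (simp add: T_w pr_bilinear f_linear algebra_simps)
  show ?thesis
  proof (cases "r < 0 \<and> p < 0")
    case True
    then obtain a b where ab: "r = -1 - int a" "p = -1 - int b" using neg_int by metis
    have i: "- 1 - int a - 1 = - 1 - int (Suc a)" "- 1 - int b - 1 = - 1 - int (Suc b)" by simp_all
    show ?thesis unfolding T unfolding ab i using rec[of a b] by (simp add: algebra_simps)
  next
    case False
    then show ?thesis unfolding T by (cases "r = 0"; cases "p = 0") (auto simp: z f_0)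
  qed
qed

lemma f_F2_zero:
  assumes "f vac = 0" "\<And>a b. a \<ge> b \<Longrightarrow> f (ww [a, b]) = 0" "x \<in> F 2"
  shows "f x = 0"
proof (rule lin_span_zero[OF lin_f assms(3)[unfolded F_def]])
  fix y assume "y \<in> {lw as (ww bs) |as bs. length bs \<le> 2 \<and> even (length bs + 2)}"
  then obtain "as" bs where y: "y = lw as (ww bs)" and bs: "length bs \<le> 2" "even (length bs)" by auto
  show "f y = 0"
  proof (cases "as")
    case (Cons a as')
    then show ?thesis using y bs by (simp add: f_l ev_mon)
  next
    case Nil
    consider "bs = []" | a b where "bs = [a, b]"
      using bs by (cases bs rule: remdups_adj.cases) auto
    then show ?thesis
    proof cases
      case (2 a b)
      then show ?thesis using y Nil assms(2)[of a b] assms(2)[of b a] f_w_w_commute[OF assms(1), of "-1 - int a" "-1 - int b"]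
        by (cases "a \<ge> b") auto
    qed (use y Nil assms(1) in simp)
  qed
qed

end

section \<open>Functionals dual to quadratic and quartic words\<close>

context w3
begin

text \<open>All conditions are linear in \<open>f\<close> and refer to a single weight, so multiples
  of quartic functionals can be subtracted from a quadratic one without leaving the class.\<close>

definition admissible :: "('v \<Rightarrow> complex) \<Rightarrow> nat \<Rightarrow> bool" where
  "admissible f d \<longleftrightarrow> lin sc f \<and> (\<forall>n x. n < 0 \<longrightarrow> f (l n x) = 0) \<and> (\<forall>r p. f (T (w r (w p vac))) = 0)
     \<and> f vac = 0 \<and> (\<forall>e x. e \<noteq> int d \<longrightarrow> x \<in> E e \<longrightarrow> f x = 0)"

lemma admissible_functional: "admissible f d \<Longrightarrow> w3_functional sc vac pr L W c al ga be \<theta> f"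
  by unfold_locales (auto simp: admissible_def)

lemma admissible_diff: "admissible f d \<Longrightarrow> admissible g d \<Longrightarrow> admissible (\<lambda>x. f x - r * g x) d"
  by (auto simp: admissible_def lin_def algebra_simps)

lemma admissibleI:
  assumes "lin sc f" "\<And>n x. n < 0 \<Longrightarrow> f (l n x) = 0" "\<And>bs. dec bs \<Longrightarrow> f (ww bs) = val bs"
    and val: "\<And>bs. wt [] bs \<noteq> d \<Longrightarrow> val bs = 0" "val [] = 0"
    and rec: "\<And>a b. of_nat (Suc a) * f (ww [Suc a, b]) + of_nat (Suc b) * f (ww [a, Suc b]) = 0"
  shows "admissible f d"
proof -
  interpret w3_l_functional sc vac pr L W c al ga be \<theta> f
    by unfold_locales (use assms in auto)
  have vac: "f vac = 0" using assms(3)[of "[]"] val(2) by simp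
  have "f x = 0" if "e \<noteq> int d" "x \<in> E e" for e x
  proof (rule lin_span_zero[OF assms(1) E_span[OF that(2)]])
    fix y assume "y \<in> {lw as (ww bs) |as bs. dec as \<and> dec bs \<and> even (length bs) \<and> int (wt as bs) = e}"
    then obtain "as" bs where y: "y = lw as (ww bs)" "dec bs" "int (wt as bs) = e" by blast
    then show "f y = 0" using that(1) assms(2,3) val(1)[of bs] by (cases "as") auto
  qed
  then show ?thesis using assms(1,2) vac f_T_criterion[OF vac rec] by (auto simp: admissible_def)
qed

text \<open>The values \<open>(-1)^b * (n choose b)\<close> are the solution of the derivative
  recursion with value 1 at \<open>b = 0\<close>. They are symmetric in the two letters exactly
  because \<open>n\<close> is even, as commutativity under \<open>f\<close> demands.\<close>

lemma quadratic_functional: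
  assumes n: "even n"
  shows "\<exists>f. admissible f (n + 6) \<and> f (U n) = 1"
proof -
  define val :: "nat list \<Rightarrow> complex" where
    "val = (\<lambda>bs. case bs of [a, b] \<Rightarrow> if a + b = n then (-1) ^ b * of_nat (n choose b) else 0 | _ \<Rightarrow> 0)"
  obtain f where f: "lin sc f" "\<And>n x. n < 0 \<Longrightarrow> f (l n x) = 0" "\<And>bs. dec bs \<Longrightarrow> f (ww bs) = val bs"
    using extension_by_words[of val] by blast
  interpret w3_l_functional sc vac pr L W c al ga be \<theta> f
    by unfold_locales (use f in auto)
  have vac: "f vac = 0" using f(3)[of "[]"] by (simp add: val_def)
  have two: "f (ww [a, b]) = val [a, b]" for a b
  proof (cases "b \<le> a")
    case False
    have "val [b, a] = val [a, b]"
      using n binomial_symmetric[of a n] by (auto simp: val_def uminus_power_if)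
    then show ?thesis using f(3)[of "[b, a]"] False f_w_w_commute[OF vac, of "-1 - int a" "-1 - int b"] by simp
  qed (use f(3)[of "[a, b]"] in simp)
  have "admissible f (n + 6)"
  proof (rule admissibleI[OF f])
    show "val bs = 0" if "wt [] bs \<noteq> n + 6" for bs
      using that by (auto simp: val_def wt_def split: list.splits)
    show "val [] = 0" by (simp add: val_def)
    show "of_nat (Suc a) * f (ww [Suc a, b]) + of_nat (Suc b) * f (ww [a, Suc b]) = 0" for a b
    proof (cases "Suc (a + b) = n")
      case True
      have "n - b = Suc a" using True by simp
      then have "Suc b * (n choose Suc b) = Suc a * (n choose b)"
        using binomial_absorb_comp[of n b] binomial_absorption[of b n] by simp
      then have "of_nat (Suc b) * of_nat (n choose Suc b) = (of_nat (Suc a) * of_nat (n choose b) :: complex)"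
        by (metis of_nat_mult)
      moreover have "A * (s * X) + B * - (s * Y) = s * (A * X - B * Y)" for A B X Y s :: complex
        by (simp add: algebra_simps)
      moreover have "val [Suc a, b] = (-1) ^ b * of_nat (n choose b)" "val [a, Suc b] = - ((-1) ^ b * of_nat (n choose Suc b))"
        using True by (simp_all add: val_def)
      ultimately show ?thesis unfolding two by simp
    qed (unfold two, simp add: val_def)
  qed
  moreover have "f (U n) = 1" using two[of n 0] by (simp add: U_def val_def)
  ultimately show ?thesis by blast
qed

lemma quartic_functional:
  assumes \<beta>: "length \<beta> = 4"
  shows "\<exists>f. admissible f (wt [] \<beta>) \<and> (\<forall>x\<in>F 2. f x = 0) \<and> (\<forall>bs. dec bs \<longrightarrow> f (ww bs) = (if bs = \<beta> then 1 else 0))"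
proof -
  define val :: "nat list \<Rightarrow> complex" where "val = (\<lambda>bs. if bs = \<beta> then 1 else 0)"
  obtain f where f: "lin sc f" "\<And>n x. n < 0 \<Longrightarrow> f (l n x) = 0" "\<And>bs. dec bs \<Longrightarrow> f (ww bs) = val bs"
    using extension_by_words[of val] by blast
  interpret w3_l_functional sc vac pr L W c al ga be \<theta> f
    by unfold_locales (use f in auto)
  have vac: "f vac = 0" using f(3)[of "[]"] \<beta> by (auto simp: val_def)
  have F2: "f x = 0" if "x \<in> F 2" for x
  proof (rule f_F2_zero[OF vac _ that])
    fix a b :: nat assume "a \<ge> b"
    then show "f (ww [a, b]) = 0" using f(3)[of "[a, b]"] \<beta> by (auto simp: val_def)
  qed
  have "ww [a, b] \<in> F 2" for a b using ww_F[of "[a, b]"] by (simp add: numeral_2_eq_2)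
  then have two: "f (ww [a, b]) = 0" for a b using F2 by blast
  have "admissible f (wt [] \<beta>)"
  proof (rule admissibleI[OF f])
    show "of_nat (Suc a) * f (ww [Suc a, b]) + of_nat (Suc b) * f (ww [a, Suc b]) = 0" for a b
      by (simp only: two mult_zero_right add_0)
  qed (use \<beta> in \<open>auto simp: val_def\<close>)
  then show ?thesis using F2 f(3) by (auto simp: val_def)
qed

lemma ev_F2: "x \<in> F 2 \<Longrightarrow> ev x"
  unfolding F_def by (rule ev_span) (auto intro: ev_mon)

lemma F2_words: "ww [a, b] \<in> F 2"
  using ww_F[of "[a, b]"] by (simp add: numeral_2_eq_2)

lemma U_ww: "U n = ww [n, 0]"
  by (simp add: U_def)

text \<open>In each term of the iterate formula the inner mode of \<open>W\<close> is nonnegative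
  and contracts with the word, so the number of factors does not rise above two.\<close>

lemma pr_U_F2:
  assumes "q \<ge> 0" shows "pr q (U a) (ww [b1, b2]) \<in> F 2"
proof -
  obtain N where N: "pr q (pr (-1 - int a) W W) (ww [b1, b2]) = (\<Sum>j<N. sc ((-1) ^ j * (of_int (-1 - int a) gchoose j))
       (w (-1 - int a - int j) (w (q + int j) (ww [b1, b2])) - sc (isign (-1 - int a)) (w (-1 - int a + q - int j) (w (int j) (ww [b1, b2])))))"
    using iterate_ex[of q "-1 - int a" W W "ww [b1, b2]"] by blast
  have 1: "w r (w (q + int j) (ww [b1, b2])) \<in> F 2" "w r (w (int j) (ww [b1, b2])) \<in> F 2" for r j
    using F_w[OF F_w_pos[of "q + int j" "[b1, b2]"], of r] F_w[OF F_w_pos[of "int j" "[b1, b2]"], of r] assms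
    by (simp_all add: numeral_2_eq_2)
  have U: "U a = pr (-1 - int a) W W"
    by (simp add: U_def W_w[symmetric])
  show ?thesis unfolding U N
    by (intro subspace_sum[OF F_subspace] subspace_scale[OF F_subspace] subspace_diff[OF F_subspace] 1)
qed

lemma qwt_pos: "qs \<noteq> [] \<Longrightarrow> qwt qs > 0"
proof (cases qs)
  case (Cons t qs')
  obtain k i where "t = (k, i)" by (cases t)
  then show ?thesis using Cons gwt_pos[of i] by simp
qed simp

lemma T_pow_U0: "T (T (U 0)) = sc 2 (ww [2, 0]) + sc 2 (ww [1, 1]) + sc 2 (ww [0, 2])"
proof -
  have "sc 2 x = x + x" for x
    by (metis one_add_one scale_left_distrib scale_one)
  then show ?thesis by (simp add: U_def T_w T_linear pr_bilinear add_ac)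
qed

end

section \<open>Products of generators in weights up to 14\<close>

context w3_functional
begin

lemma f_T_F2: "z \<in> F 2 \<Longrightarrow> f (T z) = 0"
proof -
  assume z: "z \<in> F 2"
  have lf: "lin sc (\<lambda>z. f (T z))" using lin_f by (simp add: lin_def T_linear)
  show ?thesis
  proof (rule lin_span_zero[OF lf z[unfolded F_def]])
    fix y assume "y \<in> {lw as (ww bs) |as bs. length bs \<le> 2 \<and> even (length bs + 2)}"
    then obtain "as" bs where y: "y = lw as (ww bs)" and bs: "length bs \<le> 2" "even (length bs)" by auto
    show "f (T y) = 0"
    proof (cases "as")
      case (Cons a as')
      then show ?thesis using y bs by (simp add: T_l f_linear f_l ev_mon ev_T)
    next
      case Nil
      consider "bs = []" | a b where "bs = [a, b]"
        using bs by (cases bs rule: remdups_adj.cases) auto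
      then show ?thesis using y Nil by cases (simp_all add: f_0 f_T)
    qed
  qed
qed

lemma f_mode_vac_F2:
  assumes z: "z \<in> F 2" and N: "N \<le> -2" shows "f (pr N z vac) = 0"
proof -
  define k where "k = nat (-2 - N)"
  have "(T ^^ k) z \<in> F 2" using z by (induction k) (auto simp: T_eq_l0 intro: F_l)
  then have "f ((T ^^ Suc k) z) = 0" by (simp add: f_T_F2)
  then have "fact (Suc k) * f (pr (-1 - int (Suc k)) z vac) = 0"
    unfolding pr_neg_vac[symmetric] f_sc .
  then have "f (pr (-1 - int (Suc k)) z vac) = 0" by (simp only: mult_eq_0_iff fact_nonzero simp_thms)
  moreover have "-1 - int (Suc k) = N" using N by (simp add: k_def)
  ultimately show ?thesis by simp
qed

text \<open>The modes of \<open>L\<close> are commuted out to the left, where they are killed. Every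
  correction has a mode number at most \<open>-2\<close>, which keeps the induction going; with no
  \<open>L\<close> left, such a mode on \<open>vac\<close> is a total derivative.\<close>

lemma f_F2_lw:
  "x \<in> F 2 \<Longrightarrow> N \<le> -2 \<or> as \<noteq> [] \<and> N \<le> -1 \<Longrightarrow> f (pr N x (lw as vac)) = 0"
proof (induction "as" arbitrary: x N)
  case Nil
  then show ?case by (simp add: f_mode_vac_F2)
next
  case (Cons a as)
  obtain M where M: "\<And>m k z. pr m L (pr k x z) = pr k x (pr m L z)
    + (\<Sum>j<M. sc (of_int m gchoose j) (pr (m + k - int j) (pr (int j) L x) z))"
    using commutator_ex[of L x] by blast
  have ev: "ev (lw as vac)" using ev_mon[of "[]" "as"] by simp
  have "f (pr (-1 - int a + N - int j) (l (int j) x) (lw as vac)) = 0" for j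
    by (rule Cons.IH) (use Cons.prems F_l in auto)
  then have "f (l (-1 - int a) (pr N x (lw as vac))) = f (pr N x (l (-1 - int a) (lw as vac)))"
    unfolding M by (simp add: f_linear f_sum)
  moreover have "f (l (-1 - int a) (pr N x (lw as vac))) = 0"
    using ev ev_F2[OF Cons.prems(1)] by (simp add: f_l ev_pr)
  ultimately show ?case by simp
qed

lemma f_lw_mode:
  "ev x \<Longrightarrow> N \<le> -2 \<Longrightarrow> f (pr N (lw as vac) x) = 0"
proof (induction "as" arbitrary: x N)
  case Nil
  then show ?case by (simp add: pr_vac_left f_0)
next
  case (Cons a as)
  have ev: "ev (lw as vac)" using ev_mon[of "[]" "as"] by simp
  obtain M where M: "pr N (pr (-1 - int a) L (lw as vac)) x = (\<Sum>j<M. sc ((-1) ^ j * (of_int (-1 - int a) gchoose j))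
       (pr (-1 - int a - int j) L (pr (N + int j) (lw as vac) x) - sc (isign (-1 - int a)) (pr (-1 - int a + N - int j) (lw as vac) (pr (int j) L x))))"
    using iterate_ex[of N "-1 - int a" L "lw as vac" x] by blast
  have "f (pr (-1 - int a + N - int j) (lw as vac) (l (int j) x)) = 0" for j
    by (rule Cons.IH) (use Cons.prems in auto)
  then show ?case using Cons.prems ev unfolding lw_simps M by (simp add: f_sum f_linear f_l ev_pr)
qed

lemma f_U_l: "x \<in> F 2 \<Longrightarrow> z \<in> F 0 \<Longrightarrow> n < 0 \<Longrightarrow> f (pr (-1) x (l n z)) = 0"
proof -
  assume x: "x \<in> F 2" and z: "z \<in> F 0" and n: "n < 0"
  obtain a where a: "n = -1 - int a" using n neg_int by blast
  have lf: "lin sc (\<lambda>z. f (pr (-1) x (l n z)))" by (simp add: lin_def pr_bilinear f_linear)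
  show ?thesis
  proof (rule lin_span_zero[OF lf z[unfolded F_def]])
    fix y assume "y \<in> {lw as (ww bs) |as bs. length bs \<le> 0 \<and> even (length bs + 0)}"
    then obtain "as" where y: "y = lw as vac" by auto
    show "f (pr (-1) x (l n y)) = 0" using f_F2_lw[OF x, of "-1" "a # as"] by (simp add: y a)
  qed
qed

lemma f_l_mode: "ev x \<Longrightarrow> z \<in> F 0 \<Longrightarrow> N \<le> -2 \<Longrightarrow> f (pr N z x) = 0"
proof -
  assume x: "ev x" and z: "z \<in> F 0" and N: "N \<le> -2"
  have lf: "lin sc (\<lambda>z. f (pr N z x))" by (simp add: lin_def pr_bilinear f_linear)
  show ?thesis
    by (rule lin_span_zero[OF lf z[unfolded F_def]]) (use f_lw_mode[OF x N] in auto)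
qed

text \<open>In the skew-symmetry formula at \<open>n = -1\<close> all terms after the first are
  derivatives of elements of \<open>F 2\<close>.\<close>

lemma f_skew:
  assumes "\<And>q. q \<ge> 0 \<Longrightarrow> pr q a b \<in> F 2"
  shows "f (pr (-1) b a) = f (pr (-1) a b)"
proof -
  obtain N where N: "\<And>j. j \<ge> N \<Longrightarrow> pr (-1 + int j) a b = 0" using truncation_nat by blast
  have "pr (-1) b a = sc (- isign (-1)) (\<Sum>j<Suc N. sc ((-1) ^ j) (pr (-1 - int j) (pr (-1 + int j) a b) vac))"
    by (rule skew) (use N in auto)
  then have "f (pr (-1) b a) = (\<Sum>j<Suc N. (-1) ^ j * f (pr (-1 - int j) (pr (-1 + int j) a b) vac))"
    by (simp add: isign_def f_sum f_linear)
  also have "\<dots> = f (pr (-1) a b) + (\<Sum>j<N. (-1) ^ Suc j * f (pr (-1 - int (Suc j)) (pr (-1 + int (Suc j)) a b) vac))"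
    by (subst sum.lessThan_Suc_shift) (simp add: pr_creation)
  also have "(\<Sum>j<N. (-1) ^ Suc j * f (pr (-1 - int (Suc j)) (pr (-1 + int (Suc j)) a b) vac)) = 0"
    by (rule sum.neutral) (auto intro!: f_mode_vac_F2 assms)
  finally show ?thesis by simp
qed

lemma f_U0_commute: "f (pr (-1) (U 0) (ww [0, 2])) = f (pr (-1) (U 0) (ww [2, 0]))"
proof -
  have z: "l n vac \<in> F 0" "l n (l n' vac) \<in> F 0" for n n'
    using F_l[OF F_mon[of "[]" 0 "[]"], of n] F_l[OF F_l[OF F_mon[of "[]" 0 "[]"], of n'], of n] by simp_all
  have vac: "vac \<in> F 0" using F_mon[of "[]" 0 "[]"] by simp
  have U: "U 0 \<in> F 2" unfolding U_ww by (rule F2_words)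
  show ?thesis
    by (simp add: w_w_modes[of "-1" "-3" vac] norm f_linear f_U_l[OF U] z vac)
qed

text \<open>In weight 14 the products of two quadratic fields span a space on which, modulo the killed
  subspace, only two values are free; the remaining ones follow from skew-symmetry and the relation.\<close>

lemma weight_14_products:
  assumes c: "475 * c * c - 5590 * c - 181248 = 0"
    and Y3: "f (pr (-2) (U 0) (ww [1, 0])) = 0" and Y4: "f (pr (-1) (U 0) (ww [2, 0])) = 0"
  shows "f (pr (-1) (U 0) (ww [1, 1])) = 0" "f (pr (-1) (U 2) (ww [0, 0])) = 0"
    "f (pr (-3) (U 0) (ww [0, 0])) = 0" "f (pr (-1) (U 0) (l (-1) (ww [0, 0]))) = 0"
proof -
  have "(- 5 * (11 * 2 + 73) * (2 + 1) * (2 + 3) * al + 16 * (2 + 6) * (46 + 129 * 2 - 2 * 2) * ga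
     + 32 * (2 + 6) * (2 + 8) * (23 * 2 - 1) * be) * 32 = 0"
    unfolding critical_coefficient using c by simp
  then have z: "- 5 * (11 * 2 + 73) * (2 + 1) * (2 + 3) * al + 16 * (2 + 6) * (46 + 129 * 2 - 2 * 2) * ga
     + 32 * (2 + 6) * (2 + 8) * (23 * 2 - 1) * be = 0"
    by (metis mult_eq_0_iff zero_neq_numeral)
  \<comment> \<open>At the critical charge the coefficient of \<open>f (U 8)\<close> vanishes, so
    the first relation constrains the products alone.\<close>
  have "2 * f (pr (-1) (U 0) (w (-2) (w (-2) vac))) - f (pr (-2) (U 0) (w (-2) (w (-1) vac))) = 0"
    using relation_1_even[of 2] by (simp only: of_nat_numeral z mult_zero_left mult_zero_right)
  then show Y5: "f (pr (-1) (U 0) (ww [1, 1])) = 0" using Y3 by simp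
  have "f (pr (-1) (U 2) (U 0)) = f (pr (-1) (U 0) (U 2))"
    by (rule f_skew) (unfold U_ww[of 2], rule pr_U_F2)
  then show "f (pr (-1) (U 2) (ww [0, 0])) = 0" using Y4 by (simp add: U_ww)
  \<comment> \<open>Skew-symmetry for the second derivative of \<open>U 0\<close>: one side is twice
    the product of order \<open>-3\<close>, the other combines products already known to be
    killed.\<close>
  have "f (pr (-1) (T (T (U 0))) (U 0)) = f (pr (-1) (U 0) (T (T (U 0))))"
    by (rule f_skew) (unfold T_pow_U0 pr_add_right pr_scale_right,
      intro subspace_add[OF F_subspace] subspace_scale[OF F_subspace] pr_U_F2)
  also have "\<dots> = 0" using Y4 Y5 f_U0_commute by (simp add: T_pow_U0 pr_bilinear f_linear)
  finally show Y2: "f (pr (-3) (U 0) (ww [0, 0])) = 0"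
    using pr_T_pow[of 2 "U 0" "U 0"] by (simp add: eval_nat_numeral f_linear U_ww)
  obtain M where M: "\<And>m k z. pr m L (pr k (U 0) z) = pr k (U 0) (pr m L z)
    + (\<Sum>j<M. sc (of_int m gchoose j) (pr (m + k - int j) (pr (int j) L (U 0)) z))"
    using commutator_ex[of L "U 0"] by blast
  have ev: "ev (U 0)" by (simp add: U_def)
  \<comment> \<open>The corrections from moving \<open>l (-1)\<close> past \<open>U 0\<close>:
    \<open>j = 0\<close> is a derivative and \<open>j = 1\<close> the weight, both multiples of the
    product of order \<open>-3\<close>; for \<open>j >= 2\<close> only fields made of
    \<open>L\<close> remain.\<close>
  have "f (pr (-2 - int j) (l (int j) (U 0)) (U 0)) = 0" for j
  proof -
    consider "j = 0" | "j = 1" | "j \<ge> 2" by linarith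
    then show ?thesis
    proof cases
      case 1
      then show ?thesis using Y2 by (simp add: T_eq_l0[symmetric] pr_T_left f_linear U_ww)
    next
      case 2
      have "l 1 (U 0) = sc 6 (U 0)" using U_E[of 0] by (simp add: E_def V_def)
      then show ?thesis using Y2 2 by (simp add: pr_bilinear f_linear U_ww)
    next
      case 3
      have "l (int j) (U 0) = sc (of_int (2 * int j + 1)) (w (int (j - 2)) W)"
        using 3 by (simp add: U_def l_w w_vac l_vac pr_bilinear W_w[symmetric] of_nat_diff LW)
      moreover have "w (int i) W \<in> F 0" for i
        using mode_LL_closed[OF F_subspace[of 0] F_l, where y = vac and r = "-1" and j = i] F_mon[of "[]" 0 "[]"] by (simp add: pr_creation)
      ultimately show ?thesis using ev by (simp add: pr_bilinear f_linear f_l_mode)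
    qed
  qed
  then have "f (l (-1) (pr (-1) (U 0) (U 0))) = f (pr (-1) (U 0) (l (-1) (U 0)))"
    unfolding M by (simp add: f_linear f_sum)
  then show "f (pr (-1) (U 0) (l (-1) (ww [0, 0]))) = 0"
    using ev by (simp add: f_l ev_pr U_ww)
qed

text \<open>With \<open>n <= 8\<close> the right factor has weight at most 8, so its words have at
  most two factors \<open>W\<close>. Those without \<open>W\<close> are killed by
  \<open>f_F2_lw\<close>; the others are the finitely many products of weight 12 and 14, of which
  \<open>l (-1) (ww [0, 0])\<close> is the only right factor containing \<open>L\<close>.\<close>

lemma f_U_product:
  assumes weight: "\<And>e x. e \<noteq> int n + 6 \<Longrightarrow> x \<in> E e \<Longrightarrow> f x = 0"
    and n: "even n" "n \<le> 8"
    and n6: "n = 6 \<Longrightarrow> f (pr (-1) (U 0) (ww [0, 0])) = 0"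
    and n8: "n = 8 \<Longrightarrow> 475 * c * c - 5590 * c - 181248 = 0 \<and> f (pr (-2) (U 0) (ww [1, 0])) = 0
      \<and> f (pr (-1) (U 0) (ww [2, 0])) = 0"
    and y: "y \<in> E q" "q > 0" and n': "even n'"
  shows "f (pr (-1 - int k) (U n') y) = 0"
proof (cases "int n' + int k + q = int n")
  case False
  have "pr (-1 - int k) (U n') y \<in> E (int n' + int k + q + 6)" by (rule E_pr[OF U_E y(1)]) simp
  then show ?thesis by (rule weight[rotated]) (use False in simp)
next
  case True
  have lf: "lin sc (\<lambda>y. f (pr (-1 - int k) (U n') y))" by (simp add: lin_def pr_bilinear f_linear)
  show ?thesis
  proof (rule lin_span_zero[OF lf E_span[OF y(1)]])
    fix z assume "z \<in> {lw as (ww bs) |as bs. dec as \<and> dec bs \<and> even (length bs) \<and> int (wt as bs) = q}"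
    then obtain "as" bs where z: "z = lw as (ww bs)" and bs: "dec bs" "even (length bs)" "int (wt as bs) = q" by blast
    then have w: "n' + k + wt as bs = n" using True by simp
    have U2: "U n' \<in> F 2" unfolding U_ww by (rule F2_words)
    consider "bs = []" | a b where "bs = [a, b]" | a b c' d bs' where "bs = a # b # c' # d # bs'"
    proof (cases bs rule: remdups_adj.cases)
      case (3 a b xs)
      then show ?thesis using bs(2) that by (cases xs rule: remdups_adj.cases) auto
    qed (use bs(2) that in auto)
    then show "f (pr (-1 - int k) (U n') z) = 0"
    proof cases
      case 1
      then have "as \<noteq> []" using bs y by (auto simp: wt_def)
      then show ?thesis using f_F2_lw[OF U2, of "-1 - int k" "as"] z 1 by simp
    next
      case (2 a b)
      show ?thesis
      proof (cases "as")
        case Nil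
        have ab: "n' + k + a + b + 6 = n" "b \<le> a" using w bs 2 Nil by (auto simp: wt_def)
        have "n = 6 \<or> n = 8" using ab(1) n by presburger
        then consider "n = 6" | "n = 8" by blast
        then show ?thesis
        proof cases
          case 1
          then show ?thesis using ab n6 z 2 Nil by simp
        next
          case 8: 2
          note W14 = weight_14_products[OF n8[OF 8, THEN conjunct1] n8[OF 8, THEN conjunct2, THEN conjunct1]
              n8[OF 8, THEN conjunct2, THEN conjunct2]]
          have "n' = 2 \<and> k = 0 \<and> a = 0 \<and> b = 0 \<or> n' = 0 \<and> k = 2 \<and> a = 0 \<and> b = 0
            \<or> n' = 0 \<and> k = 1 \<and> a = 1 \<and> b = 0 \<or> n' = 0 \<and> k = 0 \<and> a = 2 \<and> b = 0 \<or> n' = 0 \<and> k = 0 \<and> a = 1 \<and> b = 1"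
            using ab 8 n' by presburger
          then show ?thesis using W14 n8[OF 8] z 2 Nil by (elim disjE) simp_all
        qed
      next
        case (Cons a' as')
        then have "wt as bs \<ge> 8" using 2 by (simp add: wt_def)
        moreover have "wt as bs = a' + 2 + a + b + 6 + wt as' []" using 2 Cons by (simp add: wt_def)
        moreover have "as' = []" if "wt as' [] = 0" using that by (cases as') (auto simp: wt_def)
        ultimately have e: "n = 8" "n' = 0" "k = 0" "a' = 0" "a = 0" "b = 0" "as' = []" using w n by auto
        show ?thesis using weight_14_products(4) n8[OF e(1)] e z 2 Cons by simp
      qed
    next
      case (3 a b c' d bs')
      then have "wt as bs \<ge> 12" by (simp add: wt_def)
      then show ?thesis using w n by simp
    qed
  qed
qed

lemma f_gmon_zero:
  assumes weight: "\<And>e x. e \<noteq> int n + 6 \<Longrightarrow> x \<in> E e \<Longrightarrow> f x = 0"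
    and prod: "\<And>y q n' k. y \<in> E q \<Longrightarrow> q > 0 \<Longrightarrow> even n' \<Longrightarrow> f (pr (-1 - int k) (U n') y) = 0"
    and i: "\<And>i. i \<in> snd ` set qs \<Longrightarrow> gwt i \<noteq> n + 6"
  shows "f (gmon qs) = 0"
proof (cases qs)
  case Nil
  then show ?thesis using weight[OF _ E_vac] by simp
next
  case (Cons t qs')
  obtain k j where t: "t = (k, j)" by (cases t)
  have e: "gmon qs' \<in> E (int (qwt qs'))" by (rule gmon_E)
  show ?thesis
  proof (cases "j = 0")
    case True
    then show ?thesis using e by (simp add: Cons t gen_def f_l E_def)
  next
    case j: False
    then have U: "gen j = U (2 * (j - 1))" by (simp add: gen_def)
    show ?thesis
    proof (cases "qs' = []")
      case False
      then have "qwt qs' > 0" by (rule qwt_pos)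
      then show ?thesis using prod[OF e] by (simp add: Cons t U)
    next
      case True
      show ?thesis
      proof (cases k)
        case 0
        have "gwt j \<noteq> n + 6" using i Cons t by simp
        then have "f (gen j) = 0" by (intro weight[OF _ gen_E]) auto
        then show ?thesis using True 0 by (simp add: Cons t pr_creation)
      next
        case (Suc k')
        have "gen j \<in> F 2" unfolding U U_ww by (rule F2_words)
        then show ?thesis using f_mode_vac_F2[of "gen j" "-1 - int k"] True Suc by (simp add: Cons t)
      qed
    qed
  qed
qed

end

context w3
begin

text \<open>Quartic functionals vanish on \<open>F 2\<close>, hence subtracting them does not change
  the value at \<open>U n\<close>. They are used to cancel the values at one product for
  \<open>n = 6\<close> and at two products for \<open>n = 8\<close>; for smaller \<open>n\<close>
  nothing has to be cancelled.\<close>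

lemma obstruction:
  assumes n: "even n" "n \<le> 8" and crit: "n = 8 \<Longrightarrow> 475 * c * c - 5590 * c - 181248 = 0"
  shows "\<exists>f. lin sc f \<and> f (U n) = 1 \<and> (\<forall>qs. (\<forall>i\<in>snd ` set qs. gwt i \<noteq> n + 6) \<longrightarrow> f (gmon qs) = 0)"
proof -
  obtain f0 where f0: "admissible f0 (n + 6)" "f0 (U n) = 1"
    using quadratic_functional[OF n(1)] by blast
  have lead: "pr (-1) (U 0) (ww [a, b]) - ww [0, 0, a, b] \<in> F 2" for a b
    using Wick_ww[of "[a, b]" 0 0] by (simp add: U_def numeral_2_eq_2)
  have swap: "g (ww xs) = g (ww ys)" if "lin sc g" "\<forall>x\<in>F 2. g x = 0" "ww xs - ww ys \<in> F 2" for g xs ys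
  proof -
    have "g (ww xs) = g ((ww xs - ww ys) + ww ys)" by simp
    then show ?thesis using that unfolding lin_def by (metis add_0)
  qed
  have sw: "ww (xs @ a # b # ys) - ww (xs @ b # a # ys) \<in> F 2" if "length xs + length ys = 2" for xs a b ys
    using ww_swap[of xs a b ys] that by simp
  have eval: "g x = g (ww ys)" if "lin sc g" "\<forall>x\<in>F 2. g x = 0" "x - ww ys \<in> F 2" for g x ys
  proof -
    have "g x = g ((x - ww ys) + ww ys)" by simp
    then show ?thesis using that unfolding lin_def by (metis add_0)
  qed
  have "\<exists>f. admissible f (n + 6) \<and> f (U n) = 1
     \<and> (n = 6 \<longrightarrow> f (pr (-1) (U 0) (ww [0, 0])) = 0)
     \<and> (n = 8 \<longrightarrow> f (pr (-2) (U 0) (ww [1, 0])) = 0 \<and> f (pr (-1) (U 0) (ww [2, 0])) = 0)"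
  proof -
    consider "n \<noteq> 6" "n \<noteq> 8" | "n = 6" | "n = 8" by blast
    then show ?thesis
    proof cases
      case 1
      then show ?thesis using f0 by blast
    next
      case 2
      obtain g where g: "admissible g 12" "\<forall>x\<in>F 2. g x = 0"
        "\<forall>bs. dec bs \<longrightarrow> g (ww bs) = (if bs = [0, 0, 0, 0] then 1 else 0)"
        using quartic_functional[of "[0, 0, 0, 0]"] by (auto simp: wt_def)
      have lg: "lin sc g" using g(1) by (simp add: admissible_def)
      have X: "g (pr (-1) (U 0) (ww [0, 0])) = 1"
        using eval[OF lg g(2) lead[of 0 0]] g(3)[rule_format, of "[0, 0, 0, 0]"] by simp
      have Un: "g (U n) = 0" using g(2) F2_words[of n 0] by (simp add: U_ww)
      let ?r = "f0 (pr (-1) (U 0) (ww [0, 0]))"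
      have "admissible (\<lambda>x. f0 x - ?r * g x) (n + 6)"
        using f0(1) g(1) 2 by (intro admissible_diff) simp_all
      then show ?thesis using X Un f0(2) 2 by (intro exI[of _ "\<lambda>x. f0 x - ?r * g x"]) simp
    next
      case 3
      obtain g where g: "admissible g 14" "\<forall>x\<in>F 2. g x = 0"
        "\<forall>bs. dec bs \<longrightarrow> g (ww bs) = (if bs = [2, 0, 0, 0] then 1 else 0)"
        using quartic_functional[of "[2, 0, 0, 0]"] by (auto simp: wt_def)
      obtain h where h: "admissible h 14" "\<forall>x\<in>F 2. h x = 0"
        "\<forall>bs. dec bs \<longrightarrow> h (ww bs) = (if bs = [1, 1, 0, 0] then 1 else 0)"
        using quartic_functional[of "[1, 1, 0, 0]"] by (auto simp: wt_def)
      have lin: "lin sc g" "lin sc h" using g(1) h(1) by (simp_all add: admissible_def)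
      have Un: "g (U n) = 0" "h (U n) = 0" using g(2) h(2) F2_words[of n 0] by (simp_all add: U_ww)
      let ?X = "pr (-1) (U 0) (ww [2, 0])" and ?Y = "pr (-2) (U 0) (ww [1, 0])"
      have X: "k ?X = k (ww [2, 0, 0, 0])" if k: "lin sc k" "\<forall>x\<in>F 2. k x = 0" for k
      proof -
        have "k ?X = k (ww [0, 0, 2, 0])" by (rule eval[OF k lead])
        also have "\<dots> = k (ww [0, 2, 0, 0])" using swap[OF k sw[of "[0]" "[0]" 0 2]] by simp
        also have "\<dots> = k (ww [2, 0, 0, 0])" using swap[OF k sw[of "[]" "[0, 0]" 0 2]] by simp
        finally show ?thesis .
      qed
      have TU: "T (U 0) = w (-1 - int 1) (w (-1 - int 0) vac) + w (-1 - int 0) (w (-1 - int 1) vac)"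
        by (simp add: U_def T_w pr_bilinear)
      have "?Y = pr (-1) (T (U 0)) (ww [1, 0])" by (simp add: pr_T_left)
      then have "?Y = pr (-1) (w (-1 - int 1) (w (-1 - int 0) vac)) (ww [1, 0]) + pr (-1) (w (-1 - int 0) (w (-1 - int 1) vac)) (ww [1, 0])"
        unfolding TU by (simp only: pr_add_left)
      moreover have "pr (-1) (w (-1 - int a) (w (-1 - int b) vac)) (ww [1, 0]) - ww [a, b, 1, 0] \<in> F 2" for a b
        using Wick_ww[of "[1, 0]" a b] by (simp add: numeral_2_eq_2)
      ultimately have Y0: "k ?Y = k (ww [1, 0, 1, 0]) + k (ww [0, 1, 1, 0])" if k: "lin sc k" "\<forall>x\<in>F 2. k x = 0" for k
        using eval[OF k] k(1) unfolding lin_def by metis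
      have Y: "k ?Y = 2 * k (ww [1, 1, 0, 0])" if k: "lin sc k" "\<forall>x\<in>F 2. k x = 0" for k
      proof -
        have "k (ww [0, 1, 1, 0]) = k (ww [1, 0, 1, 0])" using swap[OF k sw[of "[]" "[1, 0]" 0 1]] by simp
        moreover have "k (ww [1, 0, 1, 0]) = k (ww [1, 1, 0, 0])" using swap[OF k sw[of "[1]" "[0]" 0 1]] by simp
        ultimately show ?thesis using Y0[OF k] by simp
      qed
      have dec: "dec [2, 0, 0, 0]" "dec [1, 1, 0, 0]" by simp_all
      have vals: "g ?X = 1" "h ?X = 0" "g ?Y = 0" "h ?Y = 2"
        unfolding X[OF lin(1) g(2)] X[OF lin(2) h(2)] Y[OF lin(1) g(2)] Y[OF lin(2) h(2)]
        using g(3)[rule_format, OF dec(1)] g(3)[rule_format, OF dec(2)] h(3)[rule_format, OF dec(1)] h(3)[rule_format, OF dec(2)]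
        by simp_all
      \<comment> \<open>\<open>g\<close> and \<open>h\<close> take the values 1 and 0 on
        \<open>?X\<close>, and 0 and 2 on \<open>?Y\<close>. The 2 arises because both summands of
        \<open>T (U 0)\<close> lead to the word \<open>[1, 1, 0, 0]\<close>; hence the division by
        2.\<close>
      let ?f = "\<lambda>x. (f0 x - f0 ?X * g x) - f0 ?Y / 2 * h x"
      have "admissible ?f (n + 6)"
        using f0(1) g(1) h(1) 3 by (intro admissible_diff) simp_all
      then show ?thesis using vals Un f0(2) 3 by (intro exI[of _ ?f]) (simp del: ww_simps)
    qed
  qed
  then obtain f where f: "admissible f (n + 6)" "f (U n) = 1"
    "n = 6 \<Longrightarrow> f (pr (-1) (U 0) (ww [0, 0])) = 0"
    "n = 8 \<Longrightarrow> f (pr (-2) (U 0) (ww [1, 0])) = 0 \<and> f (pr (-1) (U 0) (ww [2, 0])) = 0" by blast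
  interpret w3_functional sc vac pr L W c al ga be \<theta> f
    by (rule admissible_functional[OF f(1)])
  have weight: "f x = 0" if "e \<noteq> int n + 6" "x \<in> E e" for e x
    using f(1) that by (auto simp: admissible_def)
  have "f (pr (-1 - int k) (U n') y) = 0" if "y \<in> E q" "q > 0" "even n'" for y q n' k
    by (rule f_U_product[OF weight n f(3) _ that]) (use f(4) crit in auto)
  then have "f (gmon qs) = 0" if "\<forall>i\<in>snd ` set qs. gwt i \<noteq> n + 6" for qs
    by (intro f_gmon_zero[OF weight]) (use that in auto)
  then show ?thesis using f(2) lin_f by blast
qed

lemma obstruction_L:
  "\<exists>f. lin sc f \<and> f L = 1 \<and> (\<forall>qs. (\<forall>i\<in>snd ` set qs. gwt i \<noteq> 2) \<longrightarrow> f (gmon qs) = 0)"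
proof -
  obtain f where f: "lin sc f" "\<And>as bs. dec as \<and> dec bs \<Longrightarrow> f (lw as (ww bs)) = (if as = [0] \<and> bs = [] then 1 else 0 :: complex)"
    using linear_extension[of "\<lambda>as bs. if as = [0] \<and> bs = [] then 1 else 0"] by blast
  have "f (gmon qs) = 0" if qs: "\<forall>i\<in>snd ` set qs. gwt i \<noteq> 2" for qs
  proof -
    have "qwt qs \<noteq> 2"
    proof (cases qs)
      case (Cons t qs')
      obtain k i where t: "t = (k, i)" by (cases t)
      then have "gwt i > 2" using qs Cons gwt_pos[of i] by (simp add: nat_neq_iff)
      then show ?thesis by (simp add: Cons t)
    qed simp
    then show ?thesis
      by (intro lin_span_zero[OF f(1) E_span[OF gmon_E]]) (auto simp: f(2) wt_def)
  qed
  moreover have "f L = 1" using f(2)[of "[0]" "[]"] by (simp add: pr_creation)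
  ultimately show ?thesis using f(1) by blast
qed

section \<open>Strong generation and minimality in terms of derivatives\<close>

lemma nmon_gmon:
  "\<exists>r. r \<noteq> 0 \<and> nmon vac pr (map (\<lambda>(k, a). der vac pr k a) (map (\<lambda>(k, i). (k, gen i)) qs)) = sc r (gmon qs)"
proof (induction qs)
  case Nil
  show ?case by (rule exI[of _ 1]) simp
next
  case (Cons t qs)
  obtain k i where t: "t = (k, i)" by (cases t)
  from Cons obtain r where "r \<noteq> 0" "nmon vac pr (map (\<lambda>(k, a). der vac pr k a) (map (\<lambda>(k, i). (k, gen i)) qs)) = sc r (gmon qs)" by blast
  then show ?case by (intro exI[of _ "fact k * r"]) (simp add: t der_def pr_T_pow pr_bilinear)
qed

lemma strongly_generates_gen:
  assumes r: "r \<ge> 1"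
    and kill: "\<And>f n. w3_functional sc vac pr L W c al ga be \<theta> f \<Longrightarrow> f vac = 0 \<Longrightarrow> decomposable_killing f
      \<Longrightarrow> even n \<Longrightarrow> n \<ge> 2 * (r - 1) \<Longrightarrow> f (U n) = 0"
  shows "strongly_generates sc vac pr (gen ` {..<r}) {x. \<theta> x = x}"
proof -
  let ?M = "{nmon vac pr (map (\<lambda>(k, a). der vac pr k a) ps) | ps. \<forall>p\<in>set ps. snd p \<in> gen ` {..<r}}"
  have "ev y" if "y \<in> ?M" for y
  proof -
    have "ev (nmon vac pr (map (\<lambda>(k, a). der vac pr k a) ps))" if "\<forall>p\<in>set ps. snd p \<in> gen ` {..<r}" for ps
      using that
    proof (induction ps)
      case (Cons p ps)
      obtain k i where p: "p = (k, gen i)" using Cons.prems by (cases p) auto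
      have "ev (gen i)" using gen_E by (simp add: E_def)
      then have "ev (der vac pr k (gen i))" unfolding der_def by (induction k) (auto intro: ev_T)
      then show ?case using Cons p by (simp add: ev_pr)
    qed simp
    then show ?thesis using that by blast
  qed
  then have 1: "span ?M \<subseteq> {x. ev x}"
    by (intro span_minimal ev_subspace) blast
  have g: "gmon qs \<in> span ?M" if "snd ` set qs \<subseteq> {..<r}" for qs
  proof -
    let ?ps = "map (\<lambda>(k, i). (k, gen i)) qs"
    obtain s where s: "s \<noteq> 0" "nmon vac pr (map (\<lambda>(k, a). der vac pr k a) ?ps) = sc s (gmon qs)"
      using nmon_gmon[of qs] by blast
    have "\<forall>p\<in>set ?ps. snd p \<in> gen ` {..<r}" using that by force
    then have "sc s (gmon qs) \<in> span ?M" unfolding s(2)[symmetric] by (intro span_base CollectI exI[of _ ?ps]) auto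
    from span_scale[OF this, of "1 / s"] show ?thesis using s(1) by simp
  qed
  have "Gs {..<r} d \<subseteq> span ?M" for d
    unfolding Gs_def by (rule span_minimal[OF _ subspace_span]) (use g in blast)
  then have "lw as (ww bs) \<in> span ?M" if "even (length bs)" for "as" bs
  proof -
    have "E (int (wt as bs)) \<subseteq> Gs {..<r} (int (wt as bs))"
      by (rule generation[OF r]) (rule kill)
    then show ?thesis using \<open>\<And>d. Gs {..<r} d \<subseteq> span ?M\<close> E_mon[OF that, of "as"] by blast
  qed
  then have "{lw as (ww bs) | as bs. dec as \<and> dec bs \<and> even (length bs)} \<subseteq> span ?M" by blast
  then have "span {lw as (ww bs) | as bs. dec as \<and> dec bs \<and> even (length bs)} \<subseteq> span ?M"
    by (rule span_minimal[OF _ subspace_span])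
  then have "{x. ev x} \<subseteq> span ?M" using ev_mon_span by blast
  then show ?thesis using 1 unfolding strongly_generates_def ev_def by blast
qed

lemma gwt_inj: "gwt i = gwt j \<Longrightarrow> i = j"
  by (auto simp: gwt_def split: if_splits)

text \<open>Every generator has a functional with value 1 on it that kills all words avoiding it. A
  proper subset omits some generator, so it cannot generate. Distinctness of the generators follows
  from their weights.\<close>

lemma of_type_gen:
  assumes r: "r \<ge> 1" "r \<le> 6" and crit: "r = 6 \<Longrightarrow> 475 * c * c - 5590 * c - 181248 = 0"
    and kill: "\<And>f n. w3_functional sc vac pr L W c al ga be \<theta> f \<Longrightarrow> f vac = 0 \<Longrightarrow> decomposable_killing f
      \<Longrightarrow> even n \<Longrightarrow> n \<ge> 2 * (r - 1) \<Longrightarrow> f (U n) = 0"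
  shows "of_type sc vac pr L {x. \<theta> x = x} (map gwt [0..<r])"
proof -
  have obs: "\<exists>f. lin sc f \<and> f (gen i) = 1 \<and> (\<forall>qs. i \<notin> snd ` set qs \<longrightarrow> f (gmon qs) = 0)" if "i < r" for i
  proof (cases "i = 0")
    case True
    obtain f where f: "lin sc f" "f L = 1" "\<forall>qs. (\<forall>i\<in>snd ` set qs. gwt i \<noteq> 2) \<longrightarrow> f (gmon qs) = 0"
      using obstruction_L by blast
    have j: "gwt j \<noteq> 2" if "j \<noteq> i" for j
      using True that by (simp add: gwt_def)
    have "f (gmon qs) = 0" if "i \<notin> snd ` set qs" for qs
    proof -
      have "\<forall>x\<in>snd ` set qs. gwt x \<noteq> 2"
      proof
        fix x assume "x \<in> snd ` set qs"
        then have "x \<noteq> i" using that by auto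
        then show "gwt x \<noteq> 2" by (rule j)
      qed
      then show ?thesis using f(3) by simp
    qed
    then show ?thesis using True f by (intro exI[of _ f]) (simp add: gen_def)
  next
    case False
    define n where "n = 2 * (i - 1)"
    have n: "even n" "n \<le> 8" "n + 6 = gwt i" "gen i = U n"
      using False that r by (auto simp: n_def gwt_def gen_def)
    have "n = 8 \<Longrightarrow> r = 6" using that r by (simp add: n_def)
    then obtain f where f: "lin sc f" "f (U n) = 1" "\<forall>qs. (\<forall>i\<in>snd ` set qs. gwt i \<noteq> n + 6) \<longrightarrow> f (gmon qs) = 0"
      using obstruction[OF n(1,2)] crit by blast
    have j: "gwt j \<noteq> n + 6" if "j \<noteq> i" for j
      using gwt_inj[of j i] that n(3) by auto
    have "f (gmon qs) = 0" if "i \<notin> snd ` set qs" for qs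
    proof -
      have "\<forall>x\<in>snd ` set qs. gwt x \<noteq> n + 6"
      proof
        fix x assume "x \<in> snd ` set qs"
        then have "x \<noteq> i" using that by auto
        then show "gwt x \<noteq> n + 6" by (rule j)
      qed
      then show ?thesis using f(3) by simp
    qed
    then show ?thesis using n(4) f by (intro exI[of _ f]) simp
  qed
  have nz: "gen i \<noteq> 0" if i: "i < r" for i
  proof
    assume "gen i = 0"
    moreover obtain f where "lin sc f" "f (gen i) = 1" using obs[OF i] by blast
    ultimately show False unfolding lin_def by (metis mult_zero_left scale_zero_left zero_neq_one)
  qed
  have inj: "inj_on gen {..<r}"
  proof (rule inj_onI)
    fix i j assume ij: "i \<in> {..<r}" "j \<in> {..<r}" "gen i = gen j"
    have "sc (of_int (int (gwt i))) (gen i) = sc (of_int (int (gwt j))) (gen i)"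
      using gen_E[of i] gen_E[of j] ij(3) by (simp add: E_def V_def)
    then have "gwt i = gwt j" using nz[of i] ij(1) by simp
    then show "i = j" by (rule gwt_inj)
  qed
  have min: "\<not> strongly_generates sc vac pr S' {x. \<theta> x = x}" if S': "S' \<subset> gen ` {..<r}" for S'
  proof
    assume sg: "strongly_generates sc vac pr S' {x. \<theta> x = x}"
    obtain i where i: "i < r" "gen i \<notin> S'" using S' by auto
    obtain f where f: "lin sc f" "f (gen i) = 1" "\<forall>qs. i \<notin> snd ` set qs \<longrightarrow> f (gmon qs) = 0"
      using obs[OF i(1)] by blast
    have "gen i \<in> {x. \<theta> x = x}" using gen_E[of i] by (simp add: E_def ev_def)
    then have "gen i \<in> span {nmon vac pr (map (\<lambda>(k, a). der vac pr k a) ps) | ps. \<forall>p\<in>set ps. snd p \<in> S'}"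
      unfolding sg[unfolded strongly_generates_def, symmetric] .
    then have "f (gen i) = 0"
    proof (rule lin_span_zero[OF f(1)])
      fix y assume "y \<in> {nmon vac pr (map (\<lambda>(k, a). der vac pr k a) ps) | ps. \<forall>p\<in>set ps. snd p \<in> S'}"
      then obtain ps where y: "y = nmon vac pr (map (\<lambda>(k, a). der vac pr k a) ps)" and ps: "\<forall>p\<in>set ps. snd p \<in> S'" by blast
      \<comment> \<open>Choosing preimages turns words in elements of \<open>S'\<close> into words
        in indexed generators, none of which is \<open>i\<close>.\<close>
      define ix where "ix = (\<lambda>a. SOME j. j < r \<and> gen j = a)"
      have ix: "ix a < r \<and> gen (ix a) = a" if "a \<in> S'" for a
        unfolding ix_def by (rule someI_ex) (use that S' in auto)
      define qs where "qs = map (\<lambda>(k, a). (k, ix a)) ps"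
      have "map (\<lambda>(k, i). (k, gen i)) qs = ps"
        unfolding qs_def using ps ix by (auto simp: comp_def split_def intro!: map_idI)
      moreover have "i \<notin> snd ` set qs"
        using ps ix i(2) by (force simp: qs_def)
      ultimately show "f y = 0"
        using nmon_gmon[of qs] f(1,3) unfolding y lin_def by auto
    qed
    then show False using f(2) by simp
  qed
  show ?thesis unfolding of_type_def
  proof (intro exI[of _ gen] conjI allI impI)
    show "inj_on gen {..<length (map gwt [0..<r])}" using inj by simp
    show "gen i \<in> {x. \<theta> x = x}" for i using gen_E[of i] by (simp add: E_def ev_def)
    show "pr 1 L (gen i) = sc (of_nat (map gwt [0..<r] ! i)) (gen i)" if "i < length (map gwt [0..<r])" for i
      using gen_E[of i] that by (simp add: E_def V_def)
    show "strongly_generates sc vac pr (gen ` {..<length (map gwt [0..<r])}) {x. \<theta> x = x}"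
      unfolding length_map length_upt diff_zero by (rule strongly_generates_gen[OF r(1)]) (rule kill)
  qed (use min in simp)
qed

lemma orbifold_type:
  "475 * c * c - 5590 * c - 181248 \<noteq> 0 \<Longrightarrow> of_type sc vac pr L {x. \<theta> x = x} [2, 6, 8, 10, 12]"
  "475 * c * c - 5590 * c - 181248 = 0 \<Longrightarrow> of_type sc vac pr L {x. \<theta> x = x} [2, 6, 8, 10, 12, 14]"
proof -
  assume c: "475 * c * c - 5590 * c - 181248 \<noteq> 0"
  have "of_type sc vac pr L {x. \<theta> x = x} (map gwt [0..<5])"
    by (rule of_type_gen) (use c in \<open>auto intro!: w3_functional.decomposable_killing_U\<close>)
  moreover have "map gwt [0..<5] = [2, 6, 8, 10, 12]" by (simp add: gwt_def upt_rec)
  ultimately show "of_type sc vac pr L {x. \<theta> x = x} [2, 6, 8, 10, 12]" by simp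
next
  assume c: "475 * c * c - 5590 * c - 181248 = 0"
  have "of_type sc vac pr L {x. \<theta> x = x} (map gwt [0..<6])"
    by (rule of_type_gen) (use c in \<open>auto intro!: w3_functional.decomposable_killing_U\<close>)
  moreover have "map gwt [0..<6] = [2, 6, 8, 10, 12, 14]" by (simp add: gwt_def upt_rec)
  ultimately show "of_type sc vac pr L {x. \<theta> x = x} [2, 6, 8, 10, 12, 14]" by simp
qed

end

lemma w3_of_is_W3:
  assumes W3: "is_W3 sc vac pr c L W" and \<theta>: "va_automorphism sc vac pr \<theta>" "\<theta> L = L" "\<theta> W = - W"
  shows "\<exists>al ga be. w3 sc vac pr L W c al ga be \<theta>"
proof -
  interpret va sc vac pr using W3 by unfold_locales (simp add: is_W3_def)
  have der: "der vac pr 1 x = T x" "der vac pr (Suc 0) x = T x" "der vac pr 2 x = T (T x)" "der vac pr 3 x = T (T (T x))" for x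
    by (simp_all add: der_def eval_nat_numeral)
  have opes: "W3_opes sc vac pr c L W" using W3 by (simp add: is_W3_def)
  have pbw: "inj_on (pbw_mon vac pr L W) pbw_index" "independent (pbw_mon vac pr L W ` pbw_index)"
    "span (pbw_mon vac pr L W ` pbw_index) = UNIV"
    using W3 by (simp_all add: is_W3_def)
  show ?thesis
  proof (cases "c = - 22 / 5")
    case True
    have "w3 sc vac pr L W c 0 0 32 \<theta>"
      by unfold_locales (use opes \<theta> pbw in \<open>auto simp: W3_opes_def True der\<close>)
    then show ?thesis by blast
  next
    case False
    have nz: "22 + 5 * c \<noteq> 0"
    proof
      assume "22 + 5 * c = 0"
      then have "5 * c = - 22" by (simp add: add_eq_0_iff)
      then have "c = - 22 / 5" by (metis nonzero_mult_div_cancel_left zero_neq_numeral)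
      then show False using False by simp
    qed
    \<comment> \<open>This identity for \<open>ga - be\<close> turns the constants
      \<open>3 / 10\<close> and \<open>1 / 15\<close> of the unified OPE into the coefficients of
      the second and third derivative of \<open>L\<close>.\<close>
    have e0: "1 - 32 / (22 + 5 * c) = 5 * (c - 2) / (22 + 5 * c)"
      using nz by (simp add: field_simps)
    have g: "3 / 10 * (5 * x / D) = 3 * x / (2 * D)" "5 * x / D / 15 = x / (3 * D)" for x D :: complex
      by simp_all
    have e1: "3 / 10 * (1 - 32 / (22 + 5 * c)) = 3 * (c - 2) / (2 * (22 + 5 * c))"
      and e2: "(1 - 32 / (22 + 5 * c)) / 15 = (c - 2) / (3 * (22 + 5 * c))"
      unfolding e0 by (rule g)+
    have "w3 sc vac pr L W c (c / 3) 1 (32 / (22 + 5 * c)) \<theta>"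
    proof unfold_locales
      show "pr n W W = (if n = 5 then sc (c / 3) vac else if n = 3 then sc (2 * 1) L else if n = 2 then sc 1 (T L)
         else if n = 1 then sc (32 / (22 + 5 * c)) (pr (-1) L L) + sc (3 / 10 * (1 - 32 / (22 + 5 * c))) (T (T L))
         else if n = 0 then sc (32 / (22 + 5 * c)) (pr (-1) (T L) L) + sc ((1 - 32 / (22 + 5 * c)) / 15) (T (T (T L)))
         else 0)" if "n \<ge> 0" for n
        unfolding e1 e2 using opes that False by (simp add: W3_opes_def der)
      show "32 * 1 = 32 / (22 + 5 * c) * (22 + 5 * c)"
        by (simp only: times_divide_eq_left nonzero_mult_div_cancel_right[OF nz] mult_1_right)
    qed (use opes \<theta> pbw nz in \<open>auto simp: W3_opes_def der\<close>)
    then show ?thesis by blast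
  qed
qed

theorem theorem1p1:
  fixes sc :: "complex \<Rightarrow> 'v::ab_group_add \<Rightarrow> 'v"
    and vac :: 'v and pr :: "int \<Rightarrow> 'v \<Rightarrow> 'v \<Rightarrow> 'v"
    and c :: complex and L W :: 'v and \<theta> :: "'v \<Rightarrow> 'v"
  assumes "is_W3 sc vac pr c L W"
    and "va_automorphism sc vac pr \<theta>" and "\<theta> L = L" and "\<theta> W = - W"
  shows "(c \<noteq> of_real ((559 + 7 * sqrt 76657) / 95) \<and> c \<noteq> of_real ((559 - 7 * sqrt 76657) / 95)
           \<longrightarrow> of_type sc vac pr L {x. \<theta> x = x} [2, 6, 8, 10, 12])
       \<and> ((c = of_real ((559 + 7 * sqrt 76657) / 95) \<or> c = of_real ((559 - 7 * sqrt 76657) / 95))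
           \<longrightarrow> of_type sc vac pr L {x. \<theta> x = x} [2, 6, 8, 10, 12, 14])"
proof -
  obtain al ga be where "w3 sc vac pr L W c al ga be \<theta>"
    using w3_of_is_W3[OF assms] by blast
  then interpret w3 sc vac pr L W c al ga be \<theta> .
  show ?thesis
    using orbifold_type critical_charge[of c] critical_charge_converse[of c] by blast
qed

end
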